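(* Let $L\ge 1$ be an integer and let $a,b\in\{0,1\}^L$ satisfy $b\notin\{a,a^R,\bar a,\bar a^R\}$. Let $p_c=\mathrm{P}\{Y_1=c\}$ for $c=\pm1$. Then, as $n\to\infty$, \[ \varphi_n(a,b)=\frac{(p_1-p_{-1})2^L+\mu_{1,-1}-\mu_{-1,1}}{\sqrt{2^{L+2}\,p\,q\,\pi n}}+o(1/\sqrt n). \]
   Context: $(X_i,i\ge1)$ is a symmetric Bernoulli process: i.i.d. random variables with $\mathrm{P}\{X_i=0\}=\mathrm{P}\{X_i=1\}=1/2$. For a word $x=(x_1,\dots,x_L)\in\{0,1\}^L$, $x^R=(x_L,\dots,x_1)$ is its reversal, $\bar x=(1-x_1,\dots,1-x_L)$ its conjugate, and $\bar x^R$ the reversal of $\bar x$. For a word $y$ of length $m\ge 1$, $C_n(y)=\sum_{k=m}^n \mathbf 1\{(X_{k-m+1},\dots,X_k)=y\}$ is the number of (possibly overlapping) occurrences of $y$ in $X_1,\dots,X_n$ (equal to $0$ if $n<m$). Define \[\varphi_n(a,b)=\mathrm{P}\{C_n(a)>C_n(b)\}-\mathrm{P}\{C_n(a)<C_n(b)\}.\] For $t\ge L$ let $(X)^L_t=(X_{t-L+1},\dots,X_t)$; for $t<L$ let $(X)^L_t$ be the empty word. Let $T_0=0$ and $T_k=\min\{t>T_{k-1}:(X)^L_t\in\{a,b\}\}$ for $k\ge1$ (almost surely finite). Let $Y_k=1$ if $(X)^L_{T_k}=a$ and $Y_k=-1$ if $(X)^L_{T_k}=b$. The sequence $(Y_k)_{k\ge1}$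 is a time-homogeneous Markov chain on $\{\pm1\}$ and $\mathrm{P}\{Y_2=1\mid Y_1=1\}=\mathrm{P}\{Y_2=-1\mid Y_1=-1\}$; this common value is denoted $p$, and $q=1-p$. For $c,e=\pm1$, $\mu_{c,e}=\mathrm{E}[(T_2-T_1)\mathbf 1\{Y_2=e\}\mid Y_1=c]$. *)

theory Defs
  imports "HOL-Probability.Probability" "HOL-Library.Landau_Symbols"
begin

text \<open>Words over the alphabet $\{0,1\}$ are boolean lists, with \<open>False\<close> for 0 and \<open>True\<close> for 1.\<close>

definition conjugate :: "bool list \<Rightarrow> bool list" where
  "conjugate x = map Not x"

text \<open>The process is indexed from 1; \<open>X 0\<close> is unconstrained and is never used below.\<close>

locale symmetric_bernoulli = prob_space M for M :: "'a measure" +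
  fixes X :: "nat \<Rightarrow> 'a \<Rightarrow> bool"
  assumes indep: "indep_vars (\<lambda>_. count_space UNIV) X {1..}"
    and prob_0: "\<And>i. i \<ge> 1 \<Longrightarrow> \<P>(\<omega> in M. X i \<omega> = False) = 1 / 2"
    and prob_1: "\<And>i. i \<ge> 1 \<Longrightarrow> \<P>(\<omega> in M. X i \<omega> = True) = 1 / 2"

definition window :: "(nat \<Rightarrow> 'a \<Rightarrow> bool) \<Rightarrow> nat \<Rightarrow> nat \<Rightarrow> 'a \<Rightarrow> bool list" where
  "window X L t \<omega> = (if t \<ge> L then map (\<lambda>i. X i \<omega>) [t - L + 1..<t + 1] else [])"

definition occurrences :: "(nat \<Rightarrow> 'a \<Rightarrow> bool) \<Rightarrow> bool list \<Rightarrow> nat \<Rightarrow> 'a \<Rightarrow> nat" where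
  "occurrences X y n \<omega> = card {k \<in> {length y..n}. window X (length y) k \<omega> = y}"

definition phi ::
    "'a measure \<Rightarrow> (nat \<Rightarrow> 'a \<Rightarrow> bool) \<Rightarrow> bool list \<Rightarrow> bool list \<Rightarrow> nat \<Rightarrow> real" where
  "phi M X a b n =
     \<P>(\<omega> in M. occurrences X a n \<omega> > occurrences X b n \<omega>)
     - \<P>(\<omega> in M. occurrences X a n \<omega> < occurrences X b n \<omega>)"

text \<open>The set whose minimum is taken is almost surely nonempty; on the exceptional null event
  \<open>LEAST\<close> returns an unspecified number.\<close>

primrec hit_time ::
    "(nat \<Rightarrow> 'a \<Rightarrow> bool) \<Rightarrow> nat \<Rightarrow> bool list \<Rightarrow> bool list \<Rightarrow> nat \<Rightarrow> 'a \<Rightarrow> nat" where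
  "hit_time X L a b 0 \<omega> = 0"
| "hit_time X L a b (Suc k) \<omega> =
     (LEAST t. t > hit_time X L a b k \<omega> \<and> window X L t \<omega> \<in> {a, b})"

text \<open>The value 0 can occur for $k \ge 1$ only on that null event.\<close>

definition hit_sign ::
    "(nat \<Rightarrow> 'a \<Rightarrow> bool) \<Rightarrow> nat \<Rightarrow> bool list \<Rightarrow> bool list \<Rightarrow> nat \<Rightarrow> 'a \<Rightarrow> int" where
  "hit_sign X L a b k \<omega> =
     (if window X L (hit_time X L a b k \<omega>) \<omega> = a then 1
      else if window X L (hit_time X L a b k \<omega>) \<omega> = b then - 1
      else 0)"

definition init_prob ::
    "'a measure \<Rightarrow> (nat \<Rightarrow> 'a \<Rightarrow> bool) \<Rightarrow> nat \<Rightarrow> bool list \<Rightarrow> bool list \<Rightarrow> int \<Rightarrow> real" where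
  "init_prob M X L a b c = \<P>(\<omega> in M. hit_sign X L a b 1 \<omega> = c)"

text \<open>For distinct words of length $L$ this equals
  $\mathrm{P}\{Y_2=-1 \mid Y_1=-1\}$, where $Y_k$ is \<^term>\<open>hit_sign X L a b k\<close>.\<close>

definition stay_prob ::
    "'a measure \<Rightarrow> (nat \<Rightarrow> 'a \<Rightarrow> bool) \<Rightarrow> nat \<Rightarrow> bool list \<Rightarrow> bool list \<Rightarrow> real" where
  "stay_prob M X L a b = \<P>(\<omega> in M. hit_sign X L a b 2 \<omega> = 1 \<bar> hit_sign X L a b 1 \<omega> = 1)"

text \<open>Elementary conditional expectation of $(T_2-T_1)\mathbf 1\{Y_2=e\}$ given the event
  $\{Y_1=c\}$, that is, $\mathrm{E}[Z\,\mathbf 1_A]/\mathrm{P}(A)$.\<close>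

definition mu ::
    "'a measure \<Rightarrow> (nat \<Rightarrow> 'a \<Rightarrow> bool) \<Rightarrow> nat \<Rightarrow> bool list \<Rightarrow> bool list \<Rightarrow> int \<Rightarrow> int \<Rightarrow> real" where
  "mu M X L a b c e =
     (\<integral>\<omega>. (real (hit_time X L a b 2 \<omega>) - real (hit_time X L a b 1 \<omega>))
            * indicator {\<omega>. hit_sign X L a b 2 \<omega> = e} \<omega>
            * indicator {\<omega>. hit_sign X L a b 1 \<omega> = c} \<omega> \<partial>M)
     / \<P>(\<omega> in M. hit_sign X L a b 1 \<omega> = c)"

end

theory Submission
  imports Defs "HOL-Complex_Analysis.Complex_Analysis"
begin

text \<open>
  Let \<open>D\<close> be the number of occurrences of \<open>a\<close> minus the number of occurrences of \<open>b\<close> after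
  \<open>n\<close> steps, so that the quantity to be estimated is the expectation of \<open>sgn D\<close>. The occurrences of
  the two words form a Markov renewal process with two states. Let \<open>pa, qa, pb, qb\<close> be the generating
  functions, in a variable \<open>X\<close> that marks time, of the transitions from \<open>a\<close> to \<open>a\<close>, \<open>a\<close> to \<open>b\<close>,
  \<open>b\<close> to \<open>b\<close> and \<open>b\<close> to \<open>a\<close>, and let \<open>ta, tb\<close> be those of the probabilities that no transition has
  happened yet. Write \<open>x j\<close> and \<open>y j\<close> for the generating functions of the expected sign when the
  process has just produced \<open>a\<close>, respectively \<open>b\<close>, and the difference is now \<open>j\<close>. Conditioning on the
  next occurrence gives
  \<open>x j = sgn j * ta + pa * x (j + 1) + qa * y (j - 1)\<close> and a similar equation for \<open>y j\<close>.

  Since each transition takes time, this system determines its solution as formal power series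
  (\<open>linear_system_unique\<close>). Away from level 0 the solution is a constant plus a geometric sequence
  in \<open>j\<close>, whose ratio solves a quadratic equation; the discriminant of the latter is
  \<open>(1 - X) * \<Delta>'\<close>. Matching the two geometric halves at level 0 (\<open>walk_system_solution\<close>,
  \<open>boundary_values\<close>) shows that the generating function of the expected sign is
  \<open>H * (1 - X) powr (- 1/2)\<close>, where \<open>H\<close> is built from the hitting series, \<open>sqrt (1 - X)\<close> and
  \<open>sqrt \<Delta>'\<close>. If the coefficients of \<open>H\<close> are absolutely summable and \<open>o(1/n)\<close>, the coefficients of
  this product are asymptotically \<open>H(1) / sqrt (pi * n)\<close> (\<open>transfer_inv_sqrt\<close>). This class of series
  is an algebra, it contains \<open>sqrt (1 - X)\<close> and every series of radius of convergence above 1, and it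
  contains \<open>1 / (1 - g)\<close> when it contains \<open>g\<close>, \<open>g(0) = 0\<close> and the coefficients of \<open>g\<close> have absolute sum below 1;
  the hitting series have radius above 1 because waiting times have geometric tails.

  Two facts depend on the words. First, \<open>\<Delta>'\<close> has no zero in the closed unit disc, so that
  \<open>sqrt \<Delta>'\<close> also has radius above 1: at a zero \<open>z \<noteq> 1\<close> the triangle inequality would force \<open>z ^ n = 1\<close>
  for the lengths \<open>n\<close> of all round trips, while inserting a long run of a letter \<open>c\<close> between
  two occurrences yields round trips of consecutive lengths; such a letter exists unless the two words
  are the two constant words, which are conjugate to each other. Second, the probability \<open>p\<close> of staying is positive:
  if occurrences of \<open>a\<close> and \<open>b\<close> always alternated, then the type of the last occurrence would be a
  function of the last \<open>L - 1\<close> letters, which is only possible if \<open>b\<close> is the reversal, the conjugate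
  or the reversed conjugate of \<open>a\<close> (\<open>alternation_forces_reverse_or_conjugate\<close>).

  The value \<open>H(1)\<close> is then read off, using that a given word ends at time \<open>n\<close> with
  probability \<open>2 ^ (- L)\<close> for every \<open>n \<ge> L\<close>. Comparing the corresponding expected numbers
  of visits of the two words with the transition series yields that both words have the same
  probability of staying and that their mean waiting times add up to \<open>2 ^ L\<close>.
\<close>

section \<open>Power series on the closed unit disc\<close>

definition abs_conv :: "real fps \<Rightarrow> bool" where
  "abs_conv f \<longleftrightarrow> summable (\<lambda>n. \<bar>fps_nth f n\<bar>)"

text \<open>Real series are evaluated at complex points when zeros are excluded, and at the real point 1 when
  constants are computed; hence the polymorphic target.\<close>

definition ev :: "real fps \<Rightarrow> 'a :: {banach, real_normed_field} \<Rightarrow> 'a" where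
  "ev f z = (\<Sum>n. of_real (fps_nth f n) * z ^ n)"

lemma abs_conv_0: "abs_conv 0"
  and abs_conv_const: "abs_conv (fps_const c)"
  and abs_conv_X: "abs_conv fps_X"
proof -
  show "abs_conv 0" by (simp add: abs_conv_def)
  show "abs_conv (fps_const c)"
    unfolding abs_conv_def by (rule summable_finite[of "{0}"]) auto
  show "abs_conv fps_X"
    unfolding abs_conv_def by (rule summable_finite[of "{1}"]) (auto simp: fps_X_def)
qed

lemma abs_conv_1: "abs_conv 1"
  using abs_conv_const[of 1] by simp

lemma abs_conv_numeral: "abs_conv (numeral k)"
  using abs_conv_const[of "numeral k"] by (simp add: numeral_fps_const)

lemma abs_conv_add:
  assumes "abs_conv f" "abs_conv g" shows "abs_conv (f + g)"
  unfolding abs_conv_def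
  by (rule summable_comparison_test'[where N = 0,
        OF summable_add[OF assms[unfolded abs_conv_def]]]) auto

lemma abs_conv_uminus: "abs_conv f \<Longrightarrow> abs_conv (- f)"
  by (simp add: abs_conv_def)

lemma abs_conv_diff: "abs_conv f \<Longrightarrow> abs_conv g \<Longrightarrow> abs_conv (f - g)"
  using abs_conv_add[OF _ abs_conv_uminus] by simp

lemma abs_conv_mult:
  assumes "abs_conv f" "abs_conv g" shows "abs_conv (f * g)"
proof -
  have "summable (\<lambda>n. \<Sum>i\<le>n. \<bar>fps_nth f i\<bar> * \<bar>fps_nth g (n - i)\<bar>)"
    using assms by (intro summable_Cauchy_product) (simp_all add: abs_conv_def)
  then show ?thesis
    unfolding abs_conv_def
    by (rule summable_comparison_test'[where N = 0])
      (auto simp: fps_mult_nth atLeast0AtMost abs_mult[symmetric] intro: sum_abs)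
qed

lemma abs_conv_power: "abs_conv f \<Longrightarrow> abs_conv (f ^ n)"
  by (induction n) (auto intro: abs_conv_mult abs_conv_1)

lemmas abs_conv_intros = abs_conv_0 abs_conv_1 abs_conv_const abs_conv_X abs_conv_numeral
  abs_conv_add abs_conv_uminus abs_conv_diff abs_conv_mult abs_conv_power

context
  fixes z :: "'a :: {banach, real_normed_field}"
  assumes z: "norm z \<le> 1"
begin

lemma norm_summable_ev:
  assumes "abs_conv f" shows "summable (\<lambda>n. norm (of_real (fps_nth f n) * z ^ n))"
proof (rule summable_comparison_test'[where N = 0])
  show "summable (\<lambda>n. \<bar>fps_nth f n\<bar>)" using assms by (simp add: abs_conv_def)
  show "norm (norm (of_real (fps_nth f n) * z ^ n)) \<le> \<bar>fps_nth f n\<bar>" for n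
    using z by (simp add: norm_mult norm_power mult_left_le power_le_one)
qed

lemma summable_ev: "abs_conv f \<Longrightarrow> summable (\<lambda>n. of_real (fps_nth f n) * z ^ n)"
  by (rule summable_norm_cancel[OF norm_summable_ev])

lemma ev_add: "abs_conv f \<Longrightarrow> abs_conv g \<Longrightarrow> ev (f + g) z = ev f z + ev g z"
  unfolding ev_def by (simp add: suminf_add summable_ev ring_distribs)

lemma ev_diff: "abs_conv f \<Longrightarrow> abs_conv g \<Longrightarrow> ev (f - g) z = ev f z - ev g z"
  unfolding ev_def by (simp add: suminf_diff summable_ev ring_distribs)

lemma ev_uminus: "abs_conv f \<Longrightarrow> ev (- f) z = - ev f z"
  unfolding ev_def by (simp add: suminf_minus summable_ev)

lemma ev_mult:
  assumes "abs_conv f" "abs_conv g" shows "ev (f * g) z = ev f z * ev g z"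
proof -
  have "ev f z * ev g z =
      (\<Sum>n. \<Sum>i\<le>n. (of_real (fps_nth f i) * z ^ i) * (of_real (fps_nth g (n - i)) * z ^ (n - i)))"
    unfolding ev_def by (intro Cauchy_product norm_summable_ev assms)
  also have "\<dots> = (\<Sum>n. of_real (fps_nth (f * g) n) * z ^ n)"
  proof (intro suminf_cong)
    fix n
    have *: "(of_real (fps_nth f i) * z ^ i) * (of_real (fps_nth g (n - i)) * z ^ (n - i))
        = of_real (fps_nth f i * fps_nth g (n - i)) * z ^ n" if "i \<le> n" for i
      using that power_add[of z i "n - i"] by (simp add: mult_ac)
    have "(\<Sum>i\<le>n. (of_real (fps_nth f i) * z ^ i) * (of_real (fps_nth g (n - i)) * z ^ (n - i)))
        = (\<Sum>i\<le>n. of_real (fps_nth f i * fps_nth g (n - i)) * z ^ n)"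
      by (rule sum.cong[OF refl], rule *) simp
    then show "(\<Sum>i\<le>n. (of_real (fps_nth f i) * z ^ i) * (of_real (fps_nth g (n - i)) * z ^ (n - i)))
        = of_real (fps_nth (f * g) n) * z ^ n"
      by (simp add: fps_mult_nth atLeast0AtMost sum_distrib_right)
  qed
  finally show ?thesis by (simp add: ev_def)
qed

end

lemma ev_const [simp]: "ev (fps_const c) z = of_real c"
proof -
  have "ev (fps_const c) z = (\<Sum>n\<in>{0}. of_real (fps_nth (fps_const c) n) * z ^ n)"
    unfolding ev_def by (rule suminf_finite) auto
  then show ?thesis by simp
qed

lemma ev_0 [simp]: "ev 0 z = 0" and ev_1 [simp]: "ev 1 z = 1"
  using ev_const[of 0 z] ev_const[of 1 z] by simp_all

lemma ev_numeral [simp]: "ev (numeral k) z = numeral k"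
  using ev_const[of "numeral k" z] by (simp add: numeral_fps_const)

lemma ev_X [simp]: "ev fps_X z = z"
proof -
  have "ev fps_X z = (\<Sum>n\<in>{1}. of_real (fps_nth fps_X n) * z ^ n)"
    unfolding ev_def by (rule suminf_finite) (auto simp: fps_X_def)
  then show ?thesis by simp
qed

lemma ev_power: "norm z \<le> 1 \<Longrightarrow> abs_conv f \<Longrightarrow> ev (f ^ n) z = ev f z ^ n"
  by (induction n) (auto simp: ev_mult abs_conv_power)

lemma ev_of_real: "abs_conv f \<Longrightarrow> ev f (of_real x :: complex) = of_real (ev f x)"
  if "\<bar>x\<bar> \<le> 1"
  using summable_ev[of x f] that
  by (simp add: ev_def suminf_of_real)

lemmas ev_simps = ev_add ev_diff ev_uminus ev_mult ev_power

section \<open>Series with summable coefficients of order o(1/n)\<close>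

text \<open>This is the regularity that makes the factor \<open>(1 - X) powr (- 1/2)\<close> dominate in a product. A bound
  \<open>O(1/n)\<close> would leave an error of the same order as the main term.\<close>

definition small_tail :: "real fps \<Rightarrow> bool" where
  "small_tail f \<longleftrightarrow> abs_conv f \<and> (\<lambda>n. real n * fps_nth f n) \<longlonglongrightarrow> 0"

text \<open>Each weight \<open>b i\<close> meets the limit of \<open>a\<close>, and dominated convergence for series
  exchanges the limit with the sum.\<close>

lemma convolution_tendsto:
  fixes a b :: "nat \<Rightarrow> real"
  assumes a: "a \<longlonglongrightarrow> A" and b: "summable (\<lambda>n. \<bar>b n\<bar>)"
  shows "(\<lambda>n. \<Sum>i\<le>n. b i * a (n - i)) \<longlonglongrightarrow> suminf b * A"
proof -
  obtain K where K: "\<And>n. \<bar>a n\<bar> \<le> K"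
    using Bseq_eq_bounded[of a] convergent_imp_Bseq[of a] a
    by (auto simp: convergent_def Bseq_def)
  define c where "c = (\<lambda>k n. if k \<le> n then b k * a (n - k) else 0)"
  have "(\<lambda>n. suminf (\<lambda>k. c k n)) \<longlonglongrightarrow> suminf (\<lambda>k. b k * A)"
  proof (rule tannerys_theorem[THEN conjunct2, THEN conjunct2])
    show "(\<lambda>n. c k n) \<longlonglongrightarrow> b k * A" for k
    proof (rule Lim_transform_eventually)
      show "(\<lambda>n. b k * a (n - k)) \<longlonglongrightarrow> b k * A"
        by (intro tendsto_mult tendsto_const filterlim_compose[OF a] filterlim_minus_const_nat_at_top)
      show "\<forall>\<^sub>F n in sequentially. b k * a (n - k) = c k n"
        using eventually_ge_at_top[of k] by eventually_elim (simp add: c_def)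
    qed
    show "\<forall>\<^sub>F (k, n) in at_top \<times>\<^sub>F sequentially. norm (c k n) \<le> \<bar>b k\<bar> * K"
      using K order_trans[OF abs_ge_zero K]
      by (intro always_eventually) (auto simp: c_def abs_mult intro!: mult_left_mono)
    show "summable (\<lambda>k. \<bar>b k\<bar> * K)" using b by (rule summable_mult2)
  qed simp
  moreover have "suminf (\<lambda>k. c k n) = (\<Sum>i\<le>n. b i * a (n - i))" for n
    by (subst suminf_finite[of "{..n}"]) (auto simp: c_def)
  moreover have "suminf (\<lambda>k. b k * A) = suminf b * A"
    using summable_rabs_cancel[OF b] by (rule suminf_mult2[symmetric])
  ultimately show ?thesis by simp
qed

lemma small_tail_uminus: "small_tail f \<Longrightarrow> small_tail (- f)"
  and small_tail_add: "small_tail f \<Longrightarrow> small_tail g \<Longrightarrow> small_tail (f + g)"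
  and small_tail_diff: "small_tail f \<Longrightarrow> small_tail g \<Longrightarrow> small_tail (f - g)"
  using tendsto_add[of "\<lambda>n. real n * fps_nth f n" 0 sequentially "\<lambda>n. real n * fps_nth g n" 0]
    tendsto_diff[of "\<lambda>n. real n * fps_nth f n" 0 sequentially "\<lambda>n. real n * fps_nth g n" 0]
    tendsto_minus[of "\<lambda>n. real n * fps_nth f n" 0 sequentially]
  by (auto simp: small_tail_def ring_distribs intro!: abs_conv_intros)

text \<open>Splitting \<open>n = i + (n - i)\<close> makes \<open>n\<close> times a coefficient of the product a sum of two convolutions, each
  of a summable sequence with a null sequence.\<close>

lemma small_tail_mult:
  assumes f: "small_tail f" and g: "small_tail g" shows "small_tail (f * g)"
proof -
  let ?f' = "\<lambda>n. real n * fps_nth f n" and ?g' = "\<lambda>n. real n * fps_nth g n"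
  have sf: "summable (\<lambda>n. \<bar>fps_nth f n\<bar>)" and sg: "summable (\<lambda>n. \<bar>fps_nth g n\<bar>)"
    and f0: "?f' \<longlonglongrightarrow> 0" and g0: "?g' \<longlonglongrightarrow> 0"
    using f g by (auto simp: small_tail_def abs_conv_def)
  have "real n * fps_nth (f * g) n
      = (\<Sum>i\<le>n. fps_nth f i * ?g' (n - i)) + (\<Sum>i\<le>n. fps_nth g i * ?f' (n - i))" for n
  proof -
    have "(\<Sum>i\<le>n. fps_nth g i * ?f' (n - i)) = (\<Sum>i\<le>n. fps_nth g (n - i) * ?f' i)"
      by (rule sum.reindex_bij_witness[of _ "\<lambda>i. n - i" "\<lambda>i. n - i"]) auto
    then have "(\<Sum>i\<le>n. fps_nth f i * ?g' (n - i)) + (\<Sum>i\<le>n. fps_nth g i * ?f' (n - i))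
      = (\<Sum>i\<le>n. real n * (fps_nth f i * fps_nth g (n - i)))"
      by (simp add: sum.distrib[symmetric] algebra_simps of_nat_diff)
    then show ?thesis by (simp add: fps_mult_nth atLeast0AtMost sum_distrib_left)
  qed
  moreover have "(\<lambda>n. (\<Sum>i\<le>n. fps_nth f i * ?g' (n - i)) + (\<Sum>i\<le>n. fps_nth g i * ?f' (n - i))) \<longlonglongrightarrow> 0"
    using tendsto_add[OF convolution_tendsto[OF g0 sf] convolution_tendsto[OF f0 sg]] by simp
  ultimately show ?thesis
    using f g by (simp add: small_tail_def abs_conv_mult)
qed

lemma small_tail_of_conv_radius:
  assumes "fps_conv_radius f > 1" shows "small_tail f"
proof -
  obtain r where r: "1 < ereal r" "ereal r < fps_conv_radius f"
    by (rule exE[OF ereal_dense2[OF assms]], erule conjE)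
  have r1: "1 < r" using r(1) by simp
  have s: "summable (\<lambda>n. norm (fps_nth f n * x ^ n))" if "\<bar>x\<bar> \<le> r" for x
  proof (rule norm_summable_fps)
    have "ereal (norm x) \<le> ereal r" using that by simp
    then show "ereal (norm x) < fps_conv_radius f" using r(2) by (rule le_less_trans)
  qed
  have "summable (\<lambda>n. fps_nth f n * r ^ n)" using s[of r] r1 by (rule_tac summable_norm_cancel) simp
  then have "(\<lambda>n. fps_nth f n * r ^ n) \<longlonglongrightarrow> 0" by (rule summable_LIMSEQ_zero)
  moreover have "(\<lambda>n. real n * (1 / r) ^ n) \<longlonglongrightarrow> 0"
    using powser_times_n_limit_0[of "1 / r"] r1 by simp
  ultimately have "(\<lambda>n. (fps_nth f n * r ^ n) * (real n * (1 / r) ^ n)) \<longlonglongrightarrow> 0 * 0"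
    by (rule tendsto_mult)
  moreover have "(fps_nth f n * r ^ n) * (real n * (1 / r) ^ n) = real n * fps_nth f n" for n
    using r1 by (simp add: field_simps)
  ultimately show ?thesis using s[of 1] r1 by (simp add: small_tail_def abs_conv_def)
qed

lemma abs_conv_of_conv_radius: "fps_conv_radius f > 1 \<Longrightarrow> abs_conv f"
  using small_tail_of_conv_radius by (auto simp: small_tail_def)

lemma conv_radius_gt_1_intros:
  fixes f g :: "real fps"
  shows "fps_conv_radius f > 1 \<Longrightarrow> fps_conv_radius g > 1 \<Longrightarrow> fps_conv_radius (f + g) > 1"
    and "fps_conv_radius f > 1 \<Longrightarrow> fps_conv_radius g > 1 \<Longrightarrow> fps_conv_radius (f - g) > 1"
    and "fps_conv_radius f > 1 \<Longrightarrow> fps_conv_radius g > 1 \<Longrightarrow> fps_conv_radius (f * g) > 1"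
    and "fps_conv_radius f > 1 \<Longrightarrow> fps_conv_radius (f ^ n) > 1"
    and "fps_conv_radius f > 1 \<Longrightarrow> fps_conv_radius (- f) > 1"
    and "fps_conv_radius f > 1 \<Longrightarrow> fps_conv_radius (fps_deriv f) > 1"
    and "fps_conv_radius (fps_const c :: real fps) > 1"
    and "fps_conv_radius (numeral k :: real fps) > 1"
    and "fps_conv_radius (1 :: real fps) > 1"
    and "fps_conv_radius (fps_X :: real fps) > 1"
  by (auto intro: less_le_trans[OF _ fps_conv_radius_add] less_le_trans[OF _ fps_conv_radius_diff]
      less_le_trans[OF _ fps_conv_radius_mult] less_le_trans[OF _ fps_conv_radius_power]
      less_le_trans[OF _ fps_conv_radius_deriv])

lemma conv_radius_gt_1_geometric:
  assumes bound: "\<And>n. \<bar>fps_nth f n\<bar> \<le> C * r ^ n" and r: "0 < r" "r < (1 :: real)"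
  shows "fps_conv_radius f > 1"
proof -
  define x where "x = (1 + 1 / r) / 2"
  have x: "1 < x" "r * x < 1" using r by (auto simp: x_def field_simps)
  have "summable (\<lambda>n. fps_nth f n * x ^ n)"
  proof (rule summable_comparison_test'[where N = 0])
    show "summable (\<lambda>n. C * (r * x) ^ n)"
      using x r by (intro summable_mult summable_geometric) auto
    show "norm (fps_nth f n * x ^ n) \<le> C * (r * x) ^ n" for n
      using mult_right_mono[OF bound, of "x ^ n" n] x
      by (simp add: abs_mult power_mult_distrib mult_ac)
  qed
  then have "fps_conv_radius f \<ge> ereal (norm x)"
    unfolding fps_conv_radius_def by (rule conv_radius_geI)
  then show ?thesis using x by (auto intro: less_le_trans[rotated])
qed

text \<open>Summability is that of a geometric series. The decay comes from differentiating:
  with \<open>h = 1 / (1 - g)\<close> one has \<open>h' = g' * h ^ 2\<close>, so \<open>n\<close> times the coefficient of \<open>h\<close> is a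
  convolution of the null sequence \<open>n * g_n\<close> with a summable one.\<close>

lemma small_tail_inverse:
  assumes g: "small_tail g" and nz: "fps_nth g 0 = 0" and lt: "(\<Sum>n. \<bar>fps_nth g n\<bar>) < 1"
  shows "small_tail (inverse (1 - g))"
proof -
  define h where "h = inverse (1 - g)"
  have unit: "(1 - g) * h = 1"
    unfolding h_def by (rule inverse_mult_eq_1') (simp add: nz)
  then have hg: "h = 1 + g * h" by (simp add: algebra_simps)
  have sg: "summable (\<lambda>n. \<bar>fps_nth g n\<bar>)" using g by (simp add: small_tail_def abs_conv_def)
  define G where "G = (\<Sum>n. \<bar>fps_nth g n\<bar>)"
  have G1: "G < 1" using lt by (simp add: G_def)
  \<comment> \<open>From h = 1 + g * h the partial sums S of the absolute values satisfy S \<le> 1 + G * S.\<close>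
  have bound: "(\<Sum>n\<le>N. \<bar>fps_nth h n\<bar>) \<le> 1 / (1 - G)" for N
  proof -
    let ?S = "\<Sum>n\<le>N. \<bar>fps_nth h n\<bar>"
    have "?S \<le> (\<Sum>n\<le>N. \<bar>fps_nth (1 :: real fps) n\<bar> + \<bar>fps_nth (g * h) n\<bar>)"
      using hg by (intro sum_mono) (metis abs_triangle_ineq fps_add_nth)
    also have "\<dots> \<le> 1 + (\<Sum>n\<le>N. \<bar>fps_nth (g * h) n\<bar>)"
      by (simp add: sum.distrib if_distrib[of abs] cong: if_cong)
    also have "(\<Sum>n\<le>N. \<bar>fps_nth (g * h) n\<bar>) \<le> (\<Sum>n\<le>N. \<Sum>i\<le>n. \<bar>fps_nth g i\<bar> * \<bar>fps_nth h (n - i)\<bar>)"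
      by (auto simp: fps_mult_nth atLeast0AtMost abs_mult[symmetric] intro!: sum_mono)
    also have "\<dots> = (\<Sum>(i, j)\<in>{(i, j). i + j \<le> N}. \<bar>fps_nth g i\<bar> * \<bar>fps_nth h j\<bar>)"
      by (rule sum.triangle_reindex_eq[symmetric])
    also have "\<dots> \<le> (\<Sum>(i, j)\<in>{..N} \<times> {..N}. \<bar>fps_nth g i\<bar> * \<bar>fps_nth h j\<bar>)"
      by (rule sum_mono2) auto
    also have "\<dots> = (\<Sum>i\<le>N. \<bar>fps_nth g i\<bar>) * ?S"
      by (simp add: sum_product sum.cartesian_product)
    also have "\<dots> \<le> G * ?S"
      unfolding G_def by (intro mult_right_mono sum_le_suminf sg sum_nonneg) auto
    finally have "?S \<le> 1 + G * ?S" by simp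
    then show ?thesis using G1 by (simp add: field_simps)
  qed
  have h1: "abs_conv h"
    unfolding abs_conv_def
    by (rule bounded_imp_summable[where B = "1 / (1 - G)"]) (use bound in auto)
  have "fps_deriv h = fps_deriv g * (h * h)"
  proof -
    have "fps_deriv ((1 - g) * h) = 0" using unit by simp
    then have "(1 - g) * fps_deriv h = fps_deriv g * h" by (simp add: algebra_simps)
    then have "h * ((1 - g) * fps_deriv h) = h * (fps_deriv g * h)" by simp
    then have "((1 - g) * h) * fps_deriv h = fps_deriv g * (h * h)" by (simp only: mult.commute mult.left_commute)
    then show ?thesis using unit by simp
  qed
  then have *: "fps_X * fps_deriv h = (h * h) * (fps_X * fps_deriv g)" by (simp add: mult_ac)
  have Xd: "fps_nth (fps_X * fps_deriv f) n = real n * fps_nth f n" for f :: "real fps" and n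
    by (cases n) auto
  have "(\<lambda>n. \<Sum>i\<le>n. fps_nth (h * h) i * fps_nth (fps_X * fps_deriv g) (n - i))
      \<longlonglongrightarrow> suminf (fps_nth (h * h)) * 0"
    using g h1 unfolding Xd
    by (intro convolution_tendsto) (auto simp: small_tail_def abs_conv_def[symmetric] intro: abs_conv_mult)
  then have "(\<lambda>n. fps_nth (fps_X * fps_deriv h) n) \<longlonglongrightarrow> 0"
    unfolding * by (simp add: fps_mult_nth[of "h * h"] atLeast0AtMost)
  then show ?thesis unfolding Xd h_def[symmetric] small_tail_def using h1 by simp
qed

section \<open>Square roots of power series\<close>

text \<open>By compactness the zeros of \<open>F\<close> stay away from the closed unit disc, so \<open>F\<close> has a
  holomorphic logarithm on a slightly larger disc; halving it gives the root and its inverse.\<close>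

lemma complex_fps_sqrt:
  fixes F :: "complex fps"
  assumes R: "fps_conv_radius F > 1" and F0: "fps_nth F 0 = 1"
    and nz: "\<And>z. norm z \<le> 1 \<Longrightarrow> eval_fps F z \<noteq> 0"
  obtains G H where "G * G = F" "G * H = 1" "fps_nth G 0 = 1"
    "fps_conv_radius G > 1" "fps_conv_radius H > 1"
proof -
  obtain r0 where r0: "1 < ereal r0" "ereal r0 < fps_conv_radius F"
    by (rule exE[OF ereal_dense2[OF R]], erule conjE)
  have holo0: "eval_fps F holomorphic_on cball 0 r0"
  proof (rule holomorphic_on_subset[OF holomorphic_on_eval_fps[OF subset_refl]], rule subsetI)
    fix z :: complex assume "z \<in> cball 0 r0"
    then have "ereal (norm z) \<le> ereal r0" by simp
    then show "z \<in> eball 0 (fps_conv_radius F)"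
      using r0(2) by (simp add: eball_def dist_norm) (metis ereal_less_eq(3) le_less_trans)
  qed
  obtain r where r: "1 < r" "r \<le> r0" "\<And>z. z \<in> ball 0 r \<Longrightarrow> eval_fps F z \<noteq> 0"
  proof (cases "\<exists>z\<in>cball 0 r0. eval_fps F z = 0")
    case False
    with r0 show ?thesis by (intro that[of r0]) auto
  next
    case True
    define K where "K = cball 0 r0 \<inter> eval_fps F -` {0}"
    have "compact K"
      unfolding K_def compact_eq_bounded_closed
      using continuous_on_closed_vimage[of "cball 0 r0" "eval_fps F"]
        holomorphic_on_imp_continuous_on[OF holo0]
      by (auto intro: bounded_subset[OF bounded_cball] simp: Int_commute)
    moreover have "K \<noteq> {}" using True by (auto simp: K_def)
    ultimately obtain z0 where z0: "z0 \<in> K" "\<And>z. z \<in> K \<Longrightarrow> norm z0 \<le> norm z"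
      using continuous_attains_inf[of K norm] by (auto intro: continuous_intros)
    show ?thesis
    proof (rule that[of "norm z0"])
      show "1 < norm z0" using z0(1) nz[of z0] by (force simp: K_def)
      show le: "norm z0 \<le> r0" using z0(1) by (simp add: K_def)
      show "eval_fps F z \<noteq> 0" if "z \<in> ball 0 (norm z0)" for z
        using that le z0(2)[of z] by (auto simp: K_def)
    qed
  qed
  have holo: "eval_fps F holomorphic_on ball 0 r"
    by (rule holomorphic_on_subset[OF holo0]) (use r in auto)
  obtain g where g: "g holomorphic_on ball 0 r" "\<And>z. z \<in> ball 0 r \<Longrightarrow> exp (g z) = eval_fps F z"
    using holomorphic_logarithm_exists[of "ball 0 r" "eval_fps F" 0] holo r by auto
  \<comment> \<open>Subtracting g 0 normalises the root to the value 1 at the origin.\<close>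
  define h k where "h = (\<lambda>z. exp ((g z - g 0) / 2))" and "k = (\<lambda>z. exp ((g 0 - g z) / 2))"
  have hk: "h holomorphic_on eball 0 (ereal r)" "k holomorphic_on eball 0 (ereal r)"
    unfolding h_def k_def by (auto intro!: holomorphic_intros g)
  define G H where "G = fps_expansion h 0" and "H = fps_expansion k 0"
  have GR: "fps_conv_radius G \<ge> ereal r" and HR: "fps_conv_radius H \<ge> ereal r"
    unfolding G_def H_def by (intro conv_radius_fps_expansion hk)+
  have evG: "eval_fps G z = h z" and evH: "eval_fps H z = k z" if "norm z < r" for z
    using eval_fps_expansion'[OF hk(1)] eval_fps_expansion'[OF hk(2)] that
    by (simp_all add: G_def H_def)
  have g0: "exp (g 0) = 1" using g(2)[of 0] r F0 by (simp add: eval_fps_at_0)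
  have hh: "h z * h z = eval_fps F z" if "norm z < r" for z
  proof -
    have "h z * h z = exp (g z) / exp (g 0)"
      unfolding h_def by (simp add: exp_add[symmetric] exp_diff[symmetric] del: exp_diff)
    then show ?thesis using g0 g(2)[of z] that by simp
  qed
  have rad: "ereal (norm z) < fps_conv_radius G" "ereal (norm z) < fps_conv_radius H" if "norm z < r" for z :: complex
    using that GR HR by (auto intro: less_le_trans[of _ "ereal r"])
  have ev: "\<forall>\<^sub>F z in nhds 0. norm (z :: complex) < r"
    using eventually_nhds_in_open[of "ball 0 r" "0 :: complex"] r by simp
  have rpos: "0 < ereal r" using r by simp
  have GG: "G * G = F"
  proof (rule eval_fps_eqD)
    show "fps_conv_radius (G * G) > 0"
      by (rule less_le_trans[OF rpos order_trans[OF _ fps_conv_radius_mult]]) (simp add: GR)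
    show "fps_conv_radius F > 0" using R by (rule less_trans[rotated]) simp
    show "\<forall>\<^sub>F z in nhds 0. eval_fps (G * G) z = eval_fps F z"
      using ev by eventually_elim (simp add: eval_fps_mult rad evG hh)
  qed
  have GH: "G * H = 1"
  proof (rule eval_fps_eqD)
    show "fps_conv_radius (G * H) > 0"
      by (rule less_le_trans[OF rpos order_trans[OF _ fps_conv_radius_mult]]) (simp add: GR HR)
    show "fps_conv_radius (1 :: complex fps) > 0" by simp
    show "\<forall>\<^sub>F z in nhds 0. eval_fps (G * H) z = eval_fps 1 z"
      using ev by eventually_elim
        (simp add: eval_fps_mult rad evG evH h_def k_def exp_add[symmetric] diff_divide_distrib)
  qed
  show ?thesis
  proof (rule that[OF GG GH])
    show "fps_nth G 0 = 1" using evG[of 0] r by (simp add: eval_fps_at_0 h_def)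
    show "fps_conv_radius G > 1" "fps_conv_radius H > 1"
      using GR HR r by (auto intro: less_le_trans[of _ "ereal r"])
  qed
qed

text \<open>The formal real square root with constant term 1 must coincide with the analytic one, since a
  series has only two square roots; so it inherits the radius of convergence.\<close>

lemma fps_sqrt_conv_radius:
  fixes f :: "real fps"
  assumes R: "fps_conv_radius f > 1" and f0: "fps_nth f 0 = 1"
    and nz: "\<And>z :: complex. norm z \<le> 1 \<Longrightarrow> ev f z \<noteq> 0"
  obtains g where "g * g = f" "fps_nth g 0 = 1"
    "fps_conv_radius g > 1" "fps_conv_radius (inverse g) > 1"
proof -
  define c :: "real fps \<Rightarrow> complex fps" where "c = (\<lambda>f. Abs_fps (\<lambda>n. of_real (fps_nth f n)))"
  have c_mult: "c (f * g) = c f * c g" for f g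
    by (simp add: c_def fps_eq_iff fps_mult_nth)
  have c_1: "c 1 = 1" by (simp add: c_def fps_eq_iff)
  have c_rad: "fps_conv_radius (c f) = fps_conv_radius f" for f
    using conv_radius_norm[of "\<lambda>n. complex_of_real (fps_nth f n)"] conv_radius_norm[of "fps_nth f"]
    by (simp add: c_def fps_conv_radius_def)
  have c_ev: "eval_fps (c f) z = ev f z" for f z by (simp add: c_def ev_def eval_fps_def)
  obtain G H where GH: "G * G = c f" "G * H = 1" "fps_nth G 0 = 1"
      "fps_conv_radius G > 1" "fps_conv_radius H > 1"
    by (rule complex_fps_sqrt[of "c f"]) (use R f0 nz in \<open>auto simp: c_rad c_ev\<close>, simp add: c_def)
  define g where "g = fps_radical root 2 f"
  have g2: "g * g = f"
    using power_radical[of f root 1] f0 by (simp add: g_def power2_eq_square numeral_2_eq_2)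
  have g0: "fps_nth g 0 = 1" using f0 by (simp add: g_def)
  have "(c g - G) * (c g + G) = 0" using GH(1) g2 c_mult[of g g] by (simp add: algebra_simps)
  moreover have "fps_nth (c g + G) 0 \<noteq> 0" using g0 GH(3) by (simp add: c_def)
  then have "c g + G \<noteq> 0" by (metis fps_zero_nth)
  ultimately have cg: "c g = G" by simp
  have "g * inverse g = 1" by (rule inverse_mult_eq_1') (simp add: g0)
  then have "G * c (inverse g) = 1" using c_mult[of g "inverse g"] cg c_1 by simp
  then have "H = c (inverse g)" using GH(2) by (metis mult.assoc mult.commute mult_1)
  then show ?thesis using that[OF g2 g0] GH(4,5) cg c_rad by metis
qed

section \<open>The factor (1 - X) to the power -1/2\<close>

text \<open>These are the numbers \<open>(2n choose n) / 4 ^ n\<close>, the coefficients of \<open>(1 - X) powr (- 1/2)\<close>; this form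
  gives access to the asymptotics of generalised binomial coefficients.\<close>

definition central_binom :: "nat \<Rightarrow> real" where "central_binom n = (- 1) ^ n * ((- 1/2) gchoose n)"

lemma central_binom_0 [simp]: "central_binom 0 = 1"
  by (simp add: central_binom_def)

lemma central_binom_Suc: "central_binom (Suc n) = central_binom n * (real n + 1 / 2) / (real n + 1)"
proof -
  have aux: "- s * G' = s * G * (x + 1 / 2) / (x + 1)"
    if "(x + 1) * G' = (- 1/2 - x) * G" "x + 1 \<noteq> 0" for s G G' x :: real
  proof -
    have "s * G * (x + 1 / 2) / (x + 1) = - (s * ((- 1/2 - x) * G)) / (x + 1)"
      by (simp add: algebra_simps)
    then show ?thesis unfolding that(1)[symmetric] using that(2) by simp
  qed
  have "(real n + 1) * ((- 1/2) gchoose Suc n) = (- 1/2 - real n) * ((- 1/2) gchoose n)"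
    using gbinomial_mult_1[of "- 1/2 :: real" n] by (simp add: algebra_simps)
  from aux[OF this, of "(- 1) ^ n"] show ?thesis by (simp add: central_binom_def)
qed

lemma central_binom_Suc': "(real n + 1) * central_binom (Suc n) = central_binom n * (real n + 1 / 2)"
  by (simp add: central_binom_Suc)

lemma central_binom_nonneg: "central_binom n \<ge> 0"
  by (induction n) (auto simp: central_binom_Suc)

lemma central_binom_decreasing: "central_binom n - central_binom (Suc n) = central_binom n / (2 * (real n + 1))"
  by (simp add: central_binom_Suc field_simps)

lemma central_binom_asymptotics: "(\<lambda>n. sqrt (real n) * central_binom n) \<longlonglongrightarrow> 1 / sqrt pi"
proof -
  have "(\<lambda>n. ((- 1/2 :: real) gchoose n) / ((- 1) ^ n / exp ((- 1/2 + 1) * of_real (ln (real n)))))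
      \<longlonglongrightarrow> inverse (Gamma (- (- 1/2)))"
    by (rule gbinomial_asymptotic)
  then have "(\<lambda>n. ((- 1/2 :: real) gchoose n) / ((- 1) ^ n / exp (ln (real n) / 2)))
      \<longlonglongrightarrow> 1 / sqrt pi"
    by (simp add: Gamma_one_half_real field_simps)
  moreover have "\<forall>\<^sub>F n in sequentially. ((- 1/2 :: real) gchoose n) / ((- 1) ^ n / exp (ln (real n) / 2))
      = sqrt (real n) * central_binom n"
    using eventually_gt_at_top[of 0]
  proof eventually_elim
    case (elim n)
    have "exp (ln (real n) / 2) = sqrt (real n)"
      using elim by (simp add: powr_half_sqrt[symmetric] powr_def)
    then show ?case by (cases "even n") (auto simp: central_binom_def)
  qed
  ultimately show ?thesis by (rule Lim_transform_eventually)
qed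

definition inv_sqrt_fps :: "real fps" where "inv_sqrt_fps = Abs_fps central_binom"

text \<open>Defining the square root of \<open>1 - X\<close> as \<open>(1 - X)\<close> times its inverse square root makes its coefficients
  differences of consecutive \<open>central_binom\<close> numbers.\<close>

definition sqrt_fps :: "real fps" where "sqrt_fps = (1 - fps_X) * inv_sqrt_fps"

lemma sqrt_fps_nth: "fps_nth sqrt_fps 0 = 1"
    "fps_nth sqrt_fps (Suc n) = - central_binom n / (2 * (real n + 1))"
  using central_binom_decreasing[of n]
  by (simp_all add: sqrt_fps_def inv_sqrt_fps_def left_diff_distrib)

text \<open>The product \<open>(1 - X) * inv_sqrt_fps ^ 2\<close> has derivative 0 by the differential equation
  of \<open>inv_sqrt_fps\<close>, and constant term 1.\<close>

lemma sqrt_fps_power2: "sqrt_fps * sqrt_fps = 1 - fps_X"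
proof -
  define D where "D = sqrt_fps * inv_sqrt_fps"
  have ode: "(1 - fps_X) * fps_deriv inv_sqrt_fps = fps_const (1 / 2) * inv_sqrt_fps"
  proof (rule fps_ext)
    fix n
    show "fps_nth ((1 - fps_X) * fps_deriv inv_sqrt_fps) n = fps_nth (fps_const (1 / 2) * inv_sqrt_fps) n"
      using central_binom_Suc'[of n] central_binom_Suc'[of 0]
      by (cases n) (simp_all add: inv_sqrt_fps_def left_diff_distrib algebra_simps)
  qed
  have "fps_deriv D = 0"
  proof -
    have "fps_deriv D = - (inv_sqrt_fps * inv_sqrt_fps)
        + 2 * inv_sqrt_fps * ((1 - fps_X) * fps_deriv inv_sqrt_fps)"
      by (simp add: D_def sqrt_fps_def algebra_simps)
    also have "\<dots> = - (inv_sqrt_fps * inv_sqrt_fps)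
        + (2 * fps_const (1 / 2)) * (inv_sqrt_fps * inv_sqrt_fps)"
      unfolding ode by (simp only: mult.assoc mult.commute mult.left_commute)
    also have "(2 :: real fps) * fps_const (1 / 2) = 1"
      by (simp add: numeral_fps_const)
    finally show ?thesis by simp
  qed
  then have "D = fps_const (fps_nth D 0)" by (simp add: fps_deriv_eq_0_iff)
  then have "D = 1" by (simp add: D_def sqrt_fps_def inv_sqrt_fps_def)
  then show ?thesis by (simp add: D_def sqrt_fps_def mult_ac)
qed

lemma sqrt_fps_inv: "sqrt_fps * inv_sqrt_fps = 1"
proof -
  have "(1 - fps_X) * (sqrt_fps * inv_sqrt_fps) = (1 - fps_X) * 1"
    using sqrt_fps_power2 by (simp add: sqrt_fps_def mult_ac)
  moreover have "(1 - fps_X :: real fps) \<noteq> 0"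
    by (metis fps_X_nth fps_one_nth fps_sub_nth fps_zero_nth diff_zero zero_neq_one)
  ultimately show ?thesis by (simp only: mult_cancel_left) simp
qed

lemma central_binom_bound: obtains K where "K \<ge> 1" "\<And>n. sqrt (real n) * central_binom n \<le> K"
proof -
  have "Bseq (\<lambda>n. sqrt (real n) * central_binom n)"
    using central_binom_asymptotics by (intro convergent_imp_Bseq) (auto simp: convergent_def)
  then obtain K where "\<And>n. norm (sqrt (real n) * central_binom n) \<le> K" unfolding Bseq_def by blast
  then show ?thesis by (intro that[of "max 1 K"]) (auto simp: le_max_iff_disj abs_le_iff)
qed

lemma central_binom_to_0: "central_binom \<longlonglongrightarrow> 0"
proof -
  have "filterlim (\<lambda>n. sqrt (real n)) at_top sequentially"
    by (rule filterlim_compose[OF sqrt_at_top filterlim_real_sequentially])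
  from tendsto_mult[OF central_binom_asymptotics tendsto_inverse_0_at_top[OF this]]
  have "(\<lambda>n. (sqrt (real n) * central_binom n) * inverse (sqrt (real n))) \<longlonglongrightarrow> 0" by simp
  moreover have "\<forall>\<^sub>F n in sequentially. (sqrt (real n) * central_binom n) * inverse (sqrt (real n)) = central_binom n"
    using eventually_gt_at_top[of 0] by eventually_elim simp
  ultimately show ?thesis by (auto intro: Lim_transform_eventually)
qed

text \<open>The coefficients telescope and have constant sign, which gives summability; each is of order
  \<open>central_binom n / n\<close>.\<close>

lemma small_tail_sqrt_fps: "small_tail sqrt_fps"
proof -
  have "(\<lambda>n. central_binom n - central_binom (Suc n)) sums (central_binom 0 - 0)"
    by (rule telescope_sums'[OF central_binom_to_0])
  then have "summable (\<lambda>n. \<bar>fps_nth sqrt_fps (Suc n)\<bar>)"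
    using central_binom_nonneg by (simp add: sums_iff sqrt_fps_nth central_binom_decreasing abs_divide abs_of_nonneg)
  then have "abs_conv sqrt_fps"
    unfolding abs_conv_def by (subst summable_Suc_iff[symmetric])
  moreover have "(\<lambda>n. real (Suc n) * fps_nth sqrt_fps (Suc n)) \<longlonglongrightarrow> 0"
  proof -
    have "real (Suc n) * fps_nth sqrt_fps (Suc n) = - central_binom n / 2" for n
      by (simp add: sqrt_fps_nth field_simps)
    then show ?thesis using tendsto_divide[OF tendsto_minus[OF central_binom_to_0] tendsto_const[of 2]] by simp
  qed
  then have "(\<lambda>n. real n * fps_nth sqrt_fps n) \<longlonglongrightarrow> 0"
    by (subst (asm) filterlim_sequentially_Suc)
  ultimately show ?thesis by (simp add: small_tail_def)
qed

text \<open>In the convolution, write \<open>sqrt n = sqrt (n - k) + (sqrt n - sqrt (n - k))\<close>. The first part gives the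
  limit by \<open>convolution_tendsto\<close>. The second is at most \<open>k / sqrt n\<close>, so its contribution is
  bounded by the convolution of the null sequence \<open>k * H_k\<close> with \<open>central_binom\<close>, divided by
  \<open>sqrt n\<close>; it vanishes because the first \<open>n\<close> numbers \<open>central_binom\<close> sum up to \<open>O(sqrt n)\<close>.\<close>

lemma transfer_inv_sqrt:
  assumes H: "small_tail H"
  shows "(\<lambda>n. sqrt (real n) * fps_nth (H * inv_sqrt_fps) n) \<longlonglongrightarrow> ev H 1 / sqrt pi"
proof -
  define e where "e = (\<lambda>k. real k * \<bar>fps_nth H k\<bar>)"
  define w where "w = (\<lambda>n k. (sqrt (real n) - sqrt (real (n - k))) * central_binom (n - k))"
  have sH: "summable (\<lambda>n. \<bar>fps_nth H n\<bar>)" using H by (simp add: small_tail_def abs_conv_def)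
  have e0: "e \<longlonglongrightarrow> 0"
    using H tendsto_rabs_zero_iff[of "\<lambda>n. real n * fps_nth H n"]
    by (simp add: small_tail_def e_def abs_mult)
  obtain K where K: "K \<ge> 1" "\<And>n. sqrt (real n) * central_binom n \<le> K" using central_binom_bound by metis
  have cb1: "central_binom n \<le> 1" for n
  proof (induction n)
    case (Suc n)
    have "0 \<le> central_binom n - central_binom (Suc n)" unfolding central_binom_decreasing using central_binom_nonneg by simp
    then show ?case using Suc by simp
  qed simp
  have central_binom_sum: "(\<Sum>i\<le>n. central_binom i) \<le> 3 * K * sqrt (real n) + 1" for n
  proof (induction n)
    case (Suc n)
    let ?a = "sqrt (real (Suc n))" and ?b = "sqrt (real n)"
    have a: "?a > 0" by simp
    have "central_binom (Suc n) \<le> K / ?a" using K(2)[of "Suc n"] a by (simp add: field_simps)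
    also have "\<dots> \<le> 3 * K * (?a - ?b)"
    proof -
      have "(?a - ?b) * (?a + ?b) = 1" by (simp add: algebra_simps)
      moreover have "?b \<le> ?a" by simp
      ultimately have "1 \<le> (?a - ?b) * (3 * ?a)"
        using mult_left_mono[of "?a + ?b" "3 * ?a" "?a - ?b"] a by linarith
      then have "K * 1 \<le> K * ((?a - ?b) * (3 * ?a))" using K(1) by (intro mult_left_mono) auto
      then show ?thesis using a by (simp add: field_simps)
    qed
    finally show ?case using Suc by (simp add: algebra_simps)
  qed simp
  have main: "(\<lambda>n. \<Sum>i\<le>n. fps_nth H i * (sqrt (real (n - i)) * central_binom (n - i))) \<longlonglongrightarrow> ev H 1 * (1 / sqrt pi)"
    using convolution_tendsto[OF central_binom_asymptotics sH] by (simp add: ev_def)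
  have rest: "(\<lambda>n. (\<Sum>k\<le>n. e k * central_binom (n - k)) / sqrt (real n)) \<longlonglongrightarrow> 0"
  proof (rule LIMSEQ_I)
    fix \<epsilon> :: real assume \<epsilon>: "0 < \<epsilon>"
    define \<delta> where "\<delta> = \<epsilon> / (2 * (3 * K + 1))"
    have aux: "\<epsilon> / (2 * x) * x = \<epsilon> / 2" if "x \<noteq> 0" for x :: real using that by simp
    have \<delta>: "\<delta> > 0" "\<delta> * (3 * K + 1) = \<epsilon> / 2"
      unfolding \<delta>_def using \<epsilon> K(1) by (simp, intro aux) simp
    obtain k0 where k0: "\<And>k. k \<ge> k0 \<Longrightarrow> e k < \<delta>"
      using LIMSEQ_D[OF e0 \<delta>(1)] by (auto simp: e_def)
    define S where "S = (\<Sum>k<k0. e k)"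
    have e_nonneg: "e k \<ge> 0" for k by (simp add: e_def)
    then have S: "S \<ge> 0" unfolding S_def by (intro sum_nonneg) auto
    have bound: "(\<Sum>k\<le>n. e k * central_binom (n - k)) \<le> S + \<delta> * (3 * K * sqrt (real n) + 1)" for n
    proof -
      have "(\<Sum>k\<le>n. e k * central_binom (n - k)) \<le> (\<Sum>k\<le>n. (if k < k0 then e k else 0) + \<delta> * central_binom (n - k))"
      proof (rule sum_mono)
        fix k
        show "e k * central_binom (n - k) \<le> (if k < k0 then e k else 0) + \<delta> * central_binom (n - k)"
        proof (cases "k < k0")
          case True
          then show ?thesis
            using mult_left_mono[OF cb1[of "n - k"] e_nonneg[of k]]
              mult_nonneg_nonneg[OF less_imp_le[OF \<delta>(1)] central_binom_nonneg[of "n - k"]] by simp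
        next
          case False
          then show ?thesis using k0[of k] central_binom_nonneg[of "n - k"] by (simp add: mult_right_mono)
        qed
      qed
      also have "\<dots> = (\<Sum>k\<in>{..n} \<inter> {..<k0}. e k) + \<delta> * (\<Sum>k\<le>n. central_binom (n - k))"
        by (simp add: sum.distrib sum_distrib_left sum.inter_restrict lessThan_def)
      also have "(\<Sum>k\<le>n. central_binom (n - k)) = (\<Sum>k\<le>n. central_binom k)"
        by (rule sum.reindex_bij_witness[of _ "\<lambda>i. n - i" "\<lambda>i. n - i"]) auto
      also have "(\<Sum>k\<in>{..n} \<inter> {..<k0}. e k) \<le> S"
        unfolding S_def by (rule sum_mono2) (auto simp: e_nonneg)
      also have "\<delta> * (\<Sum>k\<le>n. central_binom k) \<le> \<delta> * (3 * K * sqrt (real n) + 1)"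
        using central_binom_sum \<delta>(1) by (intro mult_left_mono) auto
      finally show ?thesis by simp
    qed
    have "filterlim (\<lambda>n. sqrt (real n)) at_top sequentially"
      by (rule filterlim_compose[OF sqrt_at_top filterlim_real_sequentially])
    then have "\<forall>\<^sub>F n in sequentially. sqrt (real n) > max 1 (2 * S / \<epsilon>)"
      unfolding filterlim_at_top_dense by blast
    then have "\<forall>\<^sub>F n in sequentially. norm ((\<Sum>k\<le>n. e k * central_binom (n - k)) / sqrt (real n) - 0) < \<epsilon>"
    proof eventually_elim
      case (elim n)
      let ?r = "sqrt (real n)"
      have r: "?r > 1" "2 * S < \<epsilon> * ?r" using elim \<epsilon> by (auto simp: field_simps)
      have "\<delta> * (3 * K * ?r + 1) \<le> \<delta> * ((3 * K + 1) * ?r)"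
        using r \<delta>(1) by (intro mult_left_mono) (auto simp: algebra_simps)
      also have "\<dots> = \<epsilon> / 2 * ?r" by (simp only: mult.assoc[symmetric] \<delta>(2))
      finally have "(\<Sum>k\<le>n. e k * central_binom (n - k)) < \<epsilon> * ?r" using bound[of n] r by (simp add: field_simps)
      moreover have "(\<Sum>k\<le>n. e k * central_binom (n - k)) \<ge> 0"
        by (intro sum_nonneg mult_nonneg_nonneg e_nonneg central_binom_nonneg)
      ultimately show ?case using r by (simp add: field_simps)
    qed
    then show "\<exists>no. \<forall>n\<ge>no. norm ((\<Sum>k\<le>n. e k * central_binom (n - k)) / sqrt (real n) - 0) < \<epsilon>"
      by (simp add: eventually_sequentially)
  qed
  have "(\<lambda>n. \<Sum>k\<le>n. fps_nth H k * w n k) \<longlonglongrightarrow> 0"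
  proof (rule Lim_null_comparison[OF _ rest])
    show "\<forall>\<^sub>F n in sequentially. norm (\<Sum>k\<le>n. fps_nth H k * w n k)
        \<le> (\<Sum>k\<le>n. e k * central_binom (n - k)) / sqrt (real n)"
      using eventually_gt_at_top[of 0]
    proof eventually_elim
      case (elim n)
      have "norm (\<Sum>k\<le>n. fps_nth H k * w n k) \<le> (\<Sum>k\<le>n. e k * central_binom (n - k) / sqrt (real n))"
      proof (rule sum_norm_le)
        fix k assume "k \<in> {..n}"
        then have k: "k \<le> n" by simp
        let ?a = "sqrt (real n)" and ?b = "sqrt (real (n - k))"
        have a: "?a > 0" "0 \<le> ?b" "?b \<le> ?a" using elim by auto
        have "(?a - ?b) * ?a \<le> (?a - ?b) * (?a + ?b)" using a by (intro mult_left_mono) auto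
        also have "\<dots> = real k" using k by (simp add: algebra_simps of_nat_diff)
        finally have "?a - ?b \<le> real k / ?a" using a by (simp add: field_simps)
        then have "\<bar>fps_nth H k\<bar> * ((?a - ?b) * central_binom (n - k)) \<le> \<bar>fps_nth H k\<bar> * (real k / ?a * central_binom (n - k))"
          by (intro mult_left_mono mult_right_mono central_binom_nonneg) auto
        then show "norm (fps_nth H k * w n k) \<le> e k * central_binom (n - k) / ?a"
          using a central_binom_nonneg[of "n - k"] by (simp add: w_def e_def abs_mult mult_ac)
      qed
      then show ?case by (simp add: sum_divide_distrib)
    qed
  qed
  from tendsto_add[OF main this]
  show ?thesis
    by (simp add: w_def inv_sqrt_fps_def fps_mult_nth atLeast0AtMost sum_distrib_left
        sum.distrib[symmetric] algebra_simps)
qed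

section \<open>The linear system of a walk on the integers\<close>

text \<open>Without constant terms in the multipliers, the coefficients of order \<open>n\<close> on the left depend only
  on coefficients of lower order on the right, at all levels \<open>j\<close> simultaneously.\<close>

lemma linear_system_unique:
  fixes d e :: "int \<Rightarrow> real fps"
  assumes d: "\<And>j. d j = f * d (j + 1) + g * e (j - 1)"
    and e: "\<And>j. e j = f' * d (j + 1) + g' * e (j - 1)"
    and 0: "fps_nth f 0 = 0" "fps_nth g 0 = 0" "fps_nth f' 0 = 0" "fps_nth g' 0 = 0"
  shows "d j = 0 \<and> e j = 0"
proof -
  have shift: "fps_nth (h * k) n = 0"
    if "fps_nth h 0 = 0" "\<And>i. i < n \<Longrightarrow> fps_nth k i = 0" for h k :: "real fps" and n
    unfolding fps_mult_nth
  proof (rule sum.neutral, rule ballI)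
    fix i assume "i \<in> {0..n}"
    then show "fps_nth h i * fps_nth k (n - i) = 0"
      using that by (cases "i = 0") auto
  qed
  have "\<forall>j. fps_nth (d j) n = 0 \<and> fps_nth (e j) n = 0" for n
  proof (induction n rule: less_induct)
    case (less n)
    show ?case
    proof
      fix j
      show "fps_nth (d j) n = 0 \<and> fps_nth (e j) n = 0"
        using less 0 shift[of f n "d (j + 1)"] shift[of g n "e (j - 1)"]
          shift[of f' n "d (j + 1)"] shift[of g' n "e (j - 1)"]
        by (subst d, subst e) simp
    qed
  qed
  then show ?thesis by (simp add: fps_eq_iff)
qed

text \<open>At \<open>D = 0\<close> one has \<open>pa = pb\<close>, \<open>qa = 1 - pa\<close> and \<open>qb = 1 - pb\<close>, where the discriminant
  \<open>(1 + pa * pb - qa * qb) ^ 2 - 4 * pa * pb\<close> vanishes; this is the resulting factorisation.\<close>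

lemma discriminant_factor:
  fixes D :: "'a :: comm_ring_1"
  assumes "D * ta = 1 - pa - qa" "D * tb = 1 - pb - qb" "D * \<delta> = pa - pb"
  shows "D * (D * \<delta> * \<delta> + 2 * (pa + pb) * (ta * (1 - pb) + tb * (1 - pa) - D * ta * tb)
      + D * (ta * (1 - pb) + tb * (1 - pa) - D * ta * tb) * (ta * (1 - pb) + tb * (1 - pa) - D * ta * tb))
    = (1 + pa * pb - qa * qb) * (1 + pa * pb - qa * qb) - 4 * (pa * pb)"
proof -
  define h where "h = ta * (1 - pb) + tb * (1 - pa) - D * ta * tb"
  have "D * h = (D * ta) * (1 - pb) + (D * tb) * (1 - pa) - (D * ta) * (D * tb)"
    by (simp add: h_def algebra_simps)
  also have "\<dots> = 1 + pa * pb - qa * qb - pa - pb"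
    unfolding assms by (simp add: algebra_simps)
  finally have Dh: "1 + pa * pb - qa * qb = D * h + (pa + pb)" by simp
  have "(D * \<delta>) * (D * \<delta>) = (pa + pb) * (pa + pb) - 4 * (pa * pb)"
    unfolding assms by (simp add: algebra_simps)
  then show ?thesis
    unfolding h_def[symmetric] Dh by (simp add: algebra_simps)
qed

text \<open>Above level 0 a solution is the constant \<open>U = 1 / (1 - X)\<close> plus a multiple of the powers of
  \<open>f' * \<kappa>\<close>, and below level 0 it is \<open>- U\<close> plus a multiple of the powers of \<open>f * \<kappa>\<close>, where \<open>\<kappa>\<close> solves the
  characteristic equation. The conditions on \<open>X\<close> and \<open>Y\<close> say that both halves fit together at level 0.
  The levels 1 and -1 are those reached by the first hit from level 0.\<close>

lemma walk_system_solution: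
  fixes f g f' g' U t t' m \<kappa> X Y :: "real fps"
  assumes U: "t = U - f * U - g * U" "t' = U - f' * U - g' * U"
    and m: "m = f * f' * \<kappa>" and \<kappa>: "(1 - m) * \<kappa> = g * g' * \<kappa> + (1 - m)"
    and Y: "(1 - g * g' - m) * Y = (1 + f - g) * U + f * g * X"
    and X: "(1 - g * g' - m) * X = f' * g' * Y - (1 + f' - g') * U"
    and 0: "fps_nth f 0 = 0" "fps_nth g 0 = 0" "fps_nth f' 0 = 0" "fps_nth g' 0 = 0"
    and x: "\<And>j. x j = fps_const (of_int (sgn j)) * t + f * x (j + 1) + g * y (j - 1)"
    and y: "\<And>j. y j = fps_const (of_int (sgn j)) * t' + g' * x (j + 1) + f' * y (j - 1)"
  shows "x 1 = U + g * X" "y (- 1) = - U + g' * Y"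
proof -
  define r s where "r = f' * \<kappa>" and "s = f * \<kappa>"
  have fr: "f * (r * z) = m * z" and f's: "f' * (s * z) = m * z" for z
    by (simp_all add: r_def s_def m mult_ac)
  have r: "(1 - m) * r = g * g' * r + f' * (1 - m)" and s: "(1 - m) * s = g * g' * s + f * (1 - m)"
  proof -
    have "f' * ((1 - m) * \<kappa>) = f' * (g * g' * \<kappa> + (1 - m))" "f * ((1 - m) * \<kappa>) = f * (g * g' * \<kappa> + (1 - m))"
      using \<kappa> by simp_all
    then show "(1 - m) * r = g * g' * r + f' * (1 - m)" "(1 - m) * s = g * g' * s + f * (1 - m)"
      unfolding r_def s_def by (simp_all only: distrib_left mult.assoc mult.left_commute mult.commute)
  qed
  define x' where "x' = (\<lambda>j. if j \<ge> 1 then U + g * X * r ^ nat (j - 1) else - U + (1 - m) * Y * s ^ nat (- j))"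
  define y' where "y' = (\<lambda>j. if j \<ge> 0 then U + (1 - m) * X * r ^ nat j else - U + g' * Y * s ^ nat (- j - 1))"
  have cases: thesis if "\<And>n. j = int n + 1 \<Longrightarrow> thesis" "j = 0 \<Longrightarrow> thesis" "\<And>n. j = - int n - 1 \<Longrightarrow> thesis"
    for j thesis
    using that(1)[of "nat (j - 1)"] that(2) that(3)[of "nat (- j - 1)"] by linarith
  have neg: "fps_const (- 1) * z = - z" for z :: "real fps"
    by (simp add: fps_eq_iff)
  have x': "x' j = fps_const (of_int (sgn j)) * t + f * x' (j + 1) + g * y' (j - 1)" for j
  proof (rule cases[of j])
    fix n assume j: "j = int n + 1"
    have e: "nat (int n + 1) = Suc n" "nat (1 + int n) = Suc n" "nat (int n) = n" by simp_all
    define Z where "Z = g * X * r ^ n"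
    have Z: "f * (g * X * (r * r ^ n)) = m * Z" "g * ((1 - m) * X * r ^ n) = (1 - m) * Z"
      using fr[of Z] by (simp_all only: Z_def mult.assoc mult.commute mult.left_commute)
    have "U + g * X * r ^ n = t + f * (U + g * X * (r * r ^ n)) + g * (U + (1 - m) * X * r ^ n)"
      unfolding distrib_left Z U Z_def[symmetric] by (simp add: algebra_simps)
    then show ?thesis by (simp add: j x'_def y'_def e)
  next
    assume j: "j = 0"
    have "- U + (1 - m) * Y = f * (U + g * X) + g * (- U + g' * Y)"
      using Y by (simp add: algebra_simps)
    then show ?thesis by (simp add: j x'_def y'_def)
  next
    fix n assume j: "j = - int n - 1"
    have e: "nat (int n + 1) = Suc n" "nat (1 + int n) = Suc n" "nat (int n) = n" by simp_all
    have "(1 - m) * Y * (s * s ^ n) = Y * s ^ n * ((1 - m) * s)" by (simp add: mult_ac)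
    also have "\<dots> = f * ((1 - m) * Y * s ^ n) + g * (g' * Y * (s * s ^ n))"
      unfolding s by (simp add: algebra_simps)
    finally have "- U + (1 - m) * Y * (s * s ^ n) = - t + f * (- U + (1 - m) * Y * s ^ n) + g * (- U + g' * Y * (s * s ^ n))"
      by (simp add: U algebra_simps)
    then show ?thesis by (simp add: j x'_def y'_def e neg)
  qed
  have y': "y' j = fps_const (of_int (sgn j)) * t' + g' * x' (j + 1) + f' * y' (j - 1)" for j
  proof (rule cases[of j])
    fix n assume j: "j = int n + 1"
    have e: "nat (int n + 1) = Suc n" "nat (1 + int n) = Suc n" "nat (int n) = n" by simp_all
    have "(1 - m) * X * (r * r ^ n) = X * r ^ n * ((1 - m) * r)" by (simp add: mult_ac)
    also have "\<dots> = g' * (g * X * (r * r ^ n)) + f' * ((1 - m) * X * r ^ n)"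
      unfolding r by (simp add: algebra_simps)
    finally have "U + (1 - m) * X * (r * r ^ n) = t' + g' * (U + g * X * (r * r ^ n)) + f' * (U + (1 - m) * X * r ^ n)"
      by (simp add: U algebra_simps)
    then show ?thesis by (simp add: j x'_def y'_def e)
  next
    assume j: "j = 0"
    have "U + (1 - m) * X = g' * (U + g * X) + f' * (- U + g' * Y)"
      using X by (simp add: algebra_simps)
    then show ?thesis by (simp add: j x'_def y'_def)
  next
    fix n assume j: "j = - int n - 1"
    have e: "nat (int n + 1) = Suc n" "nat (1 + int n) = Suc n" "nat (int n) = n" by simp_all
    define Z where "Z = g' * Y * s ^ n"
    have Z: "f' * (g' * Y * (s * s ^ n)) = m * Z" "g' * ((1 - m) * Y * s ^ n) = (1 - m) * Z"
      using f's[of Z] by (simp_all only: Z_def mult.assoc mult.commute mult.left_commute)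
    have "- U + g' * Y * s ^ n = - t' + g' * (- U + (1 - m) * Y * s ^ n) + f' * (- U + g' * Y * (s * s ^ n))"
      unfolding distrib_left Z U Z_def[symmetric] by (simp add: algebra_simps)
    then show ?thesis by (simp add: j x'_def y'_def e neg)
  qed
  have "x j - x' j = 0 \<and> y j - y' j = 0" for j
  proof (rule linear_system_unique[where f = f and g = g and f' = g' and g' = f', OF _ _ 0(1,2,4,3)])
    show "x j - x' j = f * (x (j + 1) - x' (j + 1)) + g * (y (j - 1) - y' (j - 1))" for j
      by (subst x, subst x') (simp add: algebra_simps)
    show "y j - y' j = g' * (x (j + 1) - x' (j + 1)) + f' * (y (j - 1) - y' (j - 1))" for j
      by (subst y, subst y') (simp add: algebra_simps)
  qed
  from this[of 1] this[of "- 1"] show "x 1 = U + g * X" "y (- 1) = - U + g' * Y"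
    by (simp_all add: x'_def y'_def)
qed

text \<open>Both values of the previous lemma look like multiples of \<open>U = 1 / D\<close>, that is, of \<open>1 / s ^ 2\<close>, but they
  are only of order \<open>1 / s\<close>. To see this, \<open>U\<close> is eliminated: every combination of the transition series
  that vanishes at \<open>D = 0\<close> is rewritten as \<open>D\<close> times an explicit series (\<open>T1\<close>, \<open>T2\<close>, \<open>Z1\<close>, \<open>Z2\<close> below),
  after which first \<open>D\<close> and then \<open>s\<close> cancel.\<close>

lemma boundary_values:
  fixes D :: "'a :: idom"
  assumes D: "D * ta = 1 - pa - qa" "D * tb = 1 - pb - qb" "D * \<delta> = pa - pb" "D * U = 1" "D \<noteq> 0"
    and s: "s * s = D * \<Delta>" "s \<noteq> 0"
    and E: "2 * E = 1 - pa * pb - qa * qb + s" "E * E - pa * pb * (qa * qb) = s * E"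
    and Y: "E * Y = (1 + pa - qa) * U + pa * qa * X"
    and X: "E * X = pb * qb * Y - (1 + pb - qb) * U"
    and \<eta>: "\<eta> = ta * (1 - pb) + tb * (1 - pa) - D * ta * tb"
  shows "4 * (s * E * (U + qa * X)) = \<Delta> + s * (\<delta> + ta * (1 + pb) + tb * (1 - pa) - D * ta * tb)
      - 2 * (E * (\<eta> - \<delta> - 2 * ta)) + 2 * (qa * pb * (\<eta> + \<delta> - 2 * tb))" (is ?A)
    and "4 * (s * E * (- U + qb * Y)) = - \<Delta> - s * (- \<delta> + tb * (1 + pa) + ta * (1 - pb) - D * ta * tb)
      + 2 * (E * (\<eta> + \<delta> - 2 * tb)) - 2 * (qb * pa * (\<eta> - \<delta> - 2 * ta))" (is ?B)
proof -
  define X1 Y1 where "X1 = U + qa * X" and "Y1 = - U + qb * Y"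
  define T1 T2 where "T1 = \<eta> + \<delta> - 2 * tb" and "T2 = \<eta> - \<delta> - 2 * ta"
  define Z1 Z2 where "Z1 = - \<delta> + tb * (1 + pa) + ta * (1 - pb) - D * ta * tb"
    and "Z2 = \<delta> + ta * (1 + pb) + tb * (1 - pa) - D * ta * tb"
  have Dtt: "D * (D * ta * tb) = (D * ta) * (D * tb)" by (simp add: mult_ac)
  have Dh: "D * \<eta> = 1 + pa * pb - qa * qb - pa - pb"
  proof -
    have "D * \<eta> = (D * ta) * (1 - pb) + (D * tb) * (1 - pa) - (D * ta) * (D * tb)"
      by (simp add: \<eta> algebra_simps)
    then show ?thesis unfolding D by (simp add: algebra_simps)
  qed
  have DT: "D * T1 = 2 * qb - 1 + pa * pb - qa * qb" "D * T2 = 2 * qa - 1 + pa * pb - qa * qb"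
  proof -
    have "D * T1 = D * \<eta> + D * \<delta> - 2 * (D * tb)" "D * T2 = D * \<eta> - D * \<delta> - 2 * (D * ta)"
      by (simp_all add: T1_def T2_def algebra_simps)
    then show "D * T1 = 2 * qb - 1 + pa * pb - qa * qb" "D * T2 = 2 * qa - 1 + pa * pb - qa * qb"
      unfolding Dh D by (simp_all add: algebra_simps)
  qed
  have DZ: "D * Z1 = 1 - pa * pb - qa * qb - 2 * (qb * pa)" "D * Z2 = 1 - pa * pb - qa * qb - 2 * (qa * pb)"
  proof -
    have "D * Z1 = - (D * \<delta>) + (D * tb) * (1 + pa) + (D * ta) * (1 - pb) - (D * ta) * (D * tb)"
      "D * Z2 = D * \<delta> + (D * ta) * (1 + pb) + (D * tb) * (1 - pa) - (D * ta) * (D * tb)"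
      by (simp_all add: Z1_def Z2_def algebra_simps)
    then show "D * Z1 = 1 - pa * pb - qa * qb - 2 * (qb * pa)" "D * Z2 = 1 - pa * pb - qa * qb - 2 * (qa * pb)"
      unfolding D by (simp_all add: algebra_simps)
  qed
  have E1: "E * Y1 = U * (qb * (1 - qa) - E) + qb * pa * X1"
  proof -
    have "E * Y1 = - (E * U) + qb * (E * Y)" by (simp add: Y1_def algebra_simps)
    then show ?thesis unfolding Y by (simp add: X1_def algebra_simps)
  qed
  have E2: "E * X1 = - (U * (qa * (1 - qb) - E)) + qa * pb * Y1"
  proof -
    have "E * X1 = E * U + qa * (E * X)" by (simp add: X1_def algebra_simps)
    then show ?thesis unfolding X by (simp add: Y1_def algebra_simps)
  qed
  have F1: "2 * (D * (E * Y1)) = D * T1 - s + 2 * (D * (qb * pa * X1))"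
  proof -
    have "2 * (D * (E * Y1)) = (D * U) * (2 * (qb * (1 - qa)) - 2 * E) + 2 * (D * (qb * pa * X1))"
      unfolding E1 by (simp add: algebra_simps)
    then show ?thesis unfolding D E(1) DT by (simp add: algebra_simps)
  qed
  have F2: "2 * (D * (E * X1)) = s - D * T2 + 2 * (D * (qa * pb * Y1))"
  proof -
    have "2 * (D * (E * X1)) = - ((D * U) * (2 * (qa * (1 - qb)) - 2 * E)) + 2 * (D * (qa * pb * Y1))"
      unfolding E2 by (simp add: algebra_simps)
    then show ?thesis unfolding D E(1) DT by (simp add: algebra_simps)
  qed
  \<comment> \<open>Multiplying by s turns the lone s into s * s = D * \<Delta>, and D cancels.\<close>
  have G1: "2 * (s * (E * Y1)) = s * T1 - \<Delta> + 2 * (s * (qb * pa * X1))"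
  proof -
    have "D * (2 * (s * (E * Y1))) = s * (2 * (D * (E * Y1)))" by (simp add: mult_ac)
    also have "\<dots> = D * (s * T1) - s * s + D * (2 * (s * (qb * pa * X1)))"
      unfolding F1 by (simp add: algebra_simps)
    also have "\<dots> = D * (s * T1 - \<Delta> + 2 * (s * (qb * pa * X1)))"
      unfolding s by (simp add: algebra_simps)
    finally show ?thesis using D(5) by simp
  qed
  have G2: "2 * (s * (E * X1)) = \<Delta> - s * T2 + 2 * (s * (qa * pb * Y1))"
  proof -
    have "D * (2 * (s * (E * X1))) = s * (2 * (D * (E * X1)))" by (simp add: mult_ac)
    also have "\<dots> = s * s - D * (s * T2) + D * (2 * (s * (qa * pb * Y1)))"
      unfolding F2 by (simp add: algebra_simps)
    also have "\<dots> = D * (\<Delta> - s * T2 + 2 * (s * (qa * pb * Y1)))"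
      unfolding s by (simp add: algebra_simps)
    finally show ?thesis using D(5) by simp
  qed
  \<comment> \<open>The determinant of the two equations G1, G2 is E * E - pa * pb * qa * qb = s * E, so a factor s can be cancelled as well.\<close>
  have H1: "4 * (s * E * Y1) = 2 * (E * T1) - 2 * (qb * pa * T2) - \<Delta> - Z1 * s"
  proof -
    have "s * (4 * (s * E * Y1)) = 4 * (s * ((s * E) * Y1))" by (simp add: mult_ac)
    also have "\<dots> = 2 * (E * (2 * (s * (E * Y1)))) - 4 * (s * (pa * pb * (qa * qb) * Y1))"
      unfolding E(2)[symmetric] by (simp add: algebra_simps)
    also have "\<dots> = 2 * (E * (s * T1)) - 2 * E * \<Delta> + 2 * (qb * pa) * (2 * (s * (E * X1)))
        - 4 * (s * (pa * pb * (qa * qb) * Y1))"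
      unfolding G1 by (simp add: algebra_simps)
    also have "\<dots> = 2 * (E * (s * T1)) - 2 * (qb * pa * (s * T2)) - (2 * E - 2 * (qb * pa)) * \<Delta>"
      unfolding G2 by (simp add: algebra_simps)
    also have "2 * E - 2 * (qb * pa) = D * Z1 + s" unfolding DZ E(1) by simp
    also have "2 * (E * (s * T1)) - 2 * (qb * pa * (s * T2)) - (D * Z1 + s) * \<Delta>
        = 2 * (E * (s * T1)) - 2 * (qb * pa * (s * T2)) - s * \<Delta> - Z1 * (D * \<Delta>)"
      by (simp add: algebra_simps)
    also have "\<dots> = s * (2 * (E * T1) - 2 * (qb * pa * T2) - \<Delta> - Z1 * s)"
      unfolding s(1)[symmetric] by (simp add: algebra_simps)
    finally show ?thesis using s(2) by (simp only: mult_cancel_left) simp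
  qed
  have H2: "4 * (s * E * X1) = \<Delta> + Z2 * s - 2 * (E * T2) + 2 * (qa * pb * T1)"
  proof -
    have "s * (4 * (s * E * X1)) = 4 * (s * ((s * E) * X1))" by (simp add: mult_ac)
    also have "\<dots> = 2 * (E * (2 * (s * (E * X1)))) - 4 * (s * (pa * pb * (qa * qb) * X1))"
      unfolding E(2)[symmetric] by (simp add: algebra_simps)
    also have "\<dots> = 2 * E * \<Delta> - 2 * (E * (s * T2)) + 2 * (qa * pb) * (2 * (s * (E * Y1)))
        - 4 * (s * (pa * pb * (qa * qb) * X1))"
      unfolding G2 by (simp add: algebra_simps)
    also have "\<dots> = (2 * E - 2 * (qa * pb)) * \<Delta> - 2 * (E * (s * T2)) + 2 * (qa * pb * (s * T1))"
      unfolding G1 by (simp add: algebra_simps)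
    also have "2 * E - 2 * (qa * pb) = D * Z2 + s" unfolding DZ E(1) by simp
    also have "(D * Z2 + s) * \<Delta> - 2 * (E * (s * T2)) + 2 * (qa * pb * (s * T1))
        = s * \<Delta> + Z2 * (D * \<Delta>) - 2 * (E * (s * T2)) + 2 * (qa * pb * (s * T1))"
      by (simp add: algebra_simps)
    also have "\<dots> = s * (\<Delta> + Z2 * s - 2 * (E * T2) + 2 * (qa * pb * T1))"
      unfolding s(1)[symmetric] by (simp add: algebra_simps)
    finally show ?thesis using s(2) by (simp only: mult_cancel_left) simp
  qed
  show ?A
    unfolding X1_def[symmetric] T1_def[symmetric] T2_def[symmetric] Z2_def[symmetric]
    using H2 by (simp add: mult.commute[of s Z2])
  show ?B
    unfolding Y1_def[symmetric] T1_def[symmetric] T2_def[symmetric] Z1_def[symmetric]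
    using H1 by (simp add: mult.commute[of s Z1])
qed

lemma small_tail_abs_conv: "small_tail f \<Longrightarrow> abs_conv f"
  by (simp add: small_tail_def)

lemma ev_1_pos_iff:
  assumes "abs_conv f" "\<And>n. fps_nth f n \<ge> 0"
  shows "ev f (1 :: real) > 0 \<longleftrightarrow> (\<exists>n. fps_nth f n > 0)"
  using suminf_pos_iff[of "fps_nth f"] assms by (simp add: ev_def abs_conv_def)

lemma sum_fps_nth_difference:
  "(\<Sum>n\<le>N. fps_nth ((1 - fps_X) * f) n) = fps_nth (f :: real fps) N"
  by (induction N) (simp_all add: left_diff_distrib)

lemma finite_support_fps:
  fixes f :: "real fps"
  assumes "\<And>n. n > N \<Longrightarrow> fps_nth f n = 0"
  shows "fps_conv_radius f > 1" "ev f (1 :: real) = (\<Sum>n\<le>N. fps_nth f n)"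
proof -
  have "summable (\<lambda>n. fps_nth f n * 2 ^ n)"
    by (rule summable_finite[of "{..N}"]) (use assms in auto)
  from conv_radius_geI[OF this] have "ereal 2 \<le> fps_conv_radius f"
    by (simp add: fps_conv_radius_def)
  moreover have "1 < ereal 2" by simp
  ultimately show "fps_conv_radius f > 1" by (rule less_le_trans[rotated])
  show "ev f (1 :: real) = (\<Sum>n\<le>N. fps_nth f n)"
    unfolding ev_def by (subst suminf_finite[of "{..N}"]) (use assms in auto)
qed

section \<open>Asymptotics of the expected sign\<close>

text \<open>The analytic data of a Markov renewal process with two states: transition series \<open>pa, qa, pb, qb\<close>,
  series \<open>ia, ib\<close> of the first arrival, and survival series \<open>ta, tb\<close>. The series \<open>\<delta>\<close> expresses that
  both states have the same probability of staying. The last assumption excludes a common period of all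
  round trips between the states.\<close>

locale two_letter_walk =
  fixes pa qa pb qb ia ib ta tb \<delta> :: "real fps"
  assumes zero: "fps_nth pa 0 = 0" "fps_nth qa 0 = 0" "fps_nth pb 0 = 0" "fps_nth qb 0 = 0"
    and nonneg: "\<And>n. fps_nth pa n \<ge> 0" "\<And>n. fps_nth qa n \<ge> 0"
      "\<And>n. fps_nth pb n \<ge> 0" "\<And>n. fps_nth qb n \<ge> 0"
    and radius: "fps_conv_radius pa > 1" "fps_conv_radius qa > 1"
      "fps_conv_radius pb > 1" "fps_conv_radius qb > 1"
      "fps_conv_radius ia > 1" "fps_conv_radius ib > 1"
      "fps_conv_radius ta > 1" "fps_conv_radius tb > 1" "fps_conv_radius \<delta> > 1"
    and survive: "(1 - fps_X) * ta = 1 - pa - qa" "(1 - fps_X) * tb = 1 - pb - qb"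
    and difference: "(1 - fps_X) * \<delta> = pa - pb"
    and start: "ev ia (1 :: real) + ev ib 1 = 1"
    and stay: "0 < ev pa (1 :: real)" "ev pa (1 :: real) < 1"
    and time: "0 < ev ta (1 :: real) + ev tb 1"
    and aperiodic: "\<And>z :: complex. norm z \<le> 1 \<Longrightarrow>
      (\<And>i j. fps_nth pa i > 0 \<Longrightarrow> fps_nth pb j > 0 \<Longrightarrow> z ^ (i + j) = 1) \<Longrightarrow>
      (\<And>i j. fps_nth qa i > 0 \<Longrightarrow> fps_nth qb j > 0 \<Longrightarrow> z ^ (i + j) = 1) \<Longrightarrow> z = 1"
begin

definition P where "P = pa * pb"
definition Q where "Q = qa * qb"
definition \<eta> where "\<eta> = ta * (1 - pb) + tb * (1 - pa) - (1 - fps_X) * ta * tb"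
definition \<Delta>' where "\<Delta>' = (1 - fps_X) * \<delta> * \<delta> + 2 * (pa + pb) * \<eta> + (1 - fps_X) * \<eta> * \<eta>"

lemma disc: "(1 - fps_X) * \<Delta>' = (1 + P - Q) * (1 + P - Q) - 4 * P"
  unfolding P_def Q_def \<Delta>'_def \<eta>_def using survive difference by (rule discriminant_factor)

definition p where "p = ev pa (1 :: real)"
definition q where "q = 1 - p"
definition W where "W = ev ta (1 :: real) + ev tb 1"
definition \<mu> where "\<mu> = ev \<delta> (1 :: real) + ev ta 1 - ev tb 1"

lemmas ac = radius[THEN abs_conv_of_conv_radius]

lemma radius_derived:
  "fps_conv_radius P > 1" "fps_conv_radius Q > 1" "fps_conv_radius \<eta> > 1" "fps_conv_radius \<Delta>' > 1"
proof -
  show P: "fps_conv_radius P > 1" and Q: "fps_conv_radius Q > 1"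
    unfolding P_def Q_def by (intro conv_radius_gt_1_intros radius)+
  show e: "fps_conv_radius \<eta> > 1"
    unfolding \<eta>_def by (intro conv_radius_gt_1_intros radius)
  show "fps_conv_radius \<Delta>' > 1"
    unfolding \<Delta>'_def by (intro conv_radius_gt_1_intros radius e)
qed

lemmas ac' = radius_derived[THEN abs_conv_of_conv_radius]

lemma values_at_1: "ev pa (1::real) = p" "ev pb (1::real) = p" "ev qa (1::real) = q" "ev qb (1::real) = q"
    "ev P (1::real) = p\<^sup>2" "ev Q (1::real) = q\<^sup>2" "ev \<eta> (1::real) = q * W" "ev \<Delta>' (1::real) = 4 * p * q * W"
proof -
  show pa: "ev pa (1::real) = p" by (simp add: p_def)
  have "ev ((1 - fps_X) * \<delta>) (1::real) = 0"
    by (simp add: ev_simps ac abs_conv_intros)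
  then show pb: "ev pb (1::real) = p"
    using pa by (simp add: difference ev_simps ac)
  have "ev ((1 - fps_X) * ta) (1::real) = 0" "ev ((1 - fps_X) * tb) (1::real) = 0"
    by (simp_all add: ev_simps ac abs_conv_intros)
  then show qa: "ev qa (1::real) = q" and qb: "ev qb (1::real) = q"
    using pa pb by (simp_all add: survive ev_simps ac abs_conv_intros q_def)
  show "ev P (1::real) = p\<^sup>2" "ev Q (1::real) = q\<^sup>2"
    by (simp_all add: P_def Q_def ev_simps ac pa pb qa qb power2_eq_square)
  show e: "ev \<eta> (1::real) = q * W"
    by (simp add: \<eta>_def ev_simps ac abs_conv_intros pa pb q_def W_def algebra_simps)
  show "ev \<Delta>' (1::real) = 4 * p * q * W"
    by (simp add: \<Delta>'_def ev_simps ac ac' abs_conv_intros pa pb e)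
qed

lemma pq: "0 < p" "0 < q" "p + q = 1" "p < 1"
  using stay by (simp_all add: p_def q_def)

lemma W_pos: "W > 0" using time by (simp add: W_def)

lemma ev_le:
  fixes z :: complex
  assumes f: "abs_conv f" "\<And>n. fps_nth f n \<ge> 0" and z: "norm z \<le> 1"
  shows "norm (ev f z) \<le> ev f (1::real)"
proof -
  have "norm (ev f z) \<le> (\<Sum>n. norm (of_real (fps_nth f n) * z ^ n))"
    unfolding ev_def by (rule summable_norm[OF norm_summable_ev[OF z f(1)]])
  also have "\<dots> \<le> (\<Sum>n. fps_nth f n)"
  proof (rule suminf_le[OF _ norm_summable_ev[OF z f(1)]])
    show "norm (of_real (fps_nth f n) * z ^ n) \<le> fps_nth f n" for n
      using z f(2) by (simp add: norm_mult norm_power mult_left_le power_le_one)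
    show "summable (fps_nth f)" using f by (simp add: abs_conv_def)
  qed
  finally show ?thesis by (simp add: ev_def)
qed

text \<open>Equality in the triangle inequality: all terms \<open>f_n * z ^ n\<close> with \<open>f_n > 0\<close> must be positive reals.\<close>

lemma ev_eq_imp_phase:
  fixes z :: complex
  assumes f: "abs_conv f" "\<And>n. fps_nth f n \<ge> 0" and z: "norm z \<le> 1"
    and eq: "ev f z = of_real (ev f (1::real))" and n: "fps_nth f n > 0"
  shows "z ^ n = 1"
proof -
  have sm: "summable (\<lambda>n. of_real (fps_nth f n) * z ^ n)" by (rule summable_ev[OF z f(1)])
  have s1: "summable (\<lambda>n. fps_nth f n)" using f by (simp add: abs_conv_def)
  have sr: "summable (\<lambda>n. Re (of_real (fps_nth f n) * z ^ n))" by (rule summable_Re[OF sm])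
  have nz: "norm (z ^ k) \<le> 1" for k using z by (simp add: norm_power power_le_one)
  have Re1: "Re (z ^ k) \<le> 1" for k using complex_Re_le_cmod[of "z ^ k"] nz[of k] by linarith
  have sd: "summable (\<lambda>n. fps_nth f n - Re (of_real (fps_nth f n) * z ^ n))"
    by (rule summable_diff[OF s1 sr])
  have ge: "0 \<le> fps_nth f n - Re (of_real (fps_nth f n) * z ^ n)" for n
    using f(2) Re1 by (simp add: mult_left_le)
  have "(\<Sum>n. fps_nth f n - Re (of_real (fps_nth f n) * z ^ n)) = ev f (1::real) - Re (ev f z)"
    using suminf_diff[OF s1 sr] Re_suminf[OF sm] by (simp add: ev_def)
  also have "\<dots> = 0" using eq by simp
  finally have "\<forall>k. fps_nth f k - Re (of_real (fps_nth f k) * z ^ k) = 0"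
    using suminf_eq_zero_iff[OF sd] ge by blast
  from spec[OF this, of n] have "fps_nth f n * (1 - Re (z ^ n)) = 0" by (simp add: algebra_simps)
  then have R: "Re (z ^ n) = 1" using n by simp
  have "(Re (z ^ n))\<^sup>2 + (Im (z ^ n))\<^sup>2 \<le> 1"
    using nz[of n] by (simp add: cmod_def)
  then have "Im (z ^ n) = 0" using R by simp
  with R show ?thesis by (simp add: complex_eq_iff)
qed

text \<open>A zero of the discriminant means that \<open>(1 - \<sigma>) ^ 2 = Q\<close> for a square root \<open>\<sigma>\<close> of \<open>P\<close>. Then
  \<open>norm \<sigma> \<le> p\<close> and \<open>norm (1 - \<sigma>) \<le> q\<close>, and \<open>p + q = 1\<close> leaves only \<open>\<sigma> = p\<close>: the series \<open>P\<close> and \<open>Q\<close> take the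
  same values at \<open>z\<close> as at 1, which aperiodicity excludes. At \<open>z = 1\<close> the factor \<open>1 - z\<close> is responsible
  for the zero, and \<open>\<Delta>'\<close> has the positive value \<open>4 * p * q * W\<close>.\<close>

lemma discriminant_nonzero:
  fixes z :: complex
  assumes z: "norm z \<le> 1"
  shows "ev \<Delta>' z \<noteq> 0"
proof (cases "z = 1")
  case True
  have "ev \<Delta>' (of_real 1 :: complex) = of_real (ev \<Delta>' (1 :: real))"
    by (rule ev_of_real) (auto intro: ac')
  then show ?thesis using True values_at_1(8) pq W_pos by simp
next
  case False
  show ?thesis
  proof
    assume 0: "ev \<Delta>' z = 0"
    define u v where "u = ev P z" and "v = ev Q z"
    have "ev ((1 - fps_X) * \<Delta>') z = 0" using 0 z by (simp add: ev_simps ac' abs_conv_intros)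
    then have D: "(1 + u - v) * (1 + u - v) - 4 * u = 0"
      unfolding disc using z by (simp add: ev_simps ac' abs_conv_intros u_def v_def)
    define \<rho> where "\<rho> = csqrt u"
    have r2: "\<rho> * \<rho> = u" using power2_csqrt[of u] by (simp add: \<rho>_def power2_eq_square)
    have "((1 - \<rho>) * (1 - \<rho>) - v) * ((1 + \<rho>) * (1 + \<rho>) - v) = 0"
      using D unfolding r2[symmetric] by (simp add: algebra_simps)
    then have or: "(1 - \<rho>) * (1 - \<rho>) = v \<or> (1 + \<rho>) * (1 + \<rho>) = v"
      unfolding mult_eq_0_iff right_minus_eq .
    obtain \<sigma> where s: "\<sigma> * \<sigma> = u" "(1 - \<sigma>) * (1 - \<sigma>) = v"
    proof (rule disjE[OF or])
      assume c: "(1 - \<rho>) * (1 - \<rho>) = v"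
      show thesis by (rule that[OF r2 c])
    next
      assume c: "(1 + \<rho>) * (1 + \<rho>) = v"
      show thesis by (rule that[of "- \<rho>"]) (simp_all add: r2 c)
    qed
    have nn: "fps_nth P n \<ge> 0" "fps_nth Q n \<ge> 0" for n
      unfolding P_def Q_def by (auto simp: fps_mult_nth intro!: sum_nonneg mult_nonneg_nonneg nonneg)
    have "norm u \<le> p\<^sup>2" "norm v \<le> q\<^sup>2"
      unfolding u_def v_def using ev_le[OF ac'(1) nn(1) z] ev_le[OF ac'(2) nn(2) z] values_at_1 by simp_all
    then have "(norm \<sigma>)\<^sup>2 \<le> p\<^sup>2" "(norm (1 - \<sigma>))\<^sup>2 \<le> q\<^sup>2"
      unfolding s[symmetric] by (simp_all add: norm_mult power2_eq_square)
    then have le: "norm \<sigma> \<le> p" "norm (1 - \<sigma>) \<le> q" using pq by (auto intro: power2_le_imp_le)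
    have "Re \<sigma> \<le> p" "Re (1 - \<sigma>) \<le> q"
      using complex_Re_le_cmod[of \<sigma>] complex_Re_le_cmod[of "1 - \<sigma>"] le by linarith+
    then have Re: "Re \<sigma> = p" using pq by simp
    have "(Re \<sigma>)\<^sup>2 + (Im \<sigma>)\<^sup>2 \<le> p\<^sup>2"
      using \<open>(norm \<sigma>)\<^sup>2 \<le> p\<^sup>2\<close> by (simp add: cmod_power2)
    then have "Im \<sigma> = 0" using Re by simp
    with Re have sp: "\<sigma> = of_real p" by (simp add: complex_eq_iff)
    have "ev P z = of_real (ev P (1::real))"
      using s(1) by (simp add: sp values_at_1 u_def[symmetric] power2_eq_square)
    note phP = ev_eq_imp_phase[OF ac'(1) nn(1) z this]
    have "ev Q z = of_real (ev Q (1::real))"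
      using s(2) by (simp add: sp values_at_1 v_def[symmetric] power2_eq_square q_def)
    note phQ = ev_eq_imp_phase[OF ac'(2) nn(2) z this]
    have pos: "fps_nth (f * g) (i + j) > 0"
      if "fps_nth f i > 0" "fps_nth g j > 0" "\<And>n. fps_nth f n \<ge> 0" "\<And>n. fps_nth g n \<ge> 0"
      for f g :: "real fps" and i j
    proof -
      have "fps_nth f i * fps_nth g (i + j - i) \<le> fps_nth (f * g) (i + j)"
        unfolding fps_mult_nth by (rule member_le_sum) (auto intro!: mult_nonneg_nonneg that)
      moreover have "fps_nth f i * fps_nth g (i + j - i) > 0" using that by simp
      ultimately show ?thesis by linarith
    qed
    have "z = 1"
    proof (rule aperiodic[OF z])
      show "z ^ (i + j) = 1" if "fps_nth pa i > 0" "fps_nth pb j > 0" for i j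
        using phP pos[OF that nonneg(1,3)] by (simp add: P_def)
      show "z ^ (i + j) = 1" if "fps_nth qa i > 0" "fps_nth qb j > 0" for i j
        using phQ pos[OF that nonneg(2,4)] by (simp add: Q_def)
    qed
    with False show False by simp
  qed
qed

lemma disc_0: "fps_nth \<Delta>' 0 = 1"
proof -
  have "fps_nth ((1 - fps_X) * \<Delta>') 0 = 1" unfolding disc by (simp add: P_def Q_def zero)
  then show ?thesis by simp
qed

text \<open>The remaining analytic point is that \<open>1 / E\<close> has summable coefficients of order \<open>o(1/n)\<close>. Here
  \<open>E = 1 - (Q + m)\<close> where \<open>Q + m\<close> has nonnegative coefficients of sum \<open>1 - p * q < 1\<close>.\<close>

theorem walk_limit:
  assumes x: "\<And>j. x j = fps_const (of_int (sgn j)) * ta + pa * x (j + 1) + qa * y (j - 1)"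
    and y: "\<And>j. y j = fps_const (of_int (sgn j)) * tb + qb * x (j + 1) + pb * y (j - 1)"
  shows "(\<lambda>n. sqrt (real n) * fps_nth (ia * x 1 + ib * y (- 1)) n)
    \<longlonglongrightarrow> ((ev ia 1 - ev ib 1) * W + \<mu>) / sqrt (4 * p * q * W * pi)"
proof -
  define D :: "real fps" where "D = 1 - fps_X"
  have D0: "fps_nth D 0 = 1" by (simp add: D_def)
  obtain R where R: "R * R = \<Delta>'" "fps_nth R 0 = 1" "fps_conv_radius R > 1" "fps_conv_radius (inverse R) > 1"
    by (rule fps_sqrt_conv_radius[OF radius_derived(4) disc_0 discriminant_nonzero])
  define s where "s = sqrt_fps * R"
  define B where "B = 1 + P - Q"
  have PQ0: "fps_nth P 0 = 0" "fps_nth Q 0 = 0" by (simp_all add: P_def Q_def zero)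
  have s0: "fps_nth s 0 = 1" by (simp add: s_def R sqrt_fps_nth)
  have ss: "s * s = D * \<Delta>'"
  proof -
    have "s * s = (sqrt_fps * sqrt_fps) * (R * R)" by (simp add: s_def mult_ac)
    then show ?thesis by (simp add: sqrt_fps_power2 R D_def)
  qed
  then have sB: "s * s = B * B - 4 * P" using disc by (simp add: D_def B_def)
  have Bs0: "fps_nth (B + s) 0 = 2" by (simp add: B_def PQ0 s0)
  then have Bs: "B + s \<noteq> 0" by (metis fps_zero_nth zero_neq_numeral)
  \<comment> \<open>The root (B - s) / (2 * P) of the quadratic equation P * \<kappa> * \<kappa> - B * \<kappa> + 1 = 0, in a form that needs no division by P.\<close>
  define \<kappa> where "\<kappa> = 2 * inverse (B + s)"
  have "(B + s) * inverse (B + s) = 1" by (rule inverse_mult_eq_1') (simp add: Bs0 del: fps_add_nth)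
  then have k2: "(B + s) * \<kappa> = 2" by (simp add: \<kappa>_def mult.left_commute)
  define m where "m = P * \<kappa>"
  have m2: "2 * m = B - s"
  proof -
    have "(B + s) * (2 * m) = 2 * P * ((B + s) * \<kappa>)" by (simp only: m_def mult.assoc mult.commute mult.left_commute)
    also have "\<dots> = B * B - s * s" unfolding k2 sB by simp
    also have "\<dots> = (B + s) * (B - s)" by (simp add: algebra_simps)
    finally show ?thesis using Bs by simp
  qed
  have kap: "(1 - m) * \<kappa> = Q * \<kappa> + (1 - m)"
  proof -
    have "2 * (B + s) * ((1 - m) * \<kappa> - (Q * \<kappa> + (1 - m)))
      = (2 - 2 * m - 2 * Q) * ((B + s) * \<kappa>) - (B + s) * (2 - 2 * m)" by (simp add: algebra_simps)
    also have "\<dots> = 4 - 4 * B - 4 * Q + B * B - s * s" unfolding k2 m2 by (simp add: algebra_simps)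
    also have "\<dots> = 0" unfolding sB by (simp add: B_def algebra_simps)
    finally show ?thesis using Bs unfolding mult_eq_0_iff by simp
  qed
  define E where "E = 1 - Q - m"
  have E2: "2 * E = 1 - P - Q + s"
  proof -
    have "2 * E = 2 - 2 * Q - 2 * m" by (simp add: E_def algebra_simps)
    then show ?thesis unfolding m2 by (simp add: B_def)
  qed
  have EE: "E * E - P * Q = s * E"
  proof -
    have "4 * (E * E - P * Q) = (2 * E) * (2 * E) - 4 * (P * Q)" by (simp add: algebra_simps)
    also have "\<dots> = 2 * s * (2 * E) + ((1 - P - Q) * (1 - P - Q) - s * s - 4 * (P * Q))"
      unfolding E2 by (simp add: algebra_simps)
    also have "(1 - P - Q) * (1 - P - Q) - s * s - 4 * (P * Q) = 0"
      unfolding sB by (simp add: B_def algebra_simps)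
    finally have "4 * (E * E - P * Q) = 4 * (s * E)" by simp
    then show ?thesis by (simp only: mult_cancel_left) simp
  qed
  have m0: "fps_nth m 0 = 0" by (simp add: m_def PQ0)
  have E0: "fps_nth E 0 = 1" by (simp add: E_def PQ0 m0)
  define U where "U = inverse D"
  have DU: "D * U = 1" unfolding U_def by (rule inverse_mult_eq_1') (simp add: D0)
  define i where "i = inverse (s * E)"
  have i: "s * E * i = 1" unfolding i_def by (rule inverse_mult_eq_1') (simp add: s0 E0)
  define A1 A2 where "A1 = (1 + pa - qa) * U" and "A2 = (1 + pb - qb) * U"
  \<comment> \<open>Solution by determinants of the matching conditions at level 0.\<close>
  define X Y where "X = i * (pb * qb * A1 - E * A2)" and "Y = i * (E * A1 - pa * qa * A2)"
  have YE: "E * Y = A1 + pa * qa * X"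
  proof -
    have "E * Y - pa * qa * X = i * (E * E - P * Q) * A1" by (simp add: X_def Y_def P_def Q_def algebra_simps)
    also have "\<dots> = A1" unfolding EE using i by (simp add: mult_ac)
    finally show ?thesis by (simp only: diff_eq_eq)
  qed
  have XE: "E * X = pb * qb * Y - A2"
  proof -
    have "E * X - pb * qb * Y = - (i * (E * E - P * Q)) * A2" by (simp add: X_def Y_def P_def Q_def algebra_simps)
    also have "\<dots> = - A2" unfolding EE using i by (simp add: mult_ac)
    finally show ?thesis by (simp add: algebra_simps)
  qed
  have t: "ta = U - pa * U - qa * U" "tb = U - pb * U - qb * U"
  proof -
    have c: "U * (D * z) = z" for z
      by (simp add: mult.assoc[symmetric] mult.commute[of U D] DU)
    show "ta = U - pa * U - qa * U"
      using c[of ta] unfolding survive(1)[folded D_def] by (simp add: algebra_simps)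
    show "tb = U - pb * U - qb * U"
      using c[of tb] unfolding survive(2)[folded D_def] by (simp add: algebra_simps)
  qed
  have sol: "x 1 = U + qa * X" "y (- 1) = - U + qb * Y"
  proof -
    show "x 1 = U + qa * X"
      by (rule walk_system_solution(1)[OF t _ _ _ _ zero(1,2,3,4) x y, where m = m and \<kappa> = \<kappa> and X = X and Y = Y])
        (use kap YE XE in \<open>simp_all add: m_def P_def Q_def E_def A1_def A2_def\<close>)
    show "y (- 1) = - U + qb * Y"
      by (rule walk_system_solution(2)[OF t _ _ _ _ zero(1,2,3,4) x y, where m = m and \<kappa> = \<kappa> and X = X and Y = Y])
        (use kap YE XE in \<open>simp_all add: m_def P_def Q_def E_def A1_def A2_def\<close>)
  qed
  have Dnz: "D \<noteq> 0" and snz: "s \<noteq> 0" using D0 s0 by auto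
  define NX where "NX = \<Delta>' + s * (\<delta> + ta * (1 + pb) + tb * (1 - pa) - D * ta * tb)
      - 2 * (E * (\<eta> - \<delta> - 2 * ta)) + 2 * (qa * pb * (\<eta> + \<delta> - 2 * tb))"
  define NY where "NY = - \<Delta>' - s * (- \<delta> + tb * (1 + pa) + ta * (1 - pb) - D * ta * tb)
      + 2 * (E * (\<eta> + \<delta> - 2 * tb)) - 2 * (qb * pa * (\<eta> - \<delta> - 2 * ta))"
  note bv = boundary_values[OF survive[folded D_def] difference[folded D_def] DU Dnz ss snz
      E2[unfolded P_def Q_def] EE[unfolded P_def Q_def] YE[unfolded A1_def] XE[unfolded A2_def]
      \<eta>_def[folded D_def]]
  have N: "4 * (s * E * x 1) = NX" "4 * (s * E * y (- 1)) = NY"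
    unfolding sol NX_def NY_def by (rule bv)+
  define N where "N = ia * NX + ib * NY"
  define H where "H = inverse R * inverse E * fps_const (1 / 4) * N"
  have RR: "R * inverse R = 1" by (rule inverse_mult_eq_1') (simp add: R)
  have EI: "E * inverse E = 1" by (rule inverse_mult_eq_1') (simp add: E0)
  have G: "ia * x 1 + ib * y (- 1) = H * inv_sqrt_fps"
  proof -
    let ?G = "ia * x 1 + ib * y (- 1)"
    have "N = 4 * (s * E * ?G)" unfolding N_def N[symmetric] by (simp add: algebra_simps)
    then have "H * inv_sqrt_fps = (R * inverse R) * (E * inverse E) * (fps_const (1 / 4) * 4)
        * (sqrt_fps * inv_sqrt_fps) * ?G"
      by (simp only: H_def s_def mult.assoc mult.commute mult.left_commute)
    also have "fps_const (1 / 4) * 4 = (1 :: real fps)" by (simp add: numeral_fps_const)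
    finally show ?thesis by (simp add: RR EI sqrt_fps_inv)
  qed
  note st_radius = small_tail_of_conv_radius[OF radius(1)] small_tail_of_conv_radius[OF radius(2)]
    small_tail_of_conv_radius[OF radius(3)] small_tail_of_conv_radius[OF radius(4)]
    small_tail_of_conv_radius[OF radius(5)] small_tail_of_conv_radius[OF radius(6)]
    small_tail_of_conv_radius[OF radius(7)] small_tail_of_conv_radius[OF radius(8)]
    small_tail_of_conv_radius[OF radius(9)]
    radius_derived[THEN small_tail_of_conv_radius]
    R(3,4)[THEN small_tail_of_conv_radius]
  have st_const: "small_tail (fps_const c)" "small_tail (numeral k)" "small_tail 1" "small_tail fps_X" for c k
    by (intro small_tail_of_conv_radius conv_radius_gt_1_intros)+
  note st_ops = small_tail_add small_tail_diff small_tail_mult small_tail_uminus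
  have sts: "small_tail s" unfolding s_def by (intro st_ops small_tail_sqrt_fps st_radius)
  have stB: "small_tail B" unfolding B_def by (intro st_ops st_radius st_const)
  have m_half: "m = fps_const (1 / 2) * (B - s)"
  proof -
    have "fps_const (1 / 2) * (2 * m) = (fps_const (1 / 2) * 2) * m" by (simp only: mult.assoc)
    also have "fps_const (1 / 2) * 2 = (1 :: real fps)" by (simp add: numeral_fps_const)
    finally show ?thesis unfolding m2 by simp
  qed
  have stm: "small_tail m" unfolding m_half by (intro st_ops sts stB st_const)
  have stE: "small_tail E" unfolding E_def by (intro st_ops stm st_radius st_const)
  have stD: "small_tail D" unfolding D_def by (intro st_ops st_const)
  have s1: "ev s (1 :: real) = 0"
  proof -
    have "ev (sqrt_fps * sqrt_fps) (1 :: real) = 0"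
      unfolding sqrt_fps_power2 by (simp add: ev_simps abs_conv_intros)
    then have "ev sqrt_fps (1 :: real) = 0"
      by (simp add: ev_simps small_tail_abs_conv small_tail_sqrt_fps)
    then show ?thesis
      by (simp add: s_def ev_simps small_tail_abs_conv[OF small_tail_sqrt_fps] small_tail_abs_conv[OF st_radius(14)])
  qed
  have m1: "ev m (1 :: real) = p"
  proof -
    have "ev B (1 :: real) = 2 * p"
      by (simp add: B_def ev_simps ac' abs_conv_intros values_at_1 q_def power2_eq_square algebra_simps)
    then show ?thesis
      by (simp add: m_half ev_simps s1 abs_conv_intros small_tail_abs_conv[OF stB] small_tail_abs_conv[OF sts])
  qed
  have E1: "ev E (1 :: real) = p * q"
    by (simp add: E_def ev_simps m1 ac' abs_conv_intros small_tail_abs_conv[OF stm] values_at_1)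
      (simp add: q_def power2_eq_square algebra_simps)
  have nnP: "fps_nth P n \<ge> 0" "fps_nth Q n \<ge> 0" for n
    unfolding P_def Q_def by (auto simp: fps_mult_nth intro!: sum_nonneg mult_nonneg_nonneg nonneg)
  define k where "k = \<kappa> - 1"
  \<comment> \<open>A form of the quadratic equation with nonnegative coefficients; as P and Q have no constant term, it determines the coefficients of k recursively.\<close>
  have k_eq: "k = Q * (1 + k) + P * ((1 + k) * k)"
    using kap by (simp add: k_def m_def algebra_simps)
  have k_nonneg: "fps_nth k n \<ge> 0" for n
  proof (induction n rule: less_induct)
    case (less n)
    have a: "fps_nth (f * g) n \<ge> 0"
      if "\<And>i. fps_nth f i \<ge> 0" "fps_nth f 0 = 0" "\<And>i. i < n \<Longrightarrow> fps_nth g i \<ge> 0" for f g :: "real fps"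
      unfolding fps_mult_nth
    proof (rule sum_nonneg)
      fix i assume "i \<in> {0..n}"
      then show "fps_nth f i * fps_nth g (n - i) \<ge> 0" using that by (cases "i = 0") auto
    qed
    have b: "fps_nth ((1 + k) * k) i \<ge> 0" if "i < n" for i
      unfolding fps_mult_nth using less that by (auto intro!: sum_nonneg mult_nonneg_nonneg add_nonneg_nonneg)
    have c: "fps_nth (1 + k) i \<ge> 0" if "i < n" for i using less[OF that] by simp
    have "fps_nth k n = fps_nth (Q * (1 + k)) n + fps_nth (P * ((1 + k) * k)) n"
      by (subst k_eq) simp
    then show ?case using a[OF nnP(2) PQ0(2) c] a[OF nnP(1) PQ0(1) b] by simp
  qed
  have m_nonneg: "fps_nth m n \<ge> 0" for n
  proof -
    have "m = P * (1 + k)" by (simp add: m_def k_def)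
    moreover have "fps_nth (1 + k) n \<ge> 0" for n using k_nonneg[of n] by simp
    ultimately show ?thesis by (simp only: fps_mult_nth) (intro sum_nonneg mult_nonneg_nonneg nnP)
  qed
  have stEI: "small_tail (inverse E)"
  proof -
    have "small_tail (inverse (1 - (Q + m)))"
    proof (rule small_tail_inverse)
      show "small_tail (Q + m)" by (intro st_ops stm st_radius)
      show "fps_nth (Q + m) 0 = 0" by (simp add: PQ0 m0)
      have "(\<Sum>n. \<bar>fps_nth (Q + m) n\<bar>) = ev (Q + m) (1 :: real)"
        using nnP(2) m_nonneg by (simp add: ev_def)
      also have "\<dots> = q\<^sup>2 + p"
        by (simp add: ev_simps m1 ac' small_tail_abs_conv[OF stm] values_at_1)
      also have "\<dots> < 1"
      proof -
        have "q\<^sup>2 + p = 1 - p * q" by (simp add: q_def power2_eq_square algebra_simps)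
        then show ?thesis using pq by simp
      qed
      finally show "(\<Sum>n. \<bar>fps_nth (Q + m) n\<bar>) < 1" .
    qed
    then show ?thesis by (simp add: E_def diff_diff_eq)
  qed
  have stNX: "small_tail NX" unfolding NX_def by (intro st_ops sts stE stD st_radius st_const)
  have stNY: "small_tail NY" unfolding NY_def by (intro st_ops sts stE stD st_radius st_const)
  have stN: "small_tail N" unfolding N_def by (intro st_ops stNX stNY st_radius)
  have stH: "small_tail H" unfolding H_def by (intro st_ops stN stEI st_radius st_const)
  note acs = small_tail_abs_conv[OF sts] small_tail_abs_conv[OF stE] small_tail_abs_conv[OF stD]
    small_tail_abs_conv[OF stNX] small_tail_abs_conv[OF stNY] small_tail_abs_conv[OF stN]
    small_tail_abs_conv[OF stEI] R(3,4)[THEN abs_conv_of_conv_radius]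
  have NX1: "ev NX (1 :: real) = 4 * p * q * (W + \<mu>)"
    by (simp add: NX_def ev_simps ac ac' acs abs_conv_intros s1 E1 values_at_1)
      (simp add: \<mu>_def algebra_simps)
  have NY1: "ev NY (1 :: real) = 4 * p * q * (\<mu> - W)"
    by (simp add: NY_def ev_simps ac ac' acs abs_conv_intros s1 E1 values_at_1)
      (simp add: \<mu>_def algebra_simps)
  have N1: "ev N (1 :: real) = 4 * p * q * ((ev ia 1 - ev ib 1) * W + \<mu>)"
  proof -
    have "ev N (1 :: real) = ev ia 1 * (4 * p * q * (W + \<mu>)) + ev ib 1 * (4 * p * q * (\<mu> - W))"
      by (simp add: N_def ev_simps ac acs abs_conv_intros NX1 NY1)
    also have "\<dots> = 4 * p * q * ((ev ia 1 - ev ib 1) * W + (ev ia 1 + ev ib 1) * \<mu>)"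
      by (simp add: algebra_simps)
    finally show ?thesis by (simp add: start)
  qed
  have R_nz: "ev R t \<noteq> 0" if "\<bar>t\<bar> \<le> 1" for t :: real
  proof
    assume "ev R t = 0"
    moreover have "ev R t * ev (inverse R) t = ev (R * inverse R) t"
      using that acs by (simp add: ev_simps)
    ultimately show False by (simp add: RR)
  qed
  \<comment> \<open>The root R is real and without zeros on the unit interval, hence keeps the sign of its constant term 1.\<close>
  have R_pos: "ev R (1 :: real) > 0"
  proof (rule ccontr)
    assume "\<not> ev R (1 :: real) > 0"
    then have le: "ev R (1 :: real) \<le> 0" by simp
    have cont: "continuous_on {0..1 :: real} (ev R)"
    proof -
      have "continuous_on {0..1 :: real} (eval_fps R)"
      proof (rule continuous_on_subset[OF continuous_on_eval_fps], rule subsetI)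
        fix t :: real assume "t \<in> {0..1}"
        then have "ereal \<bar>t\<bar> \<le> 1" by simp
        then show "t \<in> eball 0 (fps_conv_radius R)"
          using le_less_trans[OF _ R(3)] by (simp add: eball_def)
      qed
      moreover have "eval_fps R = ev R" by (simp add: fun_eq_iff eval_fps_def ev_def)
      ultimately show ?thesis by simp
    qed
    have "ev R (0 :: real) = 1"
      unfolding ev_def using R(2) by (subst suminf_finite[of "{0}"]) (auto simp: power_0_left)
    then have "\<exists>t\<ge>0. t \<le> 1 \<and> ev R t = (0 :: real)"
      by (intro IVT2' le cont) simp_all
    then obtain t :: real where "0 \<le> t" "t \<le> 1" "ev R t = 0" by blast
    with R_nz[of t] show False by simp
  qed
  have R1: "ev R (1 :: real) = sqrt (4 * p * q * W)"
  proof -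
    have "ev R (1 :: real) * ev R 1 = 4 * p * q * W"
      using values_at_1(8) acs by (simp add: R(1)[symmetric] ev_simps)
    then show ?thesis using R_pos by (intro real_sqrt_unique[symmetric]) (simp_all add: power2_eq_square)
  qed
  have RI: "ev (inverse R) (1 :: real) = 1 / ev R 1"
  proof -
    have "ev R (1 :: real) * ev (inverse R) 1 = 1"
      using acs ev_mult[of "1 :: real" R "inverse R"] by (simp add: RR)
    then show ?thesis using R_pos by (simp add: field_simps)
  qed
  have EI1: "ev (inverse E) (1 :: real) = 1 / (p * q)"
  proof -
    have "ev E (1 :: real) * ev (inverse E) 1 = 1"
      using acs ev_mult[of "1 :: real" E "inverse E"] by (simp add: EI)
    then show ?thesis using pq by (simp add: E1 field_simps)
  qed
  have "ev H (1 :: real) = ((ev ia 1 - ev ib 1) * W + \<mu>) / sqrt (4 * p * q * W)"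
    using pq R_pos
    by (simp add: H_def ev_simps acs abs_conv_intros RI EI1 N1 R1)
  moreover have "sqrt (4 * p * q * W * pi) = sqrt (4 * p * q * W) * sqrt pi"
    by (simp only: real_sqrt_mult)
  ultimately show ?thesis using transfer_inv_sqrt[OF stH] unfolding G by simp
qed

end

section \<open>Words and hits\<close>

text \<open>Histories are lists with the newest letter first, so that a step of the process is a \<open>Cons\<close>; this
  operator averages over the next letter. Its iterates compute expectations without any
  measure theory.\<close>

definition step_avg :: "(bool list \<Rightarrow> real) \<Rightarrow> bool list \<Rightarrow> real" where
  "step_avg g h = (g (True # h) + g (False # h)) / 2"

lemma step_avg_const [simp]: "step_avg (\<lambda>_. c) = (\<lambda>_. c)"
  by (simp add: step_avg_def fun_eq_iff)

lemma step_avg_mono: "(\<And>c. f (c # h) \<le> g (c # h)) \<Longrightarrow> step_avg f h \<le> step_avg g h"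
  unfolding step_avg_def by (intro divide_right_mono add_mono) auto

lemma step_avg_nonneg: "(\<And>c. 0 \<le> f (c # h)) \<Longrightarrow> 0 \<le> step_avg f h"
  unfolding step_avg_def by simp

lemma step_avg_ge_half:
  assumes "\<And>c. 0 \<le> f (c # h)" shows "f (c # h) / 2 \<le> step_avg f h"
  using assms[of True] assms[of False] by (cases c) (simp_all add: step_avg_def)

lemma step_avg_cong: "(\<And>c. f (c # h) = g (c # h')) \<Longrightarrow> step_avg f h = step_avg g h'"
  by (simp add: step_avg_def)

lemma funpow_step_avg_cmult:
  "(step_avg ^^ n) (\<lambda>h. c * g h) = (\<lambda>h. c * (step_avg ^^ n) g h)"
  by (induction n) (auto simp: step_avg_def fun_eq_iff algebra_simps)

lemma funpow_step_avg_const [simp]: "(step_avg ^^ n) (\<lambda>_. c) = (\<lambda>_. c)"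
  by (induction n) auto

lemma uniform_words:
  "length w = n \<Longrightarrow> (step_avg ^^ n) (\<lambda>h. if take n h = w then 1 else 0) = (\<lambda>_. (1/2) ^ n)"
proof (induction n arbitrary: w)
  case (Suc n)
  then obtain x w' where w: "w = x # w'" "length w' = n" by (cases w) auto
  have "step_avg (\<lambda>h. if take (Suc n) h = w then 1 else 0) = (\<lambda>h. 1/2 * (if take n h = w' then 1 else 0))"
    by (cases x) (auto simp: step_avg_def w fun_eq_iff)
  then have "(step_avg ^^ Suc n) (\<lambda>h. if take (Suc n) h = w then 1 else 0)
      = (step_avg ^^ n) (\<lambda>h. 1/2 * (if take n h = w' then 1 else 0))"
    by (simp add: funpow_swap1)
  then show ?case
    unfolding funpow_step_avg_cmult Suc.IH[OF w(2)] by simp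
qed (simp add: fun_eq_iff)

text \<open>In this section \<open>A\<close> and \<open>B\<close> are the reversals of the two words of the race, in accordance with the
  order of letters in histories.\<close>

locale word_pair =
  fixes A B :: "bool list" and L :: nat
  assumes len: "length A = L" "length B = L" and L1: "L \<ge> 1" and AB: "A \<noteq> B"
begin

definition kind :: "bool list \<Rightarrow> int" where
  "kind h = (if take L h = A then 1 else if take L h = B then - 1 else 0)"

definition word :: "int \<Rightarrow> bool list" where
  "word c = (if c = 1 then A else B)"

lemma word_simps [simp]: "word 1 = A" "word (- 1) = B"
  by (simp_all add: word_def)

lemma kind_words [simp]: "kind A = 1" "kind B = - 1" "kind [] = 0"
  "kind (A @ h) = 1" "kind (B @ h) = - 1"
  using len AB L1 by (auto simp: kind_def)

lemma kind_cases: "kind h = 1 \<or> kind h = - 1 \<or> kind h = 0"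
  by (simp add: kind_def)

lemma kind_eq_1: "kind h = 1 \<longleftrightarrow> take L h = A" and kind_eq_m1: "kind h = - 1 \<longleftrightarrow> take L h = B"
  using AB by (auto simp: kind_def)

lemma take_word: "kind h = c \<Longrightarrow> c \<noteq> 0 \<Longrightarrow> take L h = take L (word c)"
proof -
  assume "kind h = c" "c \<noteq> 0"
  moreover have "take L A = A" "take L B = B" using len by auto
  ultimately show ?thesis by (metis kind_cases kind_eq_1 kind_eq_m1 word_simps)
qed

lemma kind_cong: "take L h = take L h' \<Longrightarrow> kind h = kind h'"
  by (simp add: kind_def)

lemma kind_Cons_cong: "take (L - 1) h = take (L - 1) h' \<Longrightarrow> kind (c # h) = kind (c # h')"
  using L1 by (intro kind_cong) (cases L, auto)

lemma take_Cons_cong: "take (L - 1) h = take (L - 1) h' \<Longrightarrow> take (L - 1) (c # h) = take (L - 1) (c # h')"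
proof (cases "L - 1")
  case (Suc m)
  assume "take (L - 1) h = take (L - 1) h'"
  from arg_cong[OF this[unfolded Suc], of "take m"] show ?thesis unfolding Suc by (simp add: min_def)
qed simp

text \<open>The probability that, after the history \<open>h\<close>, the next hit comes after exactly \<open>n\<close> more steps and is of
  type \<open>e\<close>. A hit already present in \<open>h\<close> itself does not count.\<close>

primrec first_hit :: "nat \<Rightarrow> int \<Rightarrow> bool list \<Rightarrow> real" where
  "first_hit 0 e h = 0"
| "first_hit (Suc n) e h = step_avg (\<lambda>h'. if kind h' = 0 then first_hit n e h'
      else if n = 0 \<and> kind h' = e then 1 else 0) h"

primrec no_hit :: "nat \<Rightarrow> bool list \<Rightarrow> real" where
  "no_hit 0 h = 1"
| "no_hit (Suc n) h = step_avg (\<lambda>h'. if kind h' = 0 then no_hit n h' else 0) h"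

text \<open>The expectation of \<open>\<gamma> j k\<close> after \<open>n\<close> steps, where \<open>j\<close> is the difference of the counts and \<open>k\<close> the type
  of the last position. With \<open>\<gamma> = sgn j\<close> it is the expected sign; with the indicator of \<open>k = e\<close> it counts
  visits.\<close>

primrec score :: "(int \<Rightarrow> int \<Rightarrow> real) \<Rightarrow> nat \<Rightarrow> int \<Rightarrow> bool list \<Rightarrow> real" where
  "score \<gamma> 0 j h = \<gamma> j (kind h)"
| "score \<gamma> (Suc n) j h = step_avg (\<lambda>h'. score \<gamma> n (j + kind h') h') h"

text \<open>An occurrence that ends later overlaps the past in at most \<open>L - 1\<close> letters. This is what makes hits a
  renewal process.\<close>

lemma first_hit_cong: "take (L - 1) h = take (L - 1) h' \<Longrightarrow> first_hit n e h = first_hit n e h'"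
proof (induction n arbitrary: h h')
  case (Suc n)
  show ?case
    unfolding first_hit.simps
    by (rule step_avg_cong)
      (simp add: kind_Cons_cong[OF Suc.prems] Suc.IH[OF take_Cons_cong[OF Suc.prems]])
qed simp

lemma take_L_imp: "take L h = take L h' \<Longrightarrow> take (L - 1) h = take (L - 1) h'"
  by (metis diff_le_self min.absorb1 take_take)

lemma score_cong: "take L h = take L h' \<Longrightarrow> score \<gamma> n j h = score \<gamma> n j h'"
proof (induction n arbitrary: h h' j)
  case 0
  then show ?case by (simp add: kind_cong[of h h'])
next
  case (Suc n)
  have t: "take (L - 1) h = take (L - 1) h'" by (rule take_L_imp[OF Suc.prems])
  have "take L (c # h) = take L (c # h')" for c
    using t L1 by (cases L) auto
  then show ?case
    unfolding score.simps by (intro step_avg_cong) (metis Suc.IH kind_cong)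
qed

lemma first_hit_word: "kind h = c \<Longrightarrow> c \<noteq> 0 \<Longrightarrow> first_hit n e h = first_hit n e (word c)"
  by (intro first_hit_cong take_L_imp take_word)

lemma score_word: "kind h = c \<Longrightarrow> c \<noteq> 0 \<Longrightarrow> score \<gamma> n j h = score \<gamma> n j (word c)"
  by (intro score_cong take_word)

lemma first_hit_nonneg: "first_hit n e h \<ge> 0"
  by (induction n arbitrary: h) (auto intro!: step_avg_nonneg)

lemma no_hit_nonneg: "no_hit n h \<ge> 0"
  by (induction n arbitrary: h) (auto intro!: step_avg_nonneg)

lemma no_hit_decrease: "no_hit n h - no_hit (Suc n) h = first_hit (Suc n) 1 h + first_hit (Suc n) (- 1) h"
proof (induction n arbitrary: h)
  case 0
  show ?case using kind_cases[of "True # h"] kind_cases[of "False # h"]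
    by (auto simp: step_avg_def)
next
  case (Suc n)
  define F where "F = (\<lambda>h'. if kind h' = 0 then no_hit n h' - no_hit (Suc n) h' else 0)"
  have "no_hit (Suc n) h - no_hit (Suc (Suc n)) h = step_avg F h"
    unfolding no_hit.simps(2)[of n h] no_hit.simps(2)[of "Suc n" h]
    by (simp add: F_def step_avg_def diff_divide_distrib[symmetric] del: no_hit.simps)
  also have "\<dots> = first_hit (Suc (Suc n)) 1 h + first_hit (Suc (Suc n)) (- 1) h"
    unfolding first_hit.simps(2)[of "Suc n" _ h] F_def Suc.IH
    by (simp add: step_avg_def add_divide_distrib[symmetric] del: first_hit.simps)
  finally show ?case .
qed

text \<open>Decomposition according to the time and the type of the next hit. For \<open>n = 0\<close> it would need \<open>\<gamma> j (kind h)\<close>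
  in place of \<open>\<gamma> j 0\<close>, hence the assumption.\<close>

lemma score_renewal:
  assumes "kind h = 0 \<or> n \<ge> 1"
  shows "score \<gamma> n j h = (\<Sum>t\<le>n. first_hit t 1 h * score \<gamma> (n - t) (j + 1) A
      + first_hit t (- 1) h * score \<gamma> (n - t) (j - 1) B) + no_hit n h * \<gamma> j 0"
  using assms
proof (induction n arbitrary: h)
  case (Suc n)
  define S where "S = (\<lambda>t. score \<gamma> (n - t) (j + 1) A)"
  define S' where "S' = (\<lambda>t. score \<gamma> (n - t) (j - 1) B)"
  define X where "X = (\<lambda>t e h'. if kind h' = 0 then first_hit t e h' else if t = 0 \<and> kind h' = e then 1 else 0)"
  define V where "V = (\<lambda>h'. if kind h' = 0 then no_hit n h' else 0)"
  have pw: "score \<gamma> n (j + kind h') h' = (\<Sum>t\<le>n. X t 1 h' * S t + X t (- 1) h' * S' t) + V h' * \<gamma> j 0" for h'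
  proof (cases "kind h' = 0")
    case True
    then show ?thesis using Suc.IH[of h'] by (simp add: X_def S_def S'_def V_def)
  next
    case False
    then consider "kind h' = 1" | "kind h' = - 1" using kind_cases[of h'] by auto
    then show ?thesis
    proof cases
      case 1
      have "(\<Sum>t\<le>n. X t 1 h' * S t + X t (- 1) h' * S' t) = (\<Sum>t\<in>{0}. S t)"
        using 1 by (intro sum.mono_neutral_cong_right) (auto simp: X_def)
      then show ?thesis using 1 score_word[OF 1] by (simp add: S_def V_def)
    next
      case 2
      have "(\<Sum>t\<le>n. X t 1 h' * S t + X t (- 1) h' * S' t) = (\<Sum>t\<in>{0}. S' t)"
        using 2 by (intro sum.mono_neutral_cong_right) (auto simp: X_def)
      then show ?thesis using 2 score_word[OF 2] by (simp add: S'_def V_def)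
    qed
  qed
  have fh: "first_hit (Suc t) e h = step_avg (X t e) h" for t e by (simp add: X_def)
  have nh: "no_hit (Suc n) h = step_avg V h" by (simp add: V_def)
  have "(\<Sum>t\<le>Suc n. first_hit t 1 h * score \<gamma> (Suc n - t) (j + 1) A
      + first_hit t (- 1) h * score \<gamma> (Suc n - t) (j - 1) B)
    = (\<Sum>t\<le>n. step_avg (X t 1) h * S t + step_avg (X t (- 1)) h * S' t)"
    by (subst sum.atMost_Suc_shift) (simp add: fh S_def S'_def del: first_hit.simps(2))
  also have "\<dots> = step_avg (\<lambda>h'. \<Sum>t\<le>n. X t 1 h' * S t + X t (- 1) h' * S' t) h"
    unfolding step_avg_def sum.distrib[symmetric] sum_divide_distrib
    by (intro sum.cong refl) (simp add: field_simps)
  finally have "(\<Sum>t\<le>Suc n. first_hit t 1 h * score \<gamma> (Suc n - t) (j + 1) A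
      + first_hit t (- 1) h * score \<gamma> (Suc n - t) (j - 1) B) + no_hit (Suc n) h * \<gamma> j 0
    = step_avg (\<lambda>h'. (\<Sum>t\<le>n. X t 1 h' * S t + X t (- 1) h' * S' t) + V h' * \<gamma> j 0) h"
    unfolding nh by (simp add: step_avg_def field_simps)
  then show ?case unfolding score.simps(2) pw by simp
qed simp

lemma no_hit_add_le:
  assumes "\<And>h. no_hit n h \<le> \<beta>" shows "no_hit (m + n) h \<le> \<beta> * no_hit m h"
proof (induction m arbitrary: h)
  case 0
  then show ?case using assms by simp
next
  case (Suc m)
  have "no_hit (Suc m + n) h \<le> step_avg (\<lambda>h'. \<beta> * (if kind h' = 0 then no_hit m h' else 0)) h"
    using Suc by (auto intro: step_avg_mono)
  also have "\<dots> = \<beta> * no_hit (Suc m) h" by (simp add: step_avg_def algebra_simps)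
  finally show ?case .
qed

lemma no_hit_le_1: "no_hit n h \<le> 1"
proof (induction n arbitrary: h)
  case (Suc n)
  have "step_avg (\<lambda>h'. if kind h' = 0 then no_hit n h' else 0) h \<le> step_avg (\<lambda>_. 1) h"
    using Suc.IH by (intro step_avg_mono) auto
  then show ?case by simp
qed simp

lemma no_hit_path:
  "xs \<noteq> [] \<Longrightarrow> kind (xs @ h) \<noteq> 0 \<Longrightarrow> no_hit (length xs) h \<le> 1 - (1/2) ^ length xs"
proof (induction xs arbitrary: h rule: rev_induct)
  case (snoc x ys)
  define V where "V = (\<lambda>h'. if kind h' = 0 then no_hit (length ys) h' else 0)"
  have V1: "V h' \<le> 1" for h' using no_hit_le_1 by (simp add: V_def)
  have "V (x # h) \<le> 1 - (1/2) ^ length ys"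
  proof (cases "kind (x # h) = 0")
    case True
    then have "ys \<noteq> []" using snoc.prems by auto
    then show ?thesis using snoc.IH[of "x # h"] snoc.prems True by (simp add: V_def)
  qed (simp add: V_def power_le_one)
  then have "step_avg V h \<le> (1 + (1 - (1/2) ^ length ys)) / 2"
    using V1[of "True # h"] V1[of "False # h"] by (cases x) (auto simp: step_avg_def)
  then show ?case by (simp add: V_def field_simps)
qed simp

text \<open>From any history, the next \<open>L\<close> letters spell the word \<open>A\<close> with probability \<open>2 ^ (- L)\<close>.\<close>

lemma no_hit_block: "no_hit L h \<le> 1 - (1/2) ^ L"
proof -
  have "A \<noteq> []" using len L1 by auto
  from no_hit_path[OF this, of h] show ?thesis by (simp add: len)
qed

lemma no_hit_geometric: "\<exists>C r. 0 < r \<and> r < 1 \<and> (\<forall>n h. no_hit n h \<le> C * r ^ n)"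
proof -
  define \<beta> :: real where "\<beta> = 1 - (1/2) ^ L"
  have b: "0 < \<beta>" "\<beta> < 1"
    using L1 power_decreasing[of 1 L "1/2 :: real"] by (auto simp: \<beta>_def)
  define r where "r = root L \<beta>"
  have r: "0 < r" "r < 1" "r ^ L = \<beta>" using b L1 by (auto simp: r_def real_root_lt_1_iff)
  have block: "no_hit (k * L + i) h \<le> \<beta> ^ k" for k i h
  proof (induction k arbitrary: h)
    case 0
    show ?case by (simp add: no_hit_le_1)
  next
    case (Suc k)
    have "no_hit (L + (k * L + i)) h \<le> \<beta> ^ k * no_hit L h" by (rule no_hit_add_le[OF Suc])
    also have "\<dots> \<le> \<beta> ^ k * \<beta>" using no_hit_block b by (intro mult_left_mono) (auto simp: \<beta>_def)
    finally show ?case by (simp add: add.assoc mult.commute)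
  qed
  have "no_hit n h \<le> (1 / r ^ L) * r ^ n" for n h
  proof -
    have "no_hit n h \<le> \<beta> ^ (n div L)" using block[of "n div L" "n mod L" h] by simp
    also have "\<dots> = r ^ (n div L * L)" using r by (simp add: power_mult mult.commute[of _ L])
    also have "\<dots> \<le> (1 / r ^ L) * r ^ n"
    proof -
      have "n \<le> n div L * L + L" using mod_less_divisor[of L n] L1 div_mult_mod_eq[of n L] by linarith
      then have "r ^ (n div L * L) * r ^ L \<le> r ^ n"
        unfolding power_add[symmetric] using r by (intro power_decreasing) auto
      then show ?thesis using r b by (simp add: field_simps)
    qed
    finally show ?thesis .
  qed
  with r show ?thesis by blast
qed

lemma first_hit_le:
  assumes "e = 1 \<or> e = - 1" shows "first_hit (Suc n) e h \<le> no_hit n h"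
  using no_hit_decrease[of n h] no_hit_nonneg[of "Suc n" h] assms
    first_hit_nonneg[of "Suc n" 1 h] first_hit_nonneg[of "Suc n" "- 1" h]
  by (auto simp del: first_hit.simps no_hit.simps)

text \<open>After \<open>L\<close> steps the window consists of fresh letters only.\<close>

lemma visits_eventually_uniform:
  assumes n: "n \<ge> L" and e: "e = 1 \<or> e = - 1"
  shows "score (\<lambda>_ k. if k = e then 1 else 0) n j h = (1/2) ^ L"
proof -
  have "score (\<lambda>_ k. if k = e then 1 else 0) n j h
      = (step_avg ^^ n) (\<lambda>h. if kind h = e then 1 else 0) h" for n
    by (induction n arbitrary: j h) simp_all
  also have "(\<lambda>h. if kind h = e then 1 else (0 :: real)) = (\<lambda>h. if take L h = word e then 1 else 0)"
    using e kind_eq_1 kind_eq_m1 by auto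
  also have "(step_avg ^^ n) \<dots> h = (step_avg ^^ (n - L)) ((step_avg ^^ L) (\<lambda>h. if take L h = word e then 1 else 0)) h"
    using n by (simp add: funpow_add[symmetric, unfolded o_def, THEN fun_cong] del: funpow.simps)
  finally show ?thesis
    using e len by (simp add: uniform_words word_def)
qed

lemma first_hit_step: "kind (c # h) = 0 \<Longrightarrow> first_hit n e (c # h) / 2 \<le> first_hit (Suc n) e h"
  unfolding first_hit.simps(2)
  using step_avg_ge_half[of "\<lambda>h'. if kind h' = 0 then first_hit n e h' else if n = 0 \<and> kind h' = e then 1 else 0" h c]
  by (simp add: first_hit_nonneg)

lemma first_hit_now: "kind (c # h) \<noteq> 0 \<Longrightarrow> first_hit 1 (kind (c # h)) h > 0"
  by (cases c) (auto simp: step_avg_def)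

lemma first_hit_exists: "\<exists>n e. (e = 1 \<or> e = - 1) \<and> first_hit n e h > 0"
proof (rule ccontr)
  assume "\<not> ?thesis"
  then have none: "\<not> first_hit n e h > 0" if "e = 1 \<or> e = - 1" for n e using that by blast
  have zero: "first_hit n 1 h = 0" "first_hit n (- 1) h = 0" for n
    using none[of 1 n] none[of "- 1" n] first_hit_nonneg[of n 1 h] first_hit_nonneg[of n "- 1" h] by linarith+
  have "no_hit n h = 1" for n
  proof (induction n)
    case (Suc n)
    then show ?case using no_hit_decrease[of n h] unfolding zero by simp
  qed simp
  then have "no_hit L h = 1" .
  moreover have "(1/2 :: real) ^ L > 0" by simp
  ultimately show False using no_hit_block[of h] by linarith
qed

primrec last_hit :: "bool list \<Rightarrow> int" where
  "last_hit [] = 0"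
| "last_hit (x # h) = (if kind (x # h) \<noteq> 0 then kind (x # h) else last_hit h)"

lemma last_hit_cases: "last_hit h = 1 \<or> last_hit h = - 1 \<or> last_hit h = 0"
  by (induction h) (use kind_cases in auto)

lemma last_hit_append: "last_hit h \<noteq> 0 \<Longrightarrow> last_hit (v @ h) \<noteq> 0"
  by (induction v) auto

lemma last_hit_kind: "kind h \<noteq> 0 \<Longrightarrow> last_hit h = kind h"
  by (cases h) auto

text \<open>What can be the next hit from \<open>h\<close> can be the next hit from the last word hit in \<open>h\<close>: go from there to
  \<open>h\<close> first, which takes a number \<open>d\<close> of steps independent of the continuation.\<close>

lemma first_hit_from_last_hit:
  assumes "last_hit h \<noteq> 0"
  shows "\<exists>d. \<forall>n e. first_hit n e h > 0 \<longrightarrow> first_hit (n + d) e (word (last_hit h)) > 0"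
  using assms
proof (induction h)
  case (Cons x h)
  show ?case
  proof (cases "kind (x # h) = 0")
    case False
    then show ?thesis using first_hit_word[OF refl False] by (intro exI[of _ 0]) simp
  next
    case True
    then obtain d where d: "\<And>n e. first_hit n e h > 0 \<Longrightarrow> first_hit (n + d) e (word (last_hit h)) > 0"
      using Cons by auto
    have "first_hit (n + Suc d) e (word (last_hit (x # h))) > 0" if "first_hit n e (x # h) > 0" for n e
      using d[of "Suc n" e] first_hit_step[OF True, of n e] that True by (simp del: first_hit.simps)
    then show ?thesis by blast
  qed
qed simp

text \<open>A history that ends in a long run of \<open>c\<close> can wait in this run for any number of steps without a hit.
  Hence the transition from the last hit before the run to the next one after it can take any
  sufficiently large number of steps.\<close>

lemma aperiodic_pair:
  assumes c: "replicate L c \<noteq> A" "replicate L c \<noteq> B"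
  shows "\<exists>e\<in>{1, - 1}. \<exists>e'\<in>{1, - 1}. \<exists>N. \<forall>n\<ge>N. first_hit n e' (word e) > 0"
proof -
  define h where "h = replicate L c @ A"
  have ch: "c # h = replicate L c @ c # A" by (simp add: h_def replicate_app_Cons_same)
  have tk: "take L h = replicate L c" "take L (c # h) = replicate L c"
    unfolding ch by (simp_all add: h_def)
  have t0: "kind (c # h) = 0" using tk c by (simp add: kind_def)
  have lh: "last_hit h \<noteq> 0" unfolding h_def
    by (rule last_hit_append) (simp add: last_hit_kind)
  obtain n0 e' where e': "e' = 1 \<or> e' = - 1" "first_hit n0 e' h > 0" using first_hit_exists by blast
  have loop: "first_hit (n0 + k) e' h > 0" for k
  proof (induction k)
    case (Suc k)
    have "first_hit (n0 + k) e' (c # h) = first_hit (n0 + k) e' h"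
      using tk by (intro first_hit_cong take_L_imp) simp
    then show ?case using first_hit_step[OF t0, of "n0 + k" e'] Suc by (simp del: first_hit.simps)
  qed (simp add: e')
  obtain d where d: "\<And>n e. first_hit n e h > 0 \<Longrightarrow> first_hit (n + d) e (word (last_hit h)) > 0"
    using first_hit_from_last_hit[OF lh] by blast
  have "first_hit n e' (word (last_hit h)) > 0" if "n \<ge> n0 + d" for n
    using d[OF loop[of "n - n0 - d"]] that by simp
  then show ?thesis using e'(1) last_hit_cases[of h] lh by blast
qed

text \<open>If hits alternate, the next hit determines the previous one; as the former depends only on the last
  \<open>L - 1\<close> letters, so does the latter. Let \<open>\<sigma>\<close> be this function on words of length \<open>L - 1\<close>. A word \<open>w\<close> of
  length \<open>L\<close> leads from \<open>tl w\<close> to \<open>butlast w\<close>, and \<open>\<sigma>\<close> changes along \<open>w\<close> exactly when \<open>w\<close> is one of the two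
  words. Looking at the four words with the same interior as \<open>A\<close> shows that \<open>B\<close> is \<open>A\<close> with both
  end letters flipped. If the interior is constant, \<open>B\<close> is the reversal of \<open>A\<close>, since a constant word cannot
  change \<open>\<sigma>\<close>. Otherwise pushing the letter \<open>e\<close> that differs from the first interior letter transforms
  two words with different \<open>\<sigma>\<close> into the same constant word without ever using \<open>A\<close> or \<open>B\<close>.\<close>

lemma alternation_forces_reverse_or_conjugate:
  assumes no_a: "\<And>n. first_hit n 1 A = 0" and no_b: "\<And>n. first_hit n (- 1) B = 0"
  shows "B \<in> {rev A, map Not A, rev (map Not A)}"
proof -
  have switch: "e = - last_hit h"
    if lh: "last_hit h \<noteq> 0" and fh: "first_hit n e h > 0" and e: "e = 1 \<or> e = - 1" for h n e
  proof -
    obtain d where "first_hit (n + d) e (word (last_hit h)) > 0"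
      using first_hit_from_last_hit[OF lh] fh by blast
    then show ?thesis using last_hit_cases[of h] lh e no_a[of "n + d"] no_b[of "n + d"] by auto
  qed
  have well_defined: "last_hit h = last_hit h'"
    if lh: "last_hit h \<noteq> 0" "last_hit h' \<noteq> 0" and tk: "take (L - 1) h = take (L - 1) h'" for h h'
  proof -
    obtain n e where e: "e = 1 \<or> e = - 1" "first_hit n e h > 0" using first_hit_exists by blast
    then have "first_hit n e h' > 0" using first_hit_cong[OF tk] by simp
    then show ?thesis using switch[OF lh(1) e(2,1)] switch[OF lh(2) _ e(1)] by simp
  qed
  define \<sigma> where "\<sigma> v = last_hit (v @ A)" for v
  have nz: "last_hit (v @ A) \<noteq> 0" for v by (rule last_hit_append) (simp add: last_hit_kind)
  have edge: "\<sigma> (butlast w) = last_hit (w @ A)" if "length w = L" for w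
    unfolding \<sigma>_def using that L1
    by (intro well_defined nz) (simp add: butlast_conv_take take_append min_def)
  have kind_w: "kind (w @ A) = kind w" if "length w = L" for w
    using that by (intro kind_cong) simp
  have stay: "\<sigma> (butlast w) = \<sigma> (tl w)" if "length w = L" "kind w = 0" for w
    using that edge[of w] kind_w[of w] L1 by (cases w) (auto simp: \<sigma>_def)
  have flip: "\<sigma> (butlast w) = kind w" "\<sigma> (tl w) = - kind w" if w: "length w = L" "kind w \<noteq> 0" for w
  proof -
    show "\<sigma> (butlast w) = kind w"
      using w edge[of w] kind_w[of w] L1 by (cases w) auto
    obtain c v where cv: "w = c # v" using w L1 by (cases w) auto
    have "first_hit 1 (kind w) (v @ A) > 0"
      using first_hit_now[of c "v @ A"] w kind_w[of w] unfolding cv by (simp del: first_hit.simps)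
    moreover have "kind w = 1 \<or> kind w = - 1" using kind_cases[of w] w by blast
    ultimately have "kind w = - \<sigma> v" unfolding \<sigma>_def by (rule switch[OF nz])
    then show "\<sigma> (tl w) = - kind w" by (simp add: cv)
  qed
  show ?thesis
  proof (cases "L = 1")
    case True
    then obtain x y where "A = [x]" "B = [y]" using len by (auto simp: length_Suc_conv)
    then show ?thesis using AB by auto
  next
    case False
    then obtain M where M: "L = Suc (Suc M)" using L1 by (cases L; cases "L - 1") auto
    obtain \<alpha> y \<delta> where A: "A = \<alpha> # y @ [\<delta>]" and y: "length y = M"
    proof -
      obtain \<alpha> A' where A': "A = \<alpha> # A'" "length A' = Suc M" using len M by (cases A) auto
      then obtain y \<delta> where "A' = y @ [\<delta>]" by (cases A' rule: rev_cases) auto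
      with A' that show thesis by auto
    qed
    have sA: "\<sigma> (\<alpha> # y) = 1" "\<sigma> (y @ [\<delta>]) = - 1"
      using flip[of A] len by (simp_all add: A[symmetric]) (simp_all add: A butlast_append)
    have sB: "\<sigma> (butlast B) = - 1" "\<sigma> (tl B) = 1"
      using flip[of B] len by simp_all
    have kind_L: "kind w = 0" if "w \<noteq> A" "w \<noteq> B" "length w = L" for w
      using that by (simp add: kind_def)
    have st: "\<sigma> (c # z) = \<sigma> (z @ [d])" if "c # z @ [d] \<noteq> A" "c # z @ [d] \<noteq> B" "length z = M" for c z d
      using stay[of "c # z @ [d]"] kind_L[OF that(1,2)] that(3) M by (simp add: butlast_append)
    have s1: "\<sigma> (y @ [\<not> \<delta>]) = 1"
    proof (cases "B = \<alpha> # y @ [\<not> \<delta>]")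
      case True
      then show ?thesis using sB by simp
    next
      case False
      then show ?thesis using st[of \<alpha> y "\<not> \<delta>"] sA y by (auto simp: A)
    qed
    have s2: "\<sigma> ((\<not> \<alpha>) # y) = - 1"
    proof (cases "B = (\<not> \<alpha>) # y @ [\<delta>]")
      case True
      then show ?thesis using sB by (simp add: butlast_append)
    next
      case False
      then show ?thesis using st[of "\<not> \<alpha>" y \<delta>] sA y by (auto simp: A)
    qed
    have B: "B = (\<not> \<alpha>) # y @ [\<not> \<delta>]"
    proof (rule ccontr)
      assume "\<not> ?thesis"
      then show False using st[of "\<not> \<alpha>" y "\<not> \<delta>"] s1 s2 y by (auto simp: A)
    qed
    show ?thesis
    proof (cases "\<exists>k. y = replicate M k")
      case True
      then obtain k where k: "y = replicate M k" by blast
      show ?thesis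
      proof (cases "\<alpha> = \<delta>")
        case False
        then have "(\<not> \<alpha>) = \<delta>" "(\<not> \<delta>) = \<alpha>" by auto
        then have "B = rev A" by (simp add: A B k)
        then show ?thesis by simp
      next
        case True
        have rep: "tl w = butlast w" if "w = replicate (Suc (Suc M)) c" for w and c :: bool
          using that by (simp add: butlast_conv_take) (metis replicate_Suc take_replicate min.absorb1 le_SucI order_refl)
        show ?thesis
        proof (cases "k = \<alpha>")
          case c: True
          have "A = replicate (Suc (Suc M)) k"
            using True c by (simp add: A k replicate_append_same)
          from rep[OF this] flip[of A] len show ?thesis by simp
        next
          case c: False
          then have "(\<not> \<alpha>) = k" "(\<not> \<delta>) = k" using True by auto
          then have "B = replicate (Suc (Suc M)) k"
            by (simp add: B k replicate_append_same)
          from rep[OF this] flip[of B] len show ?thesis by simp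
        qed
      qed
    next
      case nonconst: False
      then obtain y1 ys where y1: "y = y1 # ys" using y by (cases y) auto
      define e where "e = (\<not> y1)"
      have shift: "\<sigma> (e # butlast v) = \<sigma> v" if v: "length v = Suc M" "butlast v \<noteq> y" for v
      proof -
        obtain z d where "v = z @ [d]" using v by (cases v rule: rev_cases) auto
        then show ?thesis using st[of e z d] v by (auto simp: A B)
      qed
      have const: "y = replicate M \<beta>" if "take M (\<beta> # y) = y" for \<beta>
      proof (rule nth_equalityI)
        show "y ! i = replicate M \<beta> ! i" if "i < length y" for i
          using that
        proof (induction i)
          case 0
          then show ?case using \<open>take M (\<beta> # y) = y\<close> y by (metis nth_Cons_0 nth_replicate nth_take)
        next
          case (Suc i)
          then show ?case using \<open>take M (\<beta> # y) = y\<close> y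
            by (metis Suc_lessD nth_Cons_Suc nth_replicate nth_take)
        qed
      qed (simp add: y)
      have iter: "\<sigma> (take (Suc M) (replicate i e @ \<beta> # y)) = \<sigma> (\<beta> # y)" for i \<beta>
      proof (induction i)
        case 0
        show ?case using y by simp
      next
        case (Suc i)
        let ?v = "take (Suc M) (replicate i e @ \<beta> # y)"
        have bl: "butlast ?v = take M (replicate i e @ \<beta> # y)"
          using y by (subst butlast_take) (simp_all del: take_append)
        have "take M (replicate i e @ \<beta> # y) \<noteq> y"
        proof (cases i)
          case 0
          then show ?thesis using const nonconst by auto
        next
          case (Suc k)
          then show ?thesis using y by (auto simp: y1 e_def)
        qed
        then have *: "\<sigma> (e # butlast ?v) = \<sigma> ?v"
          using y by (intro shift) (simp_all add: bl del: take_append)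
        have "take (Suc M) (replicate (Suc i) e @ \<beta> # y) = e # butlast ?v"
          unfolding bl by (simp del: take_append)
        then show ?case unfolding * using * Suc.IH by (simp only:)
      qed
      have "take (Suc M) (replicate (Suc M) e @ \<beta> # y) = replicate (Suc M) e" for \<beta> by simp
      then have "\<sigma> (\<alpha> # y) = \<sigma> ((\<not> \<alpha>) # y)"
        using iter[of "Suc M" \<alpha>] iter[of "Suc M" "\<not> \<alpha>"] by simp
      then show ?thesis using sA s2 by simp
    qed
  qed
qed

section \<open>Generating functions of hits\<close>

definition hit_fps :: "int \<Rightarrow> bool list \<Rightarrow> real fps" where
  "hit_fps e h = Abs_fps (\<lambda>n. first_hit n e h)"

definition survival_fps :: "bool list \<Rightarrow> real fps" where
  "survival_fps h = Abs_fps (\<lambda>n. no_hit n h)"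

definition visit_fps :: "int \<Rightarrow> bool list \<Rightarrow> real fps" where
  "visit_fps e h = Abs_fps (\<lambda>n. score (\<lambda>_ k. if k = e then 1 else 0) n 0 h)"

definition sign_fps :: "int \<Rightarrow> bool list \<Rightarrow> real fps" where
  "sign_fps j h = Abs_fps (\<lambda>n. score (\<lambda>j _. of_int (sgn j)) n j h)"

lemma hit_fps_nth [simp]: "fps_nth (hit_fps e h) n = first_hit n e h"
  by (simp add: hit_fps_def)

lemma survival_identity: "(1 - fps_X) * survival_fps h = 1 - hit_fps 1 h - hit_fps (- 1) h"
proof (rule fps_ext)
  fix n
  show "fps_nth ((1 - fps_X) * survival_fps h) n = fps_nth (1 - hit_fps 1 h - hit_fps (- 1) h) n"
    using no_hit_decrease[of "n - 1" h]
    by (cases n) (simp_all add: survival_fps_def left_diff_distrib del: first_hit.simps(2) no_hit.simps(2))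
qed

lemma survival_radius: "fps_conv_radius (survival_fps h) > 1"
proof -
  obtain C r where r: "0 < r" "r < 1" "\<And>n h. no_hit n h \<le> C * r ^ n" using no_hit_geometric by blast
  then show ?thesis
    by (intro conv_radius_gt_1_geometric[of _ C r]) (auto simp: survival_fps_def no_hit_nonneg)
qed

lemma hit_radius: "e = 1 \<or> e = - 1 \<Longrightarrow> fps_conv_radius (hit_fps e h) > 1"
proof -
  assume e: "e = 1 \<or> e = - 1"
  obtain C r where r: "0 < r" "r < 1" "\<And>n h. no_hit n h \<le> C * r ^ n" using no_hit_geometric by blast
  show ?thesis
  proof (rule conv_radius_gt_1_geometric[of _ "C / r" r])
    show "\<bar>fps_nth (hit_fps e h) n\<bar> \<le> C / r * r ^ n" for n
    proof (cases n)
      case 0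
      have "0 \<le> C" using r(3)[of 0 h] by simp
      then show ?thesis using 0 r(1) by simp
    next
      case (Suc m)
      have "first_hit n e h \<le> C * r ^ m" unfolding Suc by (rule order_trans[OF first_hit_le[OF e] r(3)])
      then show ?thesis using r(1) first_hit_nonneg[of n e h] Suc by (simp del: first_hit.simps)
    qed
  qed (use r in auto)
qed

lemma sign_fps_eq:
  "sign_fps j h = fps_const (of_int (sgn j)) * survival_fps h
    + hit_fps 1 h * sign_fps (j + 1) A + hit_fps (- 1) h * sign_fps (j - 1) B"
proof (rule fps_ext)
  fix n
  show "fps_nth (sign_fps j h) n = fps_nth (fps_const (of_int (sgn j)) * survival_fps h
    + hit_fps 1 h * sign_fps (j + 1) A + hit_fps (- 1) h * sign_fps (j - 1) B) n"
  proof (cases n)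
    case 0
    then show ?thesis by (simp add: sign_fps_def survival_fps_def fps_mult_nth)
  next
    case (Suc m)
    then show ?thesis
      using score_renewal[of h n "\<lambda>j _. of_int (sgn j)" j]
      by (simp add: sign_fps_def survival_fps_def fps_mult_nth[of "hit_fps 1 h"]
          fps_mult_nth[of "hit_fps (- 1) h"] atLeast0AtMost sum.distrib mult.commute
          del: first_hit.simps no_hit.simps score.simps)
  qed
qed

lemma visit_fps_eq:
  assumes e: "e = 1 \<or> e = - 1"
  shows "visit_fps e h = (if kind h = e then 1 else 0)
    + hit_fps 1 h * visit_fps e A + hit_fps (- 1) h * visit_fps e B"
proof (rule fps_ext)
  fix n
  define \<gamma> :: "int \<Rightarrow> int \<Rightarrow> real" where "\<gamma> = (\<lambda>_ k. if k = e then 1 else 0)"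
  have shift: "score \<gamma> n j h = score \<gamma> n 0 h" for n j h
    by (induction n arbitrary: j h) (simp_all add: \<gamma>_def, metis)
  have g0: "\<gamma> j 0 = 0" for j using e by (auto simp: \<gamma>_def)
  show "fps_nth (visit_fps e h) n = fps_nth ((if kind h = e then 1 else 0)
    + hit_fps 1 h * visit_fps e A + hit_fps (- 1) h * visit_fps e B) n"
  proof (cases n)
    case 0
    then show ?thesis by (simp add: visit_fps_def)
  next
    case (Suc m)
    have "score \<gamma> n 0 h = (\<Sum>t\<le>n. first_hit t 1 h * score \<gamma> (n - t) 0 A
      + first_hit t (- 1) h * score \<gamma> (n - t) 0 B)"
      using score_renewal[of h n \<gamma> 0] Suc
      by (simp add: g0 shift[of _ 1] shift[of _ "- 1"] del: first_hit.simps score.simps)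
    then show ?thesis using Suc
      by (simp add: visit_fps_def \<gamma>_def[symmetric] fps_mult_nth atLeast0AtMost sum.distrib
          del: first_hit.simps score.simps)
  qed
qed

lemma visit_fps_nth: "n \<ge> L \<Longrightarrow> e = 1 \<or> e = - 1 \<Longrightarrow> fps_nth (visit_fps e h) n = (1/2) ^ L"
  by (simp add: visit_fps_def visits_eventually_uniform)

text \<open>The determinant \<open>(1 - pa) * (1 - pb) - qa * qb\<close> of the renewal equation, divided by \<open>1 - X\<close>.\<close>

definition return_det :: "real fps" where
  "return_det = survival_fps A * hit_fps 1 B + survival_fps B * hit_fps (- 1) A
    + (1 - fps_X) * survival_fps A * survival_fps B"

text \<open>The difference of the two series of staying, divided by \<open>1 - X\<close>; the visits to both words
  eventually have the same probability, so this is a series with radius of convergence above 1.\<close>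

definition drift :: "real fps" where
  "drift = return_det * (visit_fps 1 A - visit_fps (- 1) A) - survival_fps A"

text \<open>The visit series form the inverse of the matrix of the renewal equation; these are two entries of
  its adjugate.\<close>

lemma visit_matrix:
  "(1 - fps_X) * return_det * visit_fps 1 A = 1 - hit_fps (- 1) B"
  "(1 - fps_X) * return_det * visit_fps (- 1) A = hit_fps (- 1) A"
proof -
  define D :: "real fps" where "D = 1 - fps_X"
  define pa qa pb qb where "pa = hit_fps 1 A" and "qa = hit_fps (- 1) A"
    and "pb = hit_fps (- 1) B" and "qb = hit_fps 1 B"
  note defs = pa_def[symmetric] qa_def[symmetric] pb_def[symmetric] qb_def[symmetric]
  have D: "D * survival_fps A = 1 - pa - qa" "D * survival_fps B = 1 - qb - pb"
    using survival_identity[of A] survival_identity[of B] by (simp_all add: D_def defs)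
  have "D * return_det = (D * survival_fps A) * qb + (D * survival_fps B) * qa
      + (D * survival_fps A) * (D * survival_fps B)"
    by (simp add: return_det_def defs D_def[symmetric] algebra_simps)
  then have det: "D * return_det = (1 - pa) * (1 - pb) - qa * qb"
    unfolding D by (simp add: algebra_simps)
  define x11 x12 x21 x22 where "x11 = visit_fps 1 A" and "x12 = visit_fps (- 1) A"
    and "x21 = visit_fps 1 B" and "x22 = visit_fps (- 1) B"
  have x: "x11 = 1 + pa * x11 + qa * x21" "x21 = qb * x11 + pb * x21"
    "x12 = pa * x12 + qa * x22" "x22 = 1 + qb * x12 + pb * x22"
    using visit_fps_eq[of 1 A] visit_fps_eq[of 1 B] visit_fps_eq[of "- 1" A] visit_fps_eq[of "- 1" B]
    by (simp_all add: defs x11_def[symmetric] x12_def[symmetric] x21_def[symmetric] x22_def[symmetric])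
  have "((1 - pa) * (1 - pb) - qa * qb) * x11
      = (1 - pb) * (x11 - pa * x11 - qa * x21) + qa * (x21 - qb * x11 - pb * x21)"
    by (simp add: algebra_simps)
  also have "x11 - pa * x11 - qa * x21 = 1"
    using x(1) by (simp add: algebra_simps)
  also have "x21 - qb * x11 - pb * x21 = 0" using x(2) by (simp add: algebra_simps)
  finally show "(1 - fps_X) * return_det * visit_fps 1 A = 1 - hit_fps (- 1) B"
    by (simp add: D_def[symmetric] det defs x11_def[symmetric])
  have "((1 - pa) * (1 - pb) - qa * qb) * x12
      = (1 - pb) * (x12 - pa * x12 - qa * x22) + qa * (x22 - qb * x12 - pb * x22)"
    by (simp add: algebra_simps)
  also have "x12 - pa * x12 - qa * x22 = 0" using x(3) by (simp add: algebra_simps)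
  also have "x22 - qb * x12 - pb * x22 = 1" using x(4) by (simp add: algebra_simps)
  finally show "(1 - fps_X) * return_det * visit_fps (- 1) A = hit_fps (- 1) A"
    by (simp add: D_def[symmetric] det defs x12_def[symmetric])
qed

lemma drift_difference: "(1 - fps_X) * drift = hit_fps 1 A - hit_fps (- 1) B"
proof -
  have "(1 - fps_X) * drift = (1 - fps_X) * return_det * visit_fps 1 A
      - (1 - fps_X) * return_det * visit_fps (- 1) A - (1 - fps_X) * survival_fps A"
    by (simp add: drift_def algebra_simps)
  then show ?thesis unfolding visit_matrix survival_identity by simp
qed

lemma return_det_radius: "fps_conv_radius return_det > 1"
  unfolding return_det_def by (intro conv_radius_gt_1_intros survival_radius hit_radius) auto

lemma drift_radius: "fps_conv_radius drift > 1"
proof -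
  have "fps_conv_radius (visit_fps 1 A - visit_fps (- 1) A) > 1"
    by (rule finite_support_fps(1)[of L]) (simp add: visit_fps_nth)
  from conv_radius_gt_1_intros(3)[OF return_det_radius this] show ?thesis
    unfolding drift_def by (rule conv_radius_gt_1_intros(2)[OF _ survival_radius])
qed

definition stay_pr where "stay_pr = ev (hit_fps 1 A) (1 :: real)"

lemma hit_abs_conv: "abs_conv (hit_fps 1 h)" "abs_conv (hit_fps (- 1) h)"
  by (intro abs_conv_of_conv_radius hit_radius, simp)+

lemma survival_abs_conv: "abs_conv (survival_fps h)"
  by (rule abs_conv_of_conv_radius[OF survival_radius])

lemma total_hit: "ev (hit_fps 1 h) (1 :: real) + ev (hit_fps (- 1) h) 1 = 1"
proof -
  have "ev ((1 - fps_X) * survival_fps h) (1 :: real) = 0"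
    by (simp add: ev_simps survival_abs_conv abs_conv_intros)
  then show ?thesis
    by (simp add: survival_identity ev_simps hit_abs_conv abs_conv_intros)
qed

lemma stay_symmetric: "ev (hit_fps (- 1) B) (1 :: real) = stay_pr"
proof -
  have "ev ((1 - fps_X) * drift) (1 :: real) = 0"
    by (simp add: ev_simps abs_conv_of_conv_radius[OF drift_radius] abs_conv_intros)
  then show ?thesis
    by (simp add: drift_difference stay_pr_def ev_simps hit_abs_conv)
qed

lemma visit_difference_fps:
  assumes e: "e = 1 \<or> e = - 1"
  shows "abs_conv ((1 - fps_X) * visit_fps e h)" "ev ((1 - fps_X) * visit_fps e h) (1 :: real) = (1/2) ^ L"
proof -
  have z: "fps_nth ((1 - fps_X) * visit_fps e h) n = 0" if "n > L" for n
    using that visit_fps_nth[OF _ e, of n h] visit_fps_nth[OF _ e, of "n - 1" h]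
    by (cases n) (simp_all add: left_diff_distrib)
  show "abs_conv ((1 - fps_X) * visit_fps e h)"
    by (rule abs_conv_of_conv_radius[OF finite_support_fps(1)[OF z]])
  show "ev ((1 - fps_X) * visit_fps e h) (1 :: real) = (1/2) ^ L"
    using finite_support_fps(2)[of L, OF z] by (simp only: sum_fps_nth_difference visit_fps_nth[OF order_refl e])
qed

lemma return_det_visits: "return_det * ((1 - fps_X) * visit_fps (- 1) A) = hit_fps (- 1) A"
  using visit_matrix(2) by (simp add: mult_ac)

text \<open>If \<open>B\<close> never followed \<open>A\<close>, it would not be visited from \<open>A\<close> at all, whereas it is visited with
  probability \<open>2 ^ (- L)\<close> at all late times.\<close>

lemma switch_pos: "ev (hit_fps (- 1) A) (1 :: real) > 0"
proof (rule ccontr)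
  assume "\<not> ?thesis"
  then have "\<not> first_hit n (- 1) A > 0" for n
    using ev_1_pos_iff[OF hit_abs_conv(2)[of A]] first_hit_nonneg by auto
  then have "hit_fps (- 1) A = 0"
    using first_hit_nonneg[of _ "- 1" A] by (intro fps_ext) (force simp: not_less intro: antisym)
  then have "return_det * ((1 - fps_X) * visit_fps (- 1) A) = 0" using return_det_visits by simp
  moreover have "(1 - fps_X) * visit_fps (- 1) A \<noteq> 0"
    using visit_difference_fps(2)[of "- 1" A] by auto
  ultimately have "return_det = 0" by simp
  then have "1 - hit_fps (- 1) B = 0" using visit_matrix(1) by simp
  then have "fps_nth (1 - hit_fps (- 1) B) 0 = 0" by simp
  then show False by simp
qed

text \<open>Evaluating at 1 the entry \<open>qa\<close> of the adjugate, in which \<open>1 - X\<close> times the visit series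
  has the value \<open>2 ^ (- L)\<close>.\<close>

lemma mean_return_times: "ev (survival_fps A) (1 :: real) + ev (survival_fps B) 1 = 2 ^ L"
proof -
  define q where "q = 1 - stay_pr"
  have q: "ev (hit_fps (- 1) A) (1 :: real) = q" "ev (hit_fps 1 B) (1 :: real) = q"
    using total_hit[of A] total_hit[of B] stay_symmetric by (simp_all add: q_def stay_pr_def)
  have "ev (return_det * ((1 - fps_X) * visit_fps (- 1) A)) (1 :: real) = q"
    unfolding return_det_visits by (rule q)
  moreover have "ev return_det (1 :: real) = (ev (survival_fps A) 1 + ev (survival_fps B) 1) * q"
    by (simp add: return_det_def ev_simps survival_abs_conv hit_abs_conv abs_conv_intros q algebra_simps)
  ultimately have "(ev (survival_fps A) 1 + ev (survival_fps B) 1) * q * (1/2) ^ L = q"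
    using ev_mult[of "1 :: real" return_det "(1 - fps_X) * visit_fps (- 1) A"]
      visit_difference_fps[of "- 1" A] abs_conv_of_conv_radius[OF return_det_radius] by simp
  moreover have "q > 0" using switch_pos q by simp
  ultimately have "q * (ev (survival_fps A) 1 + ev (survival_fps B) 1) = q * 2 ^ L" "q \<noteq> 0"
    by (simp_all add: field_simps power_one_over)
  then show ?thesis by (simp only: mult_cancel_left) simp
qed

lemma stay_lt_1: "stay_pr < 1"
  using switch_pos total_hit[of A] by (simp add: stay_pr_def)

definition mean_time :: "int \<Rightarrow> bool list \<Rightarrow> real" where
  "mean_time e h = ev (fps_deriv (hit_fps e h)) 1"

lemma ev_deriv_difference:
  assumes "fps_conv_radius f > 1" "(1 - fps_X) * f = g"
  shows "ev f (1 :: real) = - ev (fps_deriv g) 1"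
proof -
  have r: "fps_conv_radius (fps_deriv f) > 1" by (rule conv_radius_gt_1_intros(6)[OF assms(1)])
  have "fps_deriv g = (1 - fps_X) * fps_deriv f - f"
    unfolding assms(2)[symmetric] by (simp add: algebra_simps)
  then show ?thesis
    using abs_conv_of_conv_radius[OF assms(1)] abs_conv_of_conv_radius[OF r]
    by (simp add: ev_simps abs_conv_intros)
qed

text \<open>All three series are quotients by \<open>1 - X\<close>, so their values at 1 are, up to sign, derivatives at 1 of
  combinations of hitting series, that is, combinations of partial mean waiting times; those of
  staying cancel.\<close>

lemma mean_time_balance:
  "ev drift (1 :: real) + ev (survival_fps A) 1 - ev (survival_fps B) 1 = mean_time (- 1) A - mean_time 1 B"
proof -
  have ad: "abs_conv (fps_deriv (hit_fps 1 h))" "abs_conv (fps_deriv (hit_fps (- 1) h))" for h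
    by (intro abs_conv_of_conv_radius conv_radius_gt_1_intros hit_radius, simp)+
  have "ev drift (1 :: real) = mean_time (- 1) B - mean_time 1 A"
    unfolding ev_deriv_difference[OF drift_radius drift_difference]
    by (simp add: mean_time_def ev_simps ad)
  moreover have "ev (survival_fps h) (1 :: real) = mean_time 1 h + mean_time (- 1) h" for h
    unfolding ev_deriv_difference[OF survival_radius survival_identity]
    by (simp add: mean_time_def ev_simps ad abs_conv_intros)
  ultimately show ?thesis by simp
qed

theorem sign_asymptotics:
  assumes not_special: "B \<notin> {rev A, map Not A, rev (map Not A)}"
  shows "0 < stay_pr"
    and "(\<lambda>n. sqrt (real n) * fps_nth (sign_fps 0 []) n)
      \<longlonglongrightarrow> ((ev (hit_fps 1 []) 1 - ev (hit_fps (- 1) []) 1) * 2 ^ L + (mean_time (- 1) A - mean_time 1 B))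
        / sqrt (4 * stay_pr * (1 - stay_pr) * 2 ^ L * pi)"
proof -
  have pos_iff: "ev (hit_fps e h) (1 :: real) > 0 \<longleftrightarrow> (\<exists>n. first_hit n e h > 0)"
    if "e = 1 \<or> e = - 1" for e h
    using ev_1_pos_iff[of "hit_fps e h"] that hit_abs_conv first_hit_nonneg by auto
  show stay: "0 < stay_pr"
  proof (rule ccontr)
    assume *: "\<not> 0 < stay_pr"
    have "\<not> first_hit n 1 A > 0" "\<not> first_hit n (- 1) B > 0" for n
      using * stay_symmetric pos_iff[of 1 A] pos_iff[of "- 1" B] by (auto simp: stay_pr_def)
    then have "first_hit n 1 A = 0" "first_hit n (- 1) B = 0" for n
      using first_hit_nonneg[of n 1 A] first_hit_nonneg[of n "- 1" B] by (simp_all add: not_less antisym)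
    then show False using alternation_forces_reverse_or_conjugate not_special by blast
  qed
  have ex: "\<exists>n. first_hit n 1 A > 0" "\<exists>n. first_hit n (- 1) A > 0"
      "\<exists>n. first_hit n 1 B > 0" "\<exists>n. first_hit n (- 1) B > 0"
    using pos_iff[of 1 A] pos_iff[of "- 1" A] pos_iff[of 1 B] pos_iff[of "- 1" B]
      stay stay_lt_1 stay_symmetric total_hit[of B] switch_pos
    by (auto simp: stay_pr_def)
  have aper: "z = 1"
    if P: "\<And>i j. first_hit i 1 A > 0 \<Longrightarrow> first_hit j (- 1) B > 0 \<Longrightarrow> z ^ (i + j) = 1"
      and Q: "\<And>i j. first_hit i (- 1) A > 0 \<Longrightarrow> first_hit j 1 B > 0 \<Longrightarrow> z ^ (i + j) = 1"
    for z :: complex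
  proof -
    obtain c where c: "replicate L c \<noteq> A" "replicate L c \<noteq> B"
    proof (cases "\<exists>c. replicate L c \<noteq> A \<and> replicate L c \<noteq> B")
      case False
      then have "replicate L True = A \<or> replicate L True = B" "replicate L False = A \<or> replicate L False = B"
        by blast+
      moreover have "replicate L True \<noteq> replicate L False" using L1 by (cases L) auto
      ultimately have "B = map Not A" by auto
      then show ?thesis using not_special by simp
    qed (use that in blast)
    obtain e e' N where e: "e \<in> {1, - 1}" "e' \<in> {1, - 1}" and
      N: "\<And>n. n \<ge> N \<Longrightarrow> first_hit n e' (word e) > 0"
      using aperiodic_pair[OF c] by blast
    have step: "z = 1" if "z ^ (N + j) = 1" "z ^ (Suc N + j) = 1" for j
      using that by simp
    obtain i1 i2 i3 i4 where i: "first_hit i1 1 A > 0" "first_hit i2 (- 1) A > 0"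
      "first_hit i3 1 B > 0" "first_hit i4 (- 1) B > 0" using ex by blast
    have N': "first_hit N e' (word e) > 0" "first_hit (Suc N) e' (word e) > 0"
      using N[of N] N[of "Suc N"] by (simp_all del: first_hit.simps)
    consider "e = 1" "e' = 1" | "e = 1" "e' = - 1" | "e = - 1" "e' = 1" | "e = - 1" "e' = - 1"
      using e by blast
    then show ?thesis
    proof cases
      case 1
      show ?thesis by (rule step[of i4]; rule P[OF _ i(4)]) (use N' in \<open>simp_all add: 1 del: first_hit.simps\<close>)
    next
      case 2
      show ?thesis by (rule step[of i3]; rule Q[OF _ i(3)]) (use N' in \<open>simp_all add: 2 del: first_hit.simps\<close>)
    next
      case 3
      show ?thesis
        by (rule step[of i2]; subst add.commute; rule Q[OF i(2)]) (use N' in \<open>simp_all add: 3 del: first_hit.simps\<close>)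
    next
      case 4
      show ?thesis
        by (rule step[of i1]; subst add.commute; rule P[OF i(1)]) (use N' in \<open>simp_all add: 4 del: first_hit.simps\<close>)
    qed
  qed
  interpret W: two_letter_walk "hit_fps 1 A" "hit_fps (- 1) A" "hit_fps (- 1) B" "hit_fps 1 B"
    "hit_fps 1 []" "hit_fps (- 1) []" "survival_fps A" "survival_fps B" drift
  proof
    show "(1 - fps_X) * survival_fps B = 1 - hit_fps (- 1) B - hit_fps 1 B"
      using survival_identity[of B] by simp
    show "0 < ev (survival_fps A) (1 :: real) + ev (survival_fps B) 1"
      unfolding mean_return_times by simp
    show "ev (hit_fps 1 []) (1 :: real) + ev (hit_fps (- 1) []) 1 = 1" by (rule total_hit)
    show "0 < ev (hit_fps 1 A) (1 :: real)" "ev (hit_fps 1 A) (1 :: real) < 1"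
      using stay stay_lt_1 by (simp_all add: stay_pr_def)
    show "z = 1" if "\<And>i j. 0 < fps_nth (hit_fps 1 A) i \<Longrightarrow> 0 < fps_nth (hit_fps (- 1) B) j \<Longrightarrow> z ^ (i + j) = 1"
      "\<And>i j. 0 < fps_nth (hit_fps (- 1) A) i \<Longrightarrow> 0 < fps_nth (hit_fps 1 B) j \<Longrightarrow> z ^ (i + j) = 1"
      for z :: complex
      using aper that by simp
  qed (simp_all add: first_hit_nonneg survival_radius hit_radius drift_radius survival_identity drift_difference)
  have start: "sign_fps 0 [] = hit_fps 1 [] * sign_fps 1 A + hit_fps (- 1) [] * sign_fps (- 1) B"
    by (subst sign_fps_eq) simp
  have p: "W.p = stay_pr" unfolding W.p_def stay_pr_def ..
  have q: "W.q = 1 - stay_pr" unfolding W.q_def p ..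
  have t: "W.W = 2 ^ L" unfolding W.W_def by (rule mean_return_times)
  have m: "W.\<mu> = mean_time (- 1) A - mean_time 1 B" unfolding W.\<mu>_def by (rule mean_time_balance)
  have "(\<lambda>n. sqrt (real n) * fps_nth (hit_fps 1 [] * sign_fps 1 A + hit_fps (- 1) [] * sign_fps (- 1) B) n)
      \<longlonglongrightarrow> ((ev (hit_fps 1 []) 1 - ev (hit_fps (- 1) []) 1) * W.W + W.\<mu>) / sqrt (4 * W.p * W.q * W.W * pi)"
    by (rule W.walk_limit[of "\<lambda>j. sign_fps j A" "\<lambda>j. sign_fps j B", OF sign_fps_eq sign_fps_eq])
  then show "(\<lambda>n. sqrt (real n) * fps_nth (sign_fps 0 []) n)
      \<longlonglongrightarrow> ((ev (hit_fps 1 []) 1 - ev (hit_fps (- 1) []) 1) * 2 ^ L + (mean_time (- 1) A - mean_time 1 B))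
        / sqrt (4 * stay_pr * (1 - stay_pr) * 2 ^ L * pi)"
    unfolding start p q t m .
qed

end

section \<open>Hits of the random process\<close>

locale word_race = symmetric_bernoulli M X for M :: "'a measure" and X +
  fixes L :: nat and a b :: "bool list"
  assumes L_pos: "1 \<le> L" and lengths: "length a = L" "length b = L" and distinct: "a \<noteq> b"
begin

sublocale word_pair "rev a" "rev b" L
  by unfold_locales (use L_pos lengths distinct in auto)

primrec history :: "nat \<Rightarrow> 'a \<Rightarrow> bool list" where
  "history 0 \<omega> = []"
| "history (Suc n) \<omega> = X (Suc n) \<omega> # history n \<omega>"

lemma history_eq: "history n \<omega> = rev (map (\<lambda>i. X i \<omega>) [1..<n + 1])"
  by (induction n) auto

lemma length_history [simp]: "length (history n \<omega>) = n"
  by (induction n) auto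

lemma measurable_X: "i \<ge> 1 \<Longrightarrow> X i \<in> measurable M (count_space UNIV)"
  using indep by (auto simp: indep_vars_def)

lemma measurable_history [measurable]: "history n \<in> measurable M (count_space UNIV)"
proof (induction n)
  case (Suc n)
  have "(\<lambda>\<omega>. X (Suc n) \<omega> # history n \<omega>) \<in> measurable M (count_space UNIV)"
    by (rule measurable_compose_countable[where f = "\<lambda>c \<omega>. c # history n \<omega>" and g = "X (Suc n)"])
      (auto intro: measurable_X measurable_compose[OF Suc])
  then show ?case by simp
qed simp

text \<open>All events below are described through histories, whose type is countable.\<close>

lemma measurable_history_fun: "(\<lambda>\<omega>. f (history n \<omega>)) \<in> measurable M N" if "\<And>h. f h \<in> space N"
  by (rule measurable_compose[OF measurable_history]) (use that in simp)

lemma history_eq_iff: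
  "length h = n \<Longrightarrow> history n \<omega> = h \<longleftrightarrow> (\<forall>j\<in>{1..n}. X j \<omega> = h ! (n - j))"
proof (induction n arbitrary: h)
  case (Suc n)
  then obtain x h' where h: "h = x # h'" "length h' = n" by (cases h) auto
  have "(\<forall>j\<in>{1..n}. X j \<omega> = (x # h') ! (Suc n - j)) \<longleftrightarrow> (\<forall>j\<in>{1..n}. X j \<omega> = h' ! (n - j))"
    by (intro ball_cong refl) (auto simp: Suc_diff_le)
  then show ?case
    using Suc.IH[OF h(2)] by (auto simp: h atLeastAtMostSuc_conv)
qed simp

lemma prob_X: "i \<ge> 1 \<Longrightarrow> prob (X i -` {c} \<inter> space M) = 1 / 2"
  using prob_0[of i] prob_1[of i]
  by (cases c) (auto simp: vimage_def Int_def conj_commute)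

lemma prob_history: "length h = n \<Longrightarrow> prob {\<omega>\<in>space M. history n \<omega> = h} = (1/2) ^ n"
proof (cases "n = 0")
  case False
  assume h: "length h = n"
  have "{\<omega>\<in>space M. history n \<omega> = h} = (\<Inter>j\<in>{1..n}. X j -` {h ! (n - j)} \<inter> space M)"
    using False by (auto simp: history_eq_iff[OF h])
  also have "prob \<dots> = (\<Prod>j\<in>{1..n}. prob (X j -` {h ! (n - j)} \<inter> space M))"
    by (rule indep_varsD[OF indep]) (use False in auto)
  also have "\<dots> = (\<Prod>j\<in>{1..n}. 1 / 2)"
    by (intro prod.cong refl prob_X) auto
  finally show ?thesis by simp
qed (simp add: prob_space)

lemma finite_words: "finite {h :: bool list. length h = n}"
  using finite_lists_length_eq[of "UNIV :: bool set" n] by simp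

lemma history_event [measurable]: "{\<omega>\<in>space M. history n \<omega> = h} \<in> events"
  by measurable

lemma history_expansion:
  "\<omega> \<in> space M \<Longrightarrow> (g (history n \<omega>) :: real)
    = (\<Sum>h | length h = n. g h * indicator {\<omega>\<in>space M. history n \<omega> = h} \<omega>)"
  by (subst sum.mono_neutral_right[of _ "{history n \<omega>}"]) (auto simp: finite_words indicator_def)

lemma integrable_history: "integrable M (\<lambda>\<omega>. g (history n \<omega>) :: real)"
  by (subst Bochner_Integration.integrable_cong[OF refl history_expansion])
    (auto intro!: integrable_mult_right integrable_real_indicator simp: emeasure_eq_measure)

lemma expectation_history_sum:
  fixes g :: "bool list \<Rightarrow> real"
  shows "(\<integral>\<omega>. g (history n \<omega>) \<partial>M) = (\<Sum>h | length h = n. g h) / 2 ^ n"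
proof -
  have "(\<integral>\<omega>. g (history n \<omega>) \<partial>M)
      = (\<integral>\<omega>. (\<Sum>h | length h = n. g h * indicator {\<omega>\<in>space M. history n \<omega> = h} \<omega>) \<partial>M)"
    by (rule Bochner_Integration.integral_cong[OF refl history_expansion])
  also have "\<dots> = (\<Sum>h | length h = n. g h * prob {\<omega>\<in>space M. history n \<omega> = h})"
    by (subst Bochner_Integration.integral_sum)
      (auto intro!: integrable_mult_right integrable_real_indicator simp: emeasure_eq_measure)
  also have "\<dots> = (\<Sum>h | length h = n. g h * (1/2) ^ n)"
    by (intro sum.cong refl) (simp add: prob_history)
  finally show ?thesis by (simp add: sum_divide_distrib power_one_over)
qed

text \<open>Independence of the next letter from the past, in the form in which it is used.\<close>

lemma expectation_history_step:
  "(\<integral>\<omega>. g (history (Suc n) \<omega>) \<partial>M) = (\<integral>\<omega>. step_avg g (history n \<omega>) \<partial>M)"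
proof -
  have "{h :: bool list. length h = Suc n} = (\<lambda>(c, h). c # h) ` (UNIV \<times> {h. length h = n})"
    by (auto simp: length_Suc_conv image_iff)
  then have "(\<Sum>h | length h = Suc n. g h) = (\<Sum>x\<in>UNIV \<times> {h. length h = n}. g (fst x # snd x))"
    by (simp add: sum.reindex inj_on_def case_prod_beta)
  also have "\<dots> = (\<Sum>c\<in>UNIV. \<Sum>h | length h = n. g (c # h))"
    by (simp add: sum.cartesian_product case_prod_beta)
  also have "\<dots> = 2 * (\<Sum>h | length h = n. step_avg g h)"
    by (simp add: UNIV_bool step_avg_def sum.distrib[symmetric] sum_divide_distrib[symmetric] add.commute)
  finally show ?thesis unfolding expectation_history_sum by simp
qed

lemma expectation_history:
  "(\<integral>\<omega>. g (history n \<omega>) \<partial>M) = (step_avg ^^ n) g []"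
proof (induction n arbitrary: g)
  case 0
  then show ?case by (simp add: prob_space)
next
  case (Suc n)
  then show ?case unfolding expectation_history_step by (simp add: funpow_swap1)
qed

lemma prob_history_pred:
  "\<P>(\<omega> in M. Q (history n \<omega>)) = (\<integral>\<omega>. (if Q (history n \<omega>) then 1 else 0) \<partial>M)"
proof -
  have "(\<integral>\<omega>. (if Q (history n \<omega>) then 1 else 0) \<partial>M)
      = (\<integral>\<omega>. (indicator {\<omega>\<in>space M. Q (history n \<omega>)} \<omega> :: real) \<partial>M)"
    by (rule Bochner_Integration.integral_cong) (auto simp: indicator_def)
  then show ?thesis by simp
qed

lemma kind_short: "length h < L \<Longrightarrow> kind h = 0"
  using len by (auto simp: kind_def)

lemma window_eq: "window X L t \<omega> = (if t \<ge> L then rev (take L (history t \<omega>)) else [])"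
proof (cases "t \<ge> L")
  case True
  have "rev (take L (history t \<omega>)) = drop (t - L) (map (\<lambda>i. X i \<omega>) [1..<t + 1])"
    unfolding history_eq by (simp add: take_rev)
  then show ?thesis using True by (simp add: window_def drop_map add.commute)
qed (simp add: window_def)

lemma window_kind: "window X L t \<omega> = a \<longleftrightarrow> kind (history t \<omega>) = 1"
  "window X L t \<omega> = b \<longleftrightarrow> kind (history t \<omega>) = - 1"
proof -
  have "a \<noteq> []" "b \<noteq> []" using L_pos lengths by auto
  then show "window X L t \<omega> = a \<longleftrightarrow> kind (history t \<omega>) = 1"
    "window X L t \<omega> = b \<longleftrightarrow> kind (history t \<omega>) = - 1"
    using kind_short[of "history t \<omega>"] unfolding window_eq kind_eq_1 kind_eq_m1
    by (auto simp: rev_swap)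
qed

primrec total :: "bool list \<Rightarrow> int" where
  "total [] = 0"
| "total (x # h) = total h + kind (x # h)"

lemma total_occurrences:
  "total (history n \<omega>) = int (occurrences X a n \<omega>) - int (occurrences X b n \<omega>)"
proof -
  have occ: "occurrences X y n \<omega> = card {k\<in>{1..n}. kind (history k \<omega>) = c}"
    if "y = a \<and> c = 1 \<or> y = b \<and> c = - 1" for y c
  proof -
    have ly: "length y = L" using that lengths by auto
    have w: "window X L k \<omega> = y \<longleftrightarrow> kind (history k \<omega>) = c" for k using that window_kind by auto
    have ge: "L \<le> k" if "kind (history k \<omega>) = c" for k
      using kind_short[of "history k \<omega>"] that \<open>y = a \<and> c = 1 \<or> y = b \<and> c = - 1\<close> by force
    have "{k\<in>{length y..n}. window X (length y) k \<omega> = y} = {k\<in>{1..n}. kind (history k \<omega>) = c}"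
      unfolding ly w using ge L_pos by (auto intro: order_trans)
    then show ?thesis by (simp add: occurrences_def)
  qed
  have "total (history n \<omega>)
      = int (card {k\<in>{1..n}. kind (history k \<omega>) = 1}) - int (card {k\<in>{1..n}. kind (history k \<omega>) = - 1})"
  proof (induction n)
    case (Suc n)
    have "{k\<in>{1..Suc n}. kind (history k \<omega>) = c} = (if kind (history (Suc n) \<omega>) = c
        then insert (Suc n) {k\<in>{1..n}. kind (history k \<omega>) = c} else {k\<in>{1..n}. kind (history k \<omega>) = c})" for c
      by (auto simp: atLeastAtMostSuc_conv simp del: history.simps)
    moreover have "total (history (Suc n) \<omega>) = total (history n \<omega>) + kind (history (Suc n) \<omega>)"
      by simp
    ultimately show ?case using Suc kind_cases[of "history (Suc n) \<omega>"]
      by (auto simp del: history.simps)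
  qed simp
  then show ?thesis using occ[of a 1] occ[of b "- 1"] by simp
qed

lemma funpow_step_avg_score:
  "(step_avg ^^ n) (\<lambda>h. of_int (sgn (total h))) h = score (\<lambda>j _. of_int (sgn j)) n (total h) h"
proof (induction n arbitrary: h)
  case (Suc n)
  then show ?case by (simp add: step_avg_def)
qed simp

lemma phi_eq: "phi M X a b n = fps_nth (sign_fps 0 []) n"
proof -
  have "phi M X a b n = \<P>(\<omega> in M. total (history n \<omega>) > 0) - \<P>(\<omega> in M. total (history n \<omega>) < 0)"
    unfolding phi_def total_occurrences by simp
  also have "\<dots> = (\<integral>\<omega>. (if total (history n \<omega>) > 0 then 1 else 0)
      - (if total (history n \<omega>) < 0 then 1 else 0) \<partial>M)"
    unfolding prob_history_pred[where Q = "\<lambda>h. total h > 0"] prob_history_pred[where Q = "\<lambda>h. total h < 0"]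
    by (rule Bochner_Integration.integral_diff[symmetric]) (rule integrable_history)+
  also have "\<dots> = (\<integral>\<omega>. of_int (sgn (total (history n \<omega>))) \<partial>M)"
    by (rule Bochner_Integration.integral_cong) auto
  also have "\<dots> = score (\<lambda>j _. of_int (sgn j)) n 0 []"
    unfolding expectation_history[where g = "\<lambda>h. of_int (sgn (total h))"] funpow_step_avg_score by simp
  finally show ?thesis by (simp add: sign_fps_def)
qed

text \<open>In contrast to a statement about hitting times, this event depends on finitely many letters only.\<close>

definition next_hit :: "nat \<Rightarrow> nat \<Rightarrow> int \<Rightarrow> 'a \<Rightarrow> bool" where
  "next_hit m t e \<omega> \<longleftrightarrow> t \<ge> 1 \<and> (\<forall>u\<in>{m<..<m + t}. kind (history u \<omega>) = 0) \<and> kind (history (m + t) \<omega>) = e"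

lemma next_hit_measurable [measurable]: "Measurable.pred M (next_hit m t e)"
proof -
  have [measurable]: "(\<lambda>\<omega>. kind (history u \<omega>)) \<in> measurable M (count_space UNIV)" for u
    by (rule measurable_history_fun) simp
  show ?thesis unfolding next_hit_def by measurable
qed

lemma next_hit_Suc:
  assumes "t \<ge> 1"
  shows "next_hit m (Suc t) e \<omega> \<longleftrightarrow> kind (history (Suc m) \<omega>) = 0 \<and> next_hit (Suc m) t e \<omega>"
proof -
  have "{m<..<m + Suc t} = insert (Suc m) {Suc m<..<Suc m + t}" using assms by auto
  then show ?thesis using assms by (auto simp: next_hit_def simp del: history.simps)
qed

lemma expectation_next_hit:
  assumes e: "e \<noteq> 0"
  shows "(\<integral>\<omega>. g (history m \<omega>) * (if next_hit m t e \<omega> then 1 else 0) \<partial>M)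
    = (\<integral>\<omega>. g (history m \<omega>) * first_hit t e (history m \<omega>) \<partial>M)"
proof (cases t)
  case 0
  then show ?thesis by (simp add: next_hit_def)
next
  case (Suc s)
  have "(\<integral>\<omega>. g (history m \<omega>) * (if next_hit m (Suc s) e \<omega> then 1 else 0) \<partial>M)
    = (\<integral>\<omega>. g (history m \<omega>) * first_hit (Suc s) e (history m \<omega>) \<partial>M)"
  proof (induction s arbitrary: m g)
    case 0
    define G where "G = (\<lambda>h. g (tl h) * (if kind h = e then 1 else 0))"
    have "{m<..<m + Suc 0} = {}" by auto
    then have "(\<integral>\<omega>. g (history m \<omega>) * (if next_hit m (Suc 0) e \<omega> then 1 else 0) \<partial>M)
      = (\<integral>\<omega>. G (history (Suc m) \<omega>) \<partial>M)"
      by (intro Bochner_Integration.integral_cong refl) (simp add: next_hit_def G_def)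
    also have "\<dots> = (\<integral>\<omega>. step_avg G (history m \<omega>) \<partial>M)"
      by (rule expectation_history_step)
    also have "\<dots> = (\<integral>\<omega>. g (history m \<omega>) * first_hit (Suc 0) e (history m \<omega>) \<partial>M)"
      by (intro Bochner_Integration.integral_cong refl) (use e in \<open>auto simp: step_avg_def G_def\<close>)
    finally show ?case .
  next
    case (Suc s)
    define g' where "g' = (\<lambda>h. g (tl h) * (if kind h = 0 then 1 else 0))"
    have "(\<integral>\<omega>. g (history m \<omega>) * (if next_hit m (Suc (Suc s)) e \<omega> then 1 else 0) \<partial>M)
      = (\<integral>\<omega>. g' (history (Suc m) \<omega>) * (if next_hit (Suc m) (Suc s) e \<omega> then 1 else 0) \<partial>M)"
      by (intro Bochner_Integration.integral_cong refl) (simp add: next_hit_Suc g'_def)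
    also have "\<dots> = (\<integral>\<omega>. (\<lambda>h. g' h * first_hit (Suc s) e h) (history (Suc m) \<omega>) \<partial>M)"
      unfolding Suc.IH ..
    also have "\<dots> = (\<integral>\<omega>. step_avg (\<lambda>h. g' h * first_hit (Suc s) e h) (history m \<omega>) \<partial>M)"
      by (rule expectation_history_step)
    also have "\<dots> = (\<integral>\<omega>. g (history m \<omega>) * first_hit (Suc (Suc s)) e (history m \<omega>) \<partial>M)"
      by (intro Bochner_Integration.integral_cong refl)
        (simp add: step_avg_def g'_def first_hit.simps(2)[of "Suc s"] distrib_left del: first_hit.simps)
    finally show ?case .
  qed
  then show ?thesis by (simp only: Suc)
qed

lemma prob_first_hit:
  assumes e: "e \<noteq> 0" shows "\<P>(\<omega> in M. next_hit 0 s e \<omega>) = first_hit s e []"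
proof -
  have "\<P>(\<omega> in M. next_hit 0 s e \<omega>) = (\<integral>\<omega>. indicator {\<omega>\<in>space M. next_hit 0 s e \<omega>} \<omega> \<partial>M)"
    by simp
  also have "\<dots> = (\<integral>\<omega>. 1 * (if next_hit 0 s e \<omega> then 1 else 0) \<partial>M)"
    by (rule Bochner_Integration.integral_cong) (auto simp: indicator_def)
  also have "\<dots> = first_hit s e []"
    using expectation_next_hit[OF e, of "\<lambda>_. 1" 0 s] by (simp add: prob_space)
  finally show ?thesis .
qed

text \<open>Needed to express the event that the first hit is at time \<open>s\<close> as a property of the history at that time.\<close>

primrec clean :: "bool list \<Rightarrow> bool" where
  "clean [] = True"
| "clean (x # h) = (kind (x # h) = 0 \<and> clean h)"

lemma clean_history: "clean (history n \<omega>) \<longleftrightarrow> (\<forall>u\<in>{0<..n}. kind (history u \<omega>) = 0)"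
proof (induction n)
  case (Suc n)
  have "{0<..Suc n} = insert (Suc n) {0<..n}" by auto
  then show ?case using Suc by simp
qed simp

lemma first_hit_history:
  "next_hit 0 (Suc s) c \<omega> \<longleftrightarrow> (\<lambda>h. kind h = c \<and> clean (tl h)) (history (Suc s) \<omega>)"
proof -
  have "{0<..<0 + Suc s} = {0<..s}" by auto
  then show ?thesis by (auto simp: next_hit_def clean_history)
qed

text \<open>The Markov property: after the first hit only the type of the word matters.\<close>

lemma prob_two_hits:
  assumes c: "c \<noteq> 0" and e: "e \<noteq> 0"
  shows "\<P>(\<omega> in M. next_hit 0 s c \<omega> \<and> next_hit s t e \<omega>) = first_hit s c [] * first_hit t e (word c)"
proof (cases s)
  case 0
  then show ?thesis by (simp add: next_hit_def)
next
  case (Suc s')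
  define g where "g = (\<lambda>h. if kind h = c \<and> clean (tl h) then 1 else (0 :: real))"
  have g: "(if next_hit 0 s c \<omega> then 1 else 0) = g (history s \<omega>)" for \<omega>
    unfolding Suc first_hit_history g_def by simp
  have "\<P>(\<omega> in M. next_hit 0 s c \<omega> \<and> next_hit s t e \<omega>)
      = (\<integral>\<omega>. indicator {\<omega>\<in>space M. next_hit 0 s c \<omega> \<and> next_hit s t e \<omega>} \<omega> \<partial>M)" by simp
  also have "\<dots> = (\<integral>\<omega>. g (history s \<omega>) * (if next_hit s t e \<omega> then 1 else 0) \<partial>M)"
    by (rule Bochner_Integration.integral_cong) (auto simp: indicator_def g[symmetric])
  also have "\<dots> = (\<integral>\<omega>. g (history s \<omega>) * first_hit t e (history s \<omega>) \<partial>M)"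
    by (rule expectation_next_hit[OF e])
  also have "\<dots> = (\<integral>\<omega>. g (history s \<omega>) * first_hit t e (word c) \<partial>M)"
    by (intro Bochner_Integration.integral_cong refl) (auto simp: g_def first_hit_word[OF _ c])
  also have "\<dots> = (\<integral>\<omega>. g (history s \<omega>) \<partial>M) * first_hit t e (word c)"
    by simp
  also have "(\<integral>\<omega>. g (history s \<omega>) \<partial>M) = (\<integral>\<omega>. indicator {\<omega>\<in>space M. next_hit 0 s c \<omega>} \<omega> \<partial>M)"
    by (rule Bochner_Integration.integral_cong) (auto simp: indicator_def g[symmetric])
  also have "\<dots> = first_hit s c []" using prob_first_hit[OF c, of s] by simp
  finally show ?thesis .
qed

lemma prob_no_hit:
  "\<P>(\<omega> in M. \<forall>u\<in>{m<..m + n}. kind (history u \<omega>) = 0) = (\<integral>\<omega>. no_hit n (history m \<omega>) \<partial>M)"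
proof -
  have [measurable]: "(\<lambda>\<omega>. kind (history u \<omega>)) \<in> measurable M (count_space UNIV)" for u
    by (rule measurable_history_fun) simp
  have "(\<integral>\<omega>. g (history m \<omega>) * (if \<forall>u\<in>{m<..m + n}. kind (history u \<omega>) = 0 then 1 else 0) \<partial>M)
      = (\<integral>\<omega>. g (history m \<omega>) * no_hit n (history m \<omega>) \<partial>M)" for g
  proof (induction n arbitrary: m g)
    case (Suc n)
    define g' where "g' = (\<lambda>h. g (tl h) * (if kind h = 0 then 1 else 0))"
    have "{m<..m + Suc n} = insert (Suc m) {Suc m<..Suc m + n}" for m by auto
    then have "(\<integral>\<omega>. g (history m \<omega>) * (if \<forall>u\<in>{m<..m + Suc n}. kind (history u \<omega>) = 0 then 1 else 0) \<partial>M)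
      = (\<integral>\<omega>. g' (history (Suc m) \<omega>) * (if \<forall>u\<in>{Suc m<..Suc m + n}. kind (history u \<omega>) = 0 then 1 else 0) \<partial>M)"
      by (intro Bochner_Integration.integral_cong refl) (simp add: g'_def)
    also have "\<dots> = (\<integral>\<omega>. (\<lambda>h. g' h * no_hit n h) (history (Suc m) \<omega>) \<partial>M)"
      unfolding Suc.IH ..
    also have "\<dots> = (\<integral>\<omega>. step_avg (\<lambda>h. g' h * no_hit n h) (history m \<omega>) \<partial>M)"
      by (rule expectation_history_step)
    also have "\<dots> = (\<integral>\<omega>. g (history m \<omega>) * no_hit (Suc n) (history m \<omega>) \<partial>M)"
      by (intro Bochner_Integration.integral_cong refl) (simp add: step_avg_def g'_def distrib_left)
    finally show ?case .
  qed simp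
  from this[of "\<lambda>_. 1"]
  have "(\<integral>\<omega>. (if \<forall>u\<in>{m<..m + n}. kind (history u \<omega>) = 0 then 1 else 0) \<partial>M) = (\<integral>\<omega>. no_hit n (history m \<omega>) \<partial>M)"
    by simp
  also have "(\<integral>\<omega>. (if \<forall>u\<in>{m<..m + n}. kind (history u \<omega>) = 0 then 1 else 0) \<partial>M)
      = (\<integral>\<omega>. (indicator {\<omega>\<in>space M. \<forall>u\<in>{m<..m + n}. kind (history u \<omega>) = 0} \<omega> :: real) \<partial>M)"
    by (rule Bochner_Integration.integral_cong) (auto simp: indicator_def)
  finally show ?thesis by simp
qed

lemma AE_hits: "AE \<omega> in M. \<forall>m. \<exists>u>m. kind (history u \<omega>) \<noteq> 0"
proof -
  have [measurable]: "(\<lambda>\<omega>. kind (history u \<omega>)) \<in> measurable M (count_space UNIV)" for u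
    by (rule measurable_history_fun) simp
  obtain C r where r: "0 < r" "r < 1" "\<And>n h. no_hit n h \<le> C * r ^ n" using no_hit_geometric by blast
  have "AE \<omega> in M. \<exists>u>m. kind (history u \<omega>) \<noteq> 0" for m
  proof -
    let ?N = "{\<omega>\<in>space M. \<forall>u>m. kind (history u \<omega>) = 0}"
    have N: "?N \<in> events" by measurable
    have le: "prob ?N \<le> C * r ^ n" for n
    proof -
      have "prob ?N \<le> \<P>(\<omega> in M. \<forall>u\<in>{m<..m + n}. kind (history u \<omega>) = 0)"
        by (intro finite_measure_mono) auto
      also have "\<dots> \<le> (\<integral>\<omega>. C * r ^ n \<partial>M)"
        unfolding prob_no_hit by (intro integral_mono integrable_history r(3))
      finally show ?thesis by (simp add: prob_space)
    qed
    have "(\<lambda>n. C * r ^ n) \<longlonglongrightarrow> C * 0"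
      using r by (intro tendsto_mult tendsto_const LIMSEQ_power_zero) auto
    then have "prob ?N \<le> C * 0"
      by (rule LIMSEQ_le_const) (use le in auto)
    then have "prob ?N = 0" using measure_nonneg[of M ?N] by simp
    then have "AE \<omega> in M. \<omega> \<notin> ?N" using N by (simp add: prob_eq_0)
    then show ?thesis using AE_space by eventually_elim auto
  qed
  then show ?thesis by (simp add: AE_all_countable)
qed

lemma measurable_kind [measurable]: "(\<lambda>\<omega>. kind (history u \<omega>)) \<in> measurable M (count_space UNIV)"
  by (rule measurable_history_fun) simp

lemma hit_time_Suc:
  "hit_time X L a b (Suc k) \<omega> = (LEAST t. t > hit_time X L a b k \<omega> \<and> kind (history t \<omega>) \<noteq> 0)"
proof -
  have "window X L t \<omega> \<in> {a, b} \<longleftrightarrow> kind (history t \<omega>) \<noteq> 0" for t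
    using kind_cases[of "history t \<omega>"] by (auto simp: window_kind)
  then show ?thesis by simp
qed

lemma hit_sign_eq: "hit_sign X L a b k \<omega> = kind (history (hit_time X L a b k \<omega>) \<omega>)"
  using kind_cases[of "history (hit_time X L a b k \<omega>) \<omega>"]
  unfolding hit_sign_def window_kind by auto

lemma measurable_hit_time [measurable]: "hit_time X L a b k \<in> measurable M (count_space UNIV)"
proof (induction k)
  case (Suc k)
  note [measurable] = Suc
  show ?case unfolding hit_time_Suc[abs_def] by measurable
qed simp

lemma measurable_hit_sign [measurable]: "hit_sign X L a b k \<in> measurable M (count_space UNIV)"
  unfolding hit_sign_eq[abs_def]
  by (rule measurable_compose_countable[where f = "\<lambda>t \<omega>. kind (history t \<omega>)",
        OF measurable_kind measurable_hit_time])

text \<open>Outside the null event of \<open>AE_hits\<close>, hitting times as least elements and the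
  events \<open>next_hit\<close> describe the same thing; the converse is the next lemma.\<close>

lemma next_hit_of_hit_time:
  assumes "\<forall>m. \<exists>u>m. kind (history u \<omega>) \<noteq> 0"
  shows "next_hit (hit_time X L a b k \<omega>) (hit_time X L a b (Suc k) \<omega> - hit_time X L a b k \<omega>)
      (hit_sign X L a b (Suc k) \<omega>) \<omega>"
    and "hit_time X L a b k \<omega> < hit_time X L a b (Suc k) \<omega>"
proof -
  let ?S = "hit_time X L a b k \<omega>" and ?T = "hit_time X L a b (Suc k) \<omega>"
  let ?P = "\<lambda>t. t > ?S \<and> kind (history t \<omega>) \<noteq> 0"
  have T: "?T = (LEAST t. ?P t)" by (rule hit_time_Suc)
  obtain u where "?P u" using assms by blast
  then have "?P ?T" unfolding T by (rule LeastI[of ?P])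
  moreover have "\<not> ?P u" if "u < ?T" for u
    using that unfolding T by (rule not_less_Least)
  ultimately show "?S < ?T" "next_hit ?S (?T - ?S) (hit_sign X L a b (Suc k) \<omega>) \<omega>"
    by (auto simp: next_hit_def hit_sign_eq simp del: hit_time.simps)
qed

lemma hit_time_of_next_hit:
  assumes "next_hit (hit_time X L a b k \<omega>) t e \<omega>" "e \<noteq> 0"
  shows "hit_time X L a b (Suc k) \<omega> = hit_time X L a b k \<omega> + t" "hit_sign X L a b (Suc k) \<omega> = e"
proof -
  show T: "hit_time X L a b (Suc k) \<omega> = hit_time X L a b k \<omega> + t"
    unfolding hit_time_Suc using assms
    by (intro Least_equality) (auto simp: next_hit_def not_less[symmetric])
  show "hit_sign X L a b (Suc k) \<omega> = e"
    unfolding hit_sign_eq T using assms by (simp add: next_hit_def)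
qed

lemma first_hit_event_iff:
  assumes "\<forall>m. \<exists>u>m. kind (history u \<omega>) \<noteq> 0" "c \<noteq> 0"
  shows "hit_sign X L a b 1 \<omega> = c \<and> hit_time X L a b 1 \<omega> = s \<longleftrightarrow> next_hit 0 s c \<omega>"
  using next_hit_of_hit_time(1)[OF assms(1), of 0] hit_time_of_next_hit[of 0 \<omega> s c] assms(2)
  by (auto simp del: hit_time.simps(2))

lemma two_hits_event_iff:
  assumes "\<forall>m. \<exists>u>m. kind (history u \<omega>) \<noteq> 0" "c \<noteq> 0" "e \<noteq> 0"
  shows "(hit_sign X L a b 1 \<omega> = c \<and> hit_sign X L a b 2 \<omega> = e
      \<and> hit_time X L a b 2 \<omega> - hit_time X L a b 1 \<omega> = t) \<and> hit_time X L a b 1 \<omega> = s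
    \<longleftrightarrow> next_hit 0 s c \<omega> \<and> next_hit s t e \<omega>"
  using first_hit_event_iff[OF assms(1,2), of s] next_hit_of_hit_time(1)[OF assms(1), of 1]
    hit_time_of_next_hit[of 1 \<omega> t e] assms(3)
  by (auto simp: numeral_2_eq_2 simp del: hit_time.simps(2))

text \<open>Applied to hitting times with \<open>h = 1\<close> and \<open>h = real\<close>; it turns the series of the preceding
  sections into probabilities and conditional expectations.\<close>

lemma expectation_nat_valued:
  fixes h :: "nat \<Rightarrow> real"
  assumes Z [measurable]: "Z \<in> measurable M (count_space UNIV)" and E [measurable]: "Measurable.pred M E"
    and h: "\<And>n. h n \<ge> 0" and S: "(\<lambda>n. h n * \<P>(\<omega> in M. E \<omega> \<and> Z \<omega> = n)) sums S"
  shows "(\<integral>\<omega>. h (Z \<omega>) * (if E \<omega> then 1 else 0) \<partial>M) = S"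
proof -
  define f where "f = (\<lambda>n \<omega>. h n * indicator {\<omega>\<in>space M. E \<omega> \<and> Z \<omega> = n} \<omega>)"
  have int: "integrable M (f n)" for n
    unfolding f_def by (intro integrable_mult_right integrable_real_indicator) (auto simp: emeasure_eq_measure)
  have If: "(\<integral>\<omega>. f n \<omega> \<partial>M) = h n * \<P>(\<omega> in M. E \<omega> \<and> Z \<omega> = n)" for n
    by (simp add: f_def)
  have nf: "norm (f n \<omega>) = f n \<omega>" for n \<omega> using h by (simp add: f_def)
  have fin: "summable (\<lambda>n. norm (f n \<omega>))" for \<omega>
    by (rule summable_finite[of "{Z \<omega>}"]) (auto simp: f_def)
  have "(\<lambda>n. \<integral>\<omega>. f n \<omega> \<partial>M) sums (\<integral>\<omega>. (\<Sum>n. f n \<omega>) \<partial>M)"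
  proof (rule sums_integral[OF int])
    show "AE \<omega> in M. summable (\<lambda>n. norm (f n \<omega>))" using fin by simp
    show "summable (\<lambda>n. \<integral>\<omega>. norm (f n \<omega>) \<partial>M)" unfolding nf If using S by (rule sums_summable)
  qed
  moreover have "(\<integral>\<omega>. (\<Sum>n. f n \<omega>) \<partial>M) = (\<integral>\<omega>. h (Z \<omega>) * (if E \<omega> then 1 else 0) \<partial>M)"
  proof (rule Bochner_Integration.integral_cong[OF refl])
    fix \<omega> assume "\<omega> \<in> space M"
    then show "(\<Sum>n. f n \<omega>) = h (Z \<omega>) * (if E \<omega> then 1 else 0)"
      by (subst suminf_finite[of "{Z \<omega>}"]) (auto simp: f_def indicator_def)
  qed
  ultimately have "(\<lambda>n. h n * \<P>(\<omega> in M. E \<omega> \<and> Z \<omega> = n)) sums (\<integral>\<omega>. h (Z \<omega>) * (if E \<omega> then 1 else 0) \<partial>M)"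
    unfolding If by simp
  then show ?thesis using S by (rule sums_unique2)
qed

lemma prob_nat_valued:
  assumes [measurable]: "Z \<in> measurable M (count_space UNIV)" "Measurable.pred M E"
    and S: "(\<lambda>n. \<P>(\<omega> in M. E \<omega> \<and> Z \<omega> = n)) sums S"
  shows "\<P>(\<omega> in M. E \<omega>) = S"
proof -
  have "\<P>(\<omega> in M. E \<omega>) = (\<integral>\<omega>. indicator {\<omega>\<in>space M. E \<omega>} \<omega> \<partial>M)" by simp
  also have "\<dots> = (\<integral>\<omega>. 1 * (if E \<omega> then 1 else 0) \<partial>M)"
    by (rule Bochner_Integration.integral_cong) (auto simp: indicator_def)
  also have "\<dots> = S"
    by (rule expectation_nat_valued[where h = "\<lambda>_. 1" and Z = Z]) (use S in simp_all)
  finally show ?thesis .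
qed

lemma hit_sums: "c = 1 \<or> c = - 1 \<Longrightarrow> (\<lambda>n. first_hit n c h) sums ev (hit_fps c h) 1"
  using summable_ev[of "1 :: real" "hit_fps c h"] hit_abs_conv[of h]
  by (auto simp: ev_def intro: summable_sums)

lemma init_prob_eq:
  assumes c: "c = 1 \<or> c = - 1"
  shows "\<P>(\<omega> in M. hit_sign X L a b 1 \<omega> = c) = ev (hit_fps c []) 1"
proof (rule prob_nat_valued[where Z = "hit_time X L a b 1"])
  have c0: "c \<noteq> 0" using c by auto
  have "\<P>(\<omega> in M. hit_sign X L a b 1 \<omega> = c \<and> hit_time X L a b 1 \<omega> = s) = \<P>(\<omega> in M. next_hit 0 s c \<omega>)" for s
  proof (rule prob_eq_AE)
    show "AE \<omega> in M. (hit_sign X L a b 1 \<omega> = c \<and> hit_time X L a b 1 \<omega> = s) \<longleftrightarrow> next_hit 0 s c \<omega>"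
      using AE_hits by (rule AE_mp) (intro AE_I2 impI first_hit_event_iff c0)
  qed measurable
  then show "(\<lambda>s. \<P>(\<omega> in M. hit_sign X L a b 1 \<omega> = c \<and> hit_time X L a b 1 \<omega> = s)) sums ev (hit_fps c []) 1"
    using hit_sums[OF c, of "[]"] by (simp add: prob_first_hit[OF c0])
qed measurable

lemma prob_transition_time:
  assumes c: "c = 1 \<or> c = - 1" and e: "e = 1 \<or> e = - 1"
  shows "\<P>(\<omega> in M. hit_sign X L a b 1 \<omega> = c \<and> hit_sign X L a b 2 \<omega> = e
      \<and> hit_time X L a b 2 \<omega> - hit_time X L a b 1 \<omega> = t)
    = ev (hit_fps c []) 1 * first_hit t e (word c)"
proof (rule prob_nat_valued[where Z = "hit_time X L a b 1"])
  have c0: "c \<noteq> 0" and e0: "e \<noteq> 0" using c e by auto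
  have "\<P>(\<omega> in M. (hit_sign X L a b 1 \<omega> = c \<and> hit_sign X L a b 2 \<omega> = e
      \<and> hit_time X L a b 2 \<omega> - hit_time X L a b 1 \<omega> = t) \<and> hit_time X L a b 1 \<omega> = s)
    = \<P>(\<omega> in M. next_hit 0 s c \<omega> \<and> next_hit s t e \<omega>)" for s
  proof (rule prob_eq_AE)
    show "AE \<omega> in M. ((hit_sign X L a b 1 \<omega> = c \<and> hit_sign X L a b 2 \<omega> = e
      \<and> hit_time X L a b 2 \<omega> - hit_time X L a b 1 \<omega> = t) \<and> hit_time X L a b 1 \<omega> = s)
      \<longleftrightarrow> next_hit 0 s c \<omega> \<and> next_hit s t e \<omega>"
      using AE_hits by (rule AE_mp) (intro AE_I2 impI two_hits_event_iff c0 e0)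
  qed measurable
  then show "(\<lambda>s. \<P>(\<omega> in M. (hit_sign X L a b 1 \<omega> = c \<and> hit_sign X L a b 2 \<omega> = e
      \<and> hit_time X L a b 2 \<omega> - hit_time X L a b 1 \<omega> = t) \<and> hit_time X L a b 1 \<omega> = s))
      sums (ev (hit_fps c []) 1 * first_hit t e (word c))"
    using sums_mult2[OF hit_sums[OF c, of "[]"]] by (simp add: prob_two_hits[OF c0 e0])
qed measurable

lemma prob_transition:
  assumes c: "c = 1 \<or> c = - 1" and e: "e = 1 \<or> e = - 1"
  shows "\<P>(\<omega> in M. hit_sign X L a b 1 \<omega> = c \<and> hit_sign X L a b 2 \<omega> = e)
    = ev (hit_fps c []) 1 * ev (hit_fps e (word c)) 1"
proof (rule prob_nat_valued[where Z = "\<lambda>\<omega>. hit_time X L a b 2 \<omega> - hit_time X L a b 1 \<omega>"])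
  show "(\<lambda>t. \<P>(\<omega> in M. (hit_sign X L a b 1 \<omega> = c \<and> hit_sign X L a b 2 \<omega> = e)
      \<and> hit_time X L a b 2 \<omega> - hit_time X L a b 1 \<omega> = t))
      sums (ev (hit_fps c []) 1 * ev (hit_fps e (word c)) 1)"
    using sums_mult[OF hit_sums[OF e, of "word c"]] by (simp only: conj_assoc prob_transition_time[OF c e])
qed measurable

lemma mean_time_sums:
  assumes e: "e = 1 \<or> e = - 1"
  shows "(\<lambda>n. real n * first_hit n e h) sums mean_time e h"
proof -
  have "abs_conv (fps_deriv (hit_fps e h))"
    by (intro abs_conv_of_conv_radius conv_radius_gt_1_intros hit_radius e)
  from summable_sums[OF summable_ev[OF _ this, of "1 :: real"]]
  have "(\<lambda>n. real (Suc n) * first_hit (Suc n) e h) sums mean_time e h"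
    by (simp add: mean_time_def ev_def del: first_hit.simps)
  then show ?thesis by (subst (asm) sums_Suc_iff) (simp del: first_hit.simps(2))
qed

lemma first_hit_from_suffix:
  "xs \<noteq> [] \<Longrightarrow> xs @ h = word c \<Longrightarrow> c = 1 \<or> c = - 1 \<Longrightarrow> first_hit (length xs) c h > 0"
proof (induction xs arbitrary: h rule: rev_induct)
  case (snoc x ys)
  have kc: "kind (word c) = c" using snoc.prems(3) by auto
  show ?case
  proof (cases "ys = []")
    case True
    then have "kind (x # h) = c" using snoc.prems kc by simp
    then show ?thesis using first_hit_now[of x h] snoc.prems(3) True by (auto simp del: first_hit.simps)
  next
    case False
    have "length (word c) = L" using snoc.prems(3) len by auto
    moreover have "length (word c) = length ys + Suc (length h)"
      using snoc.prems(2)[symmetric] by simp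
    ultimately have "kind (x # h) = 0" using False by (intro kind_short) auto
    from first_hit_step[OF this, of "length ys" c] snoc.IH[of "x # h"] False snoc.prems
    show ?thesis by (simp del: first_hit.simps)
  qed
qed simp

lemma init_prob_pos:
  assumes c: "c = 1 \<or> c = - 1" shows "ev (hit_fps c []) (1 :: real) > 0"
proof -
  have "word c \<noteq> []" using c len L1 by auto
  from first_hit_from_suffix[OF this _ c, of "[]"] have "first_hit (length (word c)) c [] > 0" by simp
  then show ?thesis
    using ev_1_pos_iff[of "hit_fps c []"] hit_abs_conv[of "[]"] first_hit_nonneg c by auto
qed

lemma stay_prob_eq: "stay_prob M X L a b = stay_pr"
proof -
  have *: "stay_prob M X L a b = \<P>(\<omega> in M. hit_sign X L a b 1 \<omega> = 1 \<and> hit_sign X L a b 2 \<omega> = 1)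
      / \<P>(\<omega> in M. hit_sign X L a b 1 \<omega> = 1)"
    unfolding stay_prob_def cond_prob_def by (simp only: conj_commute)
  have i: "\<P>(\<omega> in M. hit_sign X L a b 1 \<omega> = 1) = ev (hit_fps 1 []) 1"
    by (rule init_prob_eq) simp
  have t: "\<P>(\<omega> in M. hit_sign X L a b 1 \<omega> = 1 \<and> hit_sign X L a b 2 \<omega> = 1)
      = ev (hit_fps 1 []) 1 * ev (hit_fps 1 (word 1)) 1"
    by (rule prob_transition) simp_all
  show ?thesis unfolding * i t using init_prob_pos[of 1] by (simp add: stay_pr_def)
qed

lemma mu_eq:
  assumes c: "c = 1 \<or> c = - 1" and e: "e = 1 \<or> e = - 1"
  shows "mu M X L a b c e = mean_time e (word c)"
proof -
  let ?T = "\<lambda>k. hit_time X L a b k" and ?Y = "\<lambda>k. hit_sign X L a b k"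
  have "(\<integral>\<omega>. (real (?T 2 \<omega>) - real (?T 1 \<omega>)) * indicator {\<omega>. ?Y 2 \<omega> = e} \<omega> * indicator {\<omega>. ?Y 1 \<omega> = c} \<omega> \<partial>M)
      = (\<integral>\<omega>. real (?T 2 \<omega> - ?T 1 \<omega>) * (if ?Y 1 \<omega> = c \<and> ?Y 2 \<omega> = e then 1 else 0) \<partial>M)"
  proof (rule integral_cong_AE)
    show "AE \<omega> in M. (real (?T 2 \<omega>) - real (?T 1 \<omega>)) * indicator {\<omega>. ?Y 2 \<omega> = e} \<omega> * indicator {\<omega>. ?Y 1 \<omega> = c} \<omega>
      = real (?T 2 \<omega> - ?T 1 \<omega>) * (if ?Y 1 \<omega> = c \<and> ?Y 2 \<omega> = e then 1 else 0)"
      using AE_hits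
    proof (rule AE_mp, intro AE_I2 impI)
      fix \<omega> assume "\<forall>m. \<exists>u>m. kind (history u \<omega>) \<noteq> 0"
      from next_hit_of_hit_time(2)[OF this, of 1] have "?T 1 \<omega> \<le> ?T 2 \<omega>"
        by (simp add: numeral_2_eq_2 del: hit_time.simps)
      then show "(real (?T 2 \<omega>) - real (?T 1 \<omega>)) * indicator {\<omega>. ?Y 2 \<omega> = e} \<omega> * indicator {\<omega>. ?Y 1 \<omega> = c} \<omega>
        = real (?T 2 \<omega> - ?T 1 \<omega>) * (if ?Y 1 \<omega> = c \<and> ?Y 2 \<omega> = e then 1 else 0)"
        by (auto simp: indicator_def of_nat_diff simp del: hit_time.simps)
    qed
  qed (unfold indicator_def, measurable)
  also have "\<dots> = ev (hit_fps c []) 1 * mean_time e (word c)"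
  proof (rule expectation_nat_valued[where h = real and Z = "\<lambda>\<omega>. ?T 2 \<omega> - ?T 1 \<omega>"])
    show "(\<lambda>n. real n * \<P>(\<omega> in M. (?Y 1 \<omega> = c \<and> ?Y 2 \<omega> = e) \<and> ?T 2 \<omega> - ?T 1 \<omega> = n))
        sums (ev (hit_fps c []) 1 * mean_time e (word c))"
      using sums_mult[OF mean_time_sums[OF e, of "word c"], of "ev (hit_fps c []) 1"]
      by (simp only: conj_assoc prob_transition_time[OF c e] mult.left_commute)
    show "0 \<le> real n" for n by simp
  qed measurable
  finally show ?thesis
    using init_prob_pos[OF c] unfolding mu_def init_prob_eq[OF c] by simp
qed

end

section \<open>The expansion of the win probability difference\<close>

theorem theorem1p1:
  fixes M :: "'a measure" and X :: "nat \<Rightarrow> 'a \<Rightarrow> bool"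
    and L :: nat and a b :: "bool list" and p q :: real
  assumes "symmetric_bernoulli M X"
    and "L \<ge> 1" and "length a = L" and "length b = L"
    and "b \<notin> {a, rev a, conjugate a, rev (conjugate a)}"
  defines "p \<equiv> stay_prob M X L a b" and "q \<equiv> 1 - p"
  shows "(\<lambda>n. phi M X a b n
            - ((init_prob M X L a b 1 - init_prob M X L a b (- 1)) * 2 ^ L
                + mu M X L a b 1 (- 1) - mu M X L a b (- 1) 1)
              / sqrt (2 ^ (L + 2) * p * q * pi * real n))
         \<in> o(\<lambda>n. 1 / sqrt (real n))"
proof -
  interpret symmetric_bernoulli M X by fact
  interpret word_race M X L a b
    by unfold_locales (use assms in auto)
  define K where "K = (init_prob M X L a b 1 - init_prob M X L a b (- 1)) * 2 ^ L
                + mu M X L a b 1 (- 1) - mu M X L a b (- 1) 1"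
  define c where "c = sqrt (2 ^ (L + 2) * p * q * pi)"
  have "rev b \<notin> {rev (rev a), map Not (rev a), rev (map Not (rev a))}"
  proof
    assume "rev b \<in> {rev (rev a), map Not (rev a), rev (map Not (rev a))}"
    then have "b = rev a \<or> b = conjugate a \<or> b = rev (conjugate a)"
      by (auto simp: rev_map rev_swap conjugate_def)
    then show False using assms(5) by auto
  qed
  note lim = sign_asymptotics(2)[OF this]
  have radicand: "4 * stay_pr * (1 - stay_pr) * 2 ^ L * pi = 2 ^ (L + 2) * p * q * pi"
    by (simp add: p_def q_def stay_prob_eq)
  have numerator: "(ev (hit_fps 1 []) 1 - ev (hit_fps (- 1) []) 1) * 2 ^ L
      + (mean_time (- 1) (rev a) - mean_time 1 (rev b)) = K"
    by (simp add: K_def init_prob_def init_prob_eq mu_eq del: One_nat_def)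
  have "(\<lambda>n. sqrt (real n) * phi M X a b n) \<longlonglongrightarrow> K / c"
    using lim unfolding radicand numerator phi_eq c_def .
  then have "(\<lambda>n. sqrt (real n) * phi M X a b n - K / c) \<longlonglongrightarrow> 0"
    by (simp add: LIM_zero_iff)
  moreover have "\<forall>\<^sub>F n in sequentially. sqrt (real n) * phi M X a b n - K / c
      = (phi M X a b n - K / sqrt (2 ^ (L + 2) * p * q * pi * real n)) / (1 / sqrt (real n))"
    using eventually_gt_at_top[of 0]
  proof eventually_elim
    case (elim n)
    have "sqrt (2 ^ (L + 2) * p * q * pi * real n) = c * sqrt (real n)"
      unfolding c_def by (rule real_sqrt_mult)
    then show ?case using elim by (simp add: field_simps)
  qed
  ultimately have "(\<lambda>n. (phi M X a b n - K / sqrt (2 ^ (L + 2) * p * q * pi * real n)) / (1 / sqrt (real n)))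
      \<longlonglongrightarrow> 0"
    by (rule Lim_transform_eventually)
  then show ?thesis
    unfolding K_def[symmetric]
    by (intro smalloI_tendsto) (auto intro: eventually_mono[OF eventually_gt_at_top[of 0]])
qed

end
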